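(* Let $X$ be a compact toric variety of complex dimension $N$, let $n\ge 3$, let $\beta\in H_2(X)$ with $\beta\neq 0$, and let $\gamma_1,\dots,\gamma_n\in\Omega^*_{\rm trop}(X)$ be representatives (of even degree) of the Poincaré duals of (tropicalized complex) cycles $C_1,\dots,C_n$. Let $\vec\Gamma$ be a discrete type of genus zero tropical curves of degree $\beta$ in $X$ with $n$ marked points, and let $\Gamma$ be the associated special tree. Then the contribution of $\vec\Gamma$ to the tropical Gromov--Witten invariant equals the amplitude on $\Gamma$ in the A-model higher topological quantum mechanics: $$\int_{\mathcal{M}_{0,n}(X,\beta;\vec\Gamma)}\ \bigwedge_{\alpha=1}^n {\rm ev}_\alpha^*\gamma_\alpha \;=\;\mathcal{A}_\Gamma\bigl(\mathcal{O}_{\gamma_1},\dots,\mathcal{O}_{\gamma_n};\ \underbrace{\Psi_{b_1},\dots,\Psi_{b_1}}_{d_1},\dots,\underbrace{\Psi_{b_B},\dots,\Psi_{b_B}}_{d_B}\bigr),$$ where $B_X=\{\vec b_1,\dots,\vec b_B\}$, $B=|B_X|$, and the number $d_a$ of divisor states $\Psi_{b_a}$ is the tropical intersection number $d_a=\beta\cdot H_{b_a}$.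
   Context: **Toric data.** $X$ is viewed as a compactification of $(\mathbb{C}^* )^N=\mathbb{R}^N\times\mathbb{T}^N$ (radial coordinates $r^j$, angular coordinates $\phi^j$) by toric hyperplanes at infinity; $B_X\subset\mathbb{Z}^N$ is the finite set of primitive integer normal vectors of the compactifying hyperplanes, and $H_b$ is the hyperplane with normal $\vec b$. $\Omega^*_{\rm trop}(X)$ is the space of $U(1)^N$-invariant smooth differential forms on $(\mathbb{C}^* )^N$ that extend to the compactification $X$. Such a form is written $\gamma(\vec r,d\vec r,d\vec\phi)$. **Tropical curves.** A discrete type $\vec\Gamma$ of genus zero tropical curves with $n$ marked points is a connected tree with vertices of valence $1,2,3$ only, whose 2-valent vertices are labelled $1,\dots,n$ (the marked points), with oriented edges and an integer vector $\vec m_e\in\mathbb{Z}^N$ on each edge such that: every external edge (edge at a 1-valent vertex, or leaf) is oriented away from its leaf and has $\vec m_e\in B_X$; every other (internal) edge has $\vec m_e\ne 0$; at every 2- or 3-valent vertex the sum of $\vec m_e$ over incoming edges equals the sum over outgoing edges. Types are identified under simultaneously reversing an internal edge and changing the sign of $\vec m_e$. The degree $\beta$ is characterised by: $\beta\cdot H_b$ is the number of external edges with $\vec m_e=\vec b$, for each $\vec b\in B_X$. $I(\Gamma)$ denotes the set (or number) of internal edges. After choosing a non-leaf vertex $R$ (the sink), the moduli space of curves of type $\vec\Gamma$ is $$\mathcal{M}_{0,n}(X,\beta;\vec\Gamma)=\mathbb{R}^N\times\mathbb{T}^N\times(\mathbb{R}^+\times S^1)^{I(\Gamma)}$$ with coordinates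 $(\vec r_c,\vec\phi_c)$ (sink location) and $(\tau_e,\varphi_e)$ (length and twist of each internal edge). The evaluation map ${\rm ev}_\alpha:\mathcal{M}_{0,n}(X,\beta;\vec\Gamma)\to X$ at a vertex $\alpha$ sends this to $\vec r_\alpha=\vec r_c+\sum_{e}\pm\vec m_e\tau_e$, $\vec\phi_\alpha=\vec\phi_c+\sum_e\pm\vec m_e\varphi_e$, the sum being over the edges of the unique path from $R$ to $\alpha$, with sign $+$ if the edge is oriented along the path and $-$ otherwise. Each factor $\mathbb{R}^+\times S^1$ is oriented by $d\varphi\wedge d\tau$, and the sink location factor is oriented as $X$. **A-model.** $V$ is the span of symbols $|\omega,\vec m\rangle$ (linear in $\omega$), $\omega\in\Omega^*_{\rm trop}(X)$, $\vec m\in\mathbb{Z}^N$, with parity $\deg\omega$ mod 2. With $\iota^R_{\vec m}$, $\iota^\Phi_{\vec m}$ the contractions with $m^i\partial_{r^i}$ and $m^i\partial_{\phi^i}$: $Q|\omega,\vec m\rangle=|d\omega,\vec m\rangle$ with $d=\sum dr^i\partial_{r^i}$, $G_+|\omega,\vec m\rangle=|\iota^R_{\vec m}\omega,\vec m\rangle$, $G_-|\omega,\vec m\rangle=|\iota^\Phi_{\vec m}\omega,\vec m\rangle$, $g(|\omega_1,\vec m_1\rangle,|\omega_2,\vec m_2\rangle)=\delta_{\vec m_1+\vec m_2,\vec 0}\int_X\omega_1\wedge\omega_2$, $\mu_2(|\omega_1,\vec m_1\rangle,|\omega_2,\vec m_2\rangle)=|\omega_1\wedge\omega_2,\vec m_1+\vec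 m_2\rangle$. Put $H=QG_++G_+Q$, so $e^{-tH}$ acts on $|\omega,\vec m\rangle$ by pulling $\omega$ back along $\vec r\mapsto\vec r-\vec m t$, and $K=\int_0^\infty dt\,e^{-tH}G_+$. Divisor states: $\Psi_b=|1,\vec b\rangle$ for $\vec b\in B_X$. Evaluation observables: $\mathcal{O}_\gamma|\omega,\vec m\rangle=|\gamma\wedge\omega,\vec m\rangle$. **Amplitudes.** The special tree $\Gamma$ associated to $\vec\Gamma$ is the underlying tree with the sink $R$ and all edges directed toward $R$, forgetting integer vectors and moduli. The amplitude $\mathcal{A}_\Gamma$ is computed by placing: the state $\Psi_b$ on each leaf whose external edge carried the vector $\vec b$; the observable $\mathcal{O}_{\gamma_\alpha}$ at the 2-valent vertex labelled $\alpha$; the operator $2\pi KG_-$ on each internal edge and the identity on each external edge; the product $\mu_2$ at each non-sink 3-valent vertex; and composing these maps along the directed tree. At the sink one applies $\mu_3^0(u,v,w)=g(u,\mu_2(v,w))$ to the three incoming vectors if $R$ is 3-valent, or $g(v,\mathcal{O}_{\gamma_\alpha}w)$ to the two incoming vectors if $R$ is the 2-valent vertex $\alpha$. The result does not depend on the choice of sink. *)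

theory Defs
  imports "HOL-Analysis.Analysis"
begin

section \<open>Differential forms\<close>

text \<open>A (mixed-degree) form assigns to a point the values of its components: the degree-\<open>k\<close>
  component is evaluated on lists of \<open>k\<close> tangent vectors.  Multilinearity, antisymmetry and
  smoothness are not built into the type; the forms in \<open>\<Omega>\<^sub>t\<^sub>r\<^sub>o\<^sub>p(X)\<close> below have them because they
  are generated from smooth functions and differentials by sums and wedge products.\<close>

type_synonym ('p, 'v) form = "'p \<Rightarrow> 'v list \<Rightarrow> real"

definition fun_form :: "('p \<Rightarrow> real) \<Rightarrow> ('p, 'v) form" where
  "fun_form f = (\<lambda>x vs. if vs = [] then f x else 0)"

definition add_form :: "('p, 'v) form \<Rightarrow> ('p, 'v) form \<Rightarrow> ('p, 'v) form" where
  "add_form \<omega> \<eta> = (\<lambda>x vs. \<omega> x vs + \<eta> x vs)"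

definition scale_form :: "real \<Rightarrow> ('p, 'v) form \<Rightarrow> ('p, 'v) form" where
  "scale_form a \<omega> = (\<lambda>x vs. a * \<omega> x vs)"

definition has_form_degree :: "nat \<Rightarrow> ('p, 'v) form \<Rightarrow> bool" where
  "has_form_degree k \<omega> \<longleftrightarrow> (\<forall>x vs. length vs \<noteq> k \<longrightarrow> \<omega> x vs = 0)"

text \<open>The sign of the shuffle that moves the positions in \<open>S\<close> in front of the remaining ones.\<close>

definition shuffle_sign :: "nat set \<Rightarrow> nat \<Rightarrow> real" where
  "shuffle_sign S k = (-1) ^ card {(i, j). i < k \<and> j < i \<and> i \<in> S \<and> j \<notin> S}"

definition wedge :: "('p, 'v) form \<Rightarrow> ('p, 'v) form \<Rightarrow> ('p, 'v) form"  (infixr "\<and>\<^sub>f" 70) where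
  "\<omega> \<and>\<^sub>f \<eta> = (\<lambda>x vs. \<Sum>S\<in>Pow {..<length vs}.
      shuffle_sign S (length vs) * \<omega> x (nths vs S) * \<eta> x (nths vs (- S)))"

definition wedge_list :: "('p, 'v) form list \<Rightarrow> ('p, 'v) form" where
  "wedge_list \<omega>s = foldr wedge \<omega>s (fun_form (\<lambda>_. 1))"

definition contract :: "'v \<Rightarrow> ('p, 'v) form \<Rightarrow> ('p, 'v) form" where
  "contract v \<omega> = (\<lambda>x vs. \<omega> x (v # vs))"

definition pullback ::
    "('q \<Rightarrow> 'p) \<Rightarrow> ('q \<Rightarrow> 'w \<Rightarrow> 'v) \<Rightarrow> ('p, 'v) form \<Rightarrow> ('q, 'w) form" where
  "pullback f Df \<omega> = (\<lambda>x vs. \<omega> (f x) (map (Df x) vs))"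

definition ext_d :: "('a::real_normed_vector, 'a) form \<Rightarrow> ('a, 'a) form" where
  "ext_d \<omega> = (\<lambda>x vs. \<Sum>i<length vs. (-1) ^ i *
      frechet_derivative (\<lambda>y. \<omega> y (take i vs @ drop (Suc i) vs)) (at x) (vs ! i))"

text \<open>An arbitrary enumeration of a finite set.  It is used only to list pairs of coordinates,
  so the orientations defined from it do not depend on the choice.\<close>

definition enum_of :: "'a set \<Rightarrow> 'a list" where
  "enum_of A = (SOME xs. distinct xs \<and> set xs = A)"


section \<open>Toric data\<close>

text \<open>Points of the universal cover of \<open>(\<complex>\<^sup>*)\<^sup>N = \<real>\<^sup>N \<times> \<T>\<^sup>N\<close>, as pairs \<open>(r, \<phi>)\<close> with
  \<open>N = CARD('n)\<close>.  The holomorphic coordinates of the torus are \<open>exp (r\<^sup>j + \<i> \<phi>\<^sup>j)\<close>.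
  A \<open>U(1)\<^sup>N\<close>-invariant form on \<open>(\<complex>\<^sup>*)\<^sup>N\<close> is the same as a form on the cover that is invariant under all
  translations of \<open>\<phi>\<close>.\<close>

type_synonym 'n pt = "(real ^ 'n) \<times> (real ^ 'n)"
type_synonym 'n tform = "('n pt, 'n pt) form"

definition ivec :: "int ^ 'n \<Rightarrow> real ^ 'n" where
  "ivec m = (\<chi> i. of_int (m $ i))"

definition rational_cone :: "(real ^ 'n) set \<Rightarrow> bool" where
  "rational_cone \<sigma> \<longleftrightarrow> (\<exists>A. finite A \<and> \<sigma> = convex_cone hull (ivec ` A))"

definition strongly_convex :: "(real ^ 'n) set \<Rightarrow> bool" where
  "strongly_convex \<sigma> \<longleftrightarrow> (\<forall>x. x \<in> \<sigma> \<and> - x \<in> \<sigma> \<longrightarrow> x = 0)"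

text \<open>Complete fans in \<open>\<int>\<^sup>N\<close> are the combinatorial data of compact (normal, possibly singular)
  toric varieties of complex dimension \<open>N\<close>.\<close>

definition complete_fan :: "(real ^ 'n) set set \<Rightarrow> bool" where
  "complete_fan F \<longleftrightarrow> finite F
     \<and> (\<forall>\<sigma>\<in>F. rational_cone \<sigma> \<and> strongly_convex \<sigma>)
     \<and> (\<forall>\<sigma>\<in>F. \<forall>\<tau>. \<tau> face_of \<sigma> \<and> \<tau> \<noteq> {} \<longrightarrow> \<tau> \<in> F)
     \<and> (\<forall>\<sigma>\<in>F. \<forall>\<tau>\<in>F. (\<sigma> \<inter> \<tau>) face_of \<sigma>)
     \<and> \<Union>F = UNIV"

definition primitive :: "int ^ 'n \<Rightarrow> bool" where
  "primitive b \<longleftrightarrow> (\<forall>k. (\<forall>i. k dvd b $ i) \<longrightarrow> k dvd 1)"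

text \<open>The set \<open>B\<^sub>X\<close>.  The divisor \<open>H\<^sub>b\<close> is reached as \<open>r\<close> goes to infinity in the direction \<open>- b\<close>,
  so \<open>b\<close> is the inward normal of the corresponding facet at infinity.\<close>

definition normals :: "(real ^ 'n) set set \<Rightarrow> (int ^ 'n) set" where
  "normals F = {b. primitive b \<and> convex_cone hull {ivec b} \<in> F}"

text \<open>\<open>H\<^sub>2(X)\<close>, a class \<open>\<beta>\<close> being given by its intersection numbers \<open>\<beta> b = \<beta> \<cdot> H\<^sub>b\<close>; the linear
  equivalences \<open>\<Sum>\<^sub>b b\<^sup>j H\<^sub>b \<sim> 0\<close> are the only relations between these numbers.\<close>

definition H2 :: "(real ^ 'n) set set \<Rightarrow> (int ^ 'n \<Rightarrow> int) set" where
  "H2 F = {\<beta>. (\<forall>b. b \<notin> normals F \<longrightarrow> \<beta> b = 0) \<and> (\<forall>j. (\<Sum>b\<in>normals F. \<beta> b * b $ j) = 0)}"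

definition monomial :: "int ^ 'n \<Rightarrow> 'n::finite pt \<Rightarrow> complex" where
  "monomial u = (\<lambda>(r, \<phi>). exp (Complex (ivec u \<bullet> r) (ivec u \<bullet> \<phi>)))"

text \<open>Exponents of the monomials that are regular on the affine chart of \<open>\<sigma>\<close>.\<close>

definition dual_monoid :: "(real ^ 'n) set \<Rightarrow> (int ^ 'n) set" where
  "dual_monoid \<sigma> = {u. \<forall>x\<in>\<sigma>. 0 \<le> ivec u \<bullet> x}"

text \<open>Smoothness of a function of complex coordinates indexed by \<open>'i\<close>: all iterated real partial
  derivatives exist and are continuous (for the product topology).  It is applied below
  only to points supported on a finite set \<open>U\<close> of indices, i.e. to functions on \<open>\<complex>\<^sup>U\<close>.\<close>

coinductive smooth :: "(('i \<Rightarrow> complex) \<Rightarrow> real) \<Rightarrow> bool" where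
  "\<lbrakk> continuous_on UNIV f;
     \<forall>i x. (\<lambda>z. f (x(i := z))) differentiable (at (x i));
     \<forall>i c. smooth (\<lambda>x. frechet_derivative (\<lambda>z. f (x(i := z))) (at (x i)) c) \<rbrakk>
   \<Longrightarrow> smooth f"

text \<open>Smooth forms on the affine toric chart of \<open>\<sigma>\<close>, written on the cover of the open torus.  Finitely
  many regular monomials embed the chart as a closed subset of \<open>\<complex>\<^sup>U\<close>, and a smooth form on the chart
  is the restriction of a smooth form \<open>\<Sum> f dx\<^sub>1 \<and> \<dots> \<and> dx\<^sub>p\<close> on \<open>\<complex>\<^sup>U\<close>, the \<open>x\<^sub>i\<close> being real and
  imaginary parts of coordinates.  If \<open>\<sigma>\<close> is generated by a basis of \<open>\<int>\<^sup>N\<close>, the chart is \<open>\<complex>\<^sup>N\<close>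
  and these are its smooth forms in the usual sense; if \<open>\<sigma> = {0}\<close>, it is \<open>(\<complex>\<^sup>*)\<^sup>N\<close>.\<close>

inductive_set chart_forms :: "(real ^ 'n) set \<Rightarrow> 'n tform set" for \<sigma> where
  smooth_fun: "\<lbrakk> finite U; U \<subseteq> dual_monoid \<sigma>; smooth f \<rbrakk>
    \<Longrightarrow> fun_form (\<lambda>x. f (\<lambda>u. if u \<in> U then monomial u x else 0)) \<in> chart_forms \<sigma>"
| d_Re: "u \<in> dual_monoid \<sigma> \<Longrightarrow> ext_d (fun_form (\<lambda>x. Re (monomial u x))) \<in> chart_forms \<sigma>"
| d_Im: "u \<in> dual_monoid \<sigma> \<Longrightarrow> ext_d (fun_form (\<lambda>x. Im (monomial u x))) \<in> chart_forms \<sigma>"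
| wedge: "\<lbrakk> \<omega> \<in> chart_forms \<sigma>; \<eta> \<in> chart_forms \<sigma> \<rbrakk> \<Longrightarrow> \<omega> \<and>\<^sub>f \<eta> \<in> chart_forms \<sigma>"
| add: "\<lbrakk> \<omega> \<in> chart_forms \<sigma>; \<eta> \<in> chart_forms \<sigma> \<rbrakk> \<Longrightarrow> add_form \<omega> \<eta> \<in> chart_forms \<sigma>"

text \<open>\<open>\<Omega>\<^sup>*\<^sub>t\<^sub>r\<^sub>o\<^sub>p(X)\<close>.  The affine charts of the cones of \<open>F\<close> cover \<open>X\<close>.\<close>

definition trop_forms :: "(real ^ 'n) set set \<Rightarrow> 'n tform set" where
  "trop_forms F = {\<omega>. (\<forall>r \<phi> \<phi>' vs. \<omega> (r, \<phi>) vs = \<omega> (r, \<phi>') vs) \<and> (\<forall>\<sigma>\<in>F. \<omega> \<in> chart_forms \<sigma>)}"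

text \<open>Integration over \<open>X\<close>, i.e. over the dense open torus, with its complex
  orientation \<open>dr\<^sup>1 \<and> d\<phi>\<^sup>1 \<and> \<dots> \<and> dr\<^sup>N \<and> d\<phi>\<^sup>N\<close>.\<close>

definition torus_measure :: "'n::finite pt measure" where
  "torus_measure = lborel \<Otimes>\<^sub>M restrict_space lborel {\<phi>. \<forall>i. 0 \<le> \<phi> $ i \<and> \<phi> $ i < 2 * pi}"

definition torus_frame :: "'n::finite pt list" where
  "torus_frame = concat (map (\<lambda>j. [(axis j 1, 0), (0, axis j 1)]) (enum_of UNIV))"

definition X_integral :: "'n::finite tform \<Rightarrow> real" where
  "X_integral \<omega> = (LINT x | torus_measure. \<omega> x torus_frame)"

text \<open>A tropicalized cycle of real dimension \<open>k\<close> enters through its integration functional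
  \<open>\<omega> \<mapsto> \<integral>\<^sub>C \<omega>\<close> on \<open>\<Omega>\<^sup>*\<^sub>t\<^sub>r\<^sub>o\<^sub>p(X)\<close>; by Stokes, the functional of a cycle vanishes on exact forms.\<close>

definition trop_cycle :: "(real ^ 'n) set set \<Rightarrow> nat \<Rightarrow> ('n tform \<Rightarrow> real) \<Rightarrow> bool" where
  "trop_cycle F k C \<longleftrightarrow>
     (\<forall>\<omega>\<in>trop_forms F. \<forall>\<eta>\<in>trop_forms F. C (add_form \<omega> \<eta>) = C \<omega> + C \<eta>)
     \<and> (\<forall>\<omega>\<in>trop_forms F. \<forall>a. C (scale_form a \<omega>) = a * C \<omega>)
     \<and> (\<forall>\<omega>\<in>trop_forms F. \<forall>l. has_form_degree l \<omega> \<and> l \<noteq> k \<longrightarrow> C \<omega> = 0)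
     \<and> (\<forall>\<omega>\<in>trop_forms F. C (ext_d \<omega>) = 0)"

definition represents_PD ::
    "(real ^ 'n) set set \<Rightarrow> nat \<Rightarrow> ('n tform \<Rightarrow> real) \<Rightarrow> 'n tform \<Rightarrow> bool" where
  "represents_PD F k C \<gamma> \<longleftrightarrow>
     \<gamma> \<in> trop_forms F \<and> has_form_degree (2 * CARD('n) - k) \<gamma> \<and> ext_d \<gamma> = (\<lambda>_ _. 0)
     \<and> (\<forall>\<eta>\<in>trop_forms F. ext_d \<eta> = (\<lambda>_ _. 0) \<longrightarrow> X_integral (\<gamma> \<and>\<^sub>f \<eta>) = C \<eta>)"


section \<open>Tropical curves\<close>

text \<open>The pair \<open>(u, w)\<close> is an edge oriented from \<open>u\<close> to \<open>w\<close>.  A type modulo reversal of internal edges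
  is given by any of its representatives.\<close>

record ('v, 'n::finite) tropical_type =
  verts :: "'v set"
  edges :: "('v \<times> 'v) set"
  mvec :: "'v \<times> 'v \<Rightarrow> int ^ 'n"
  mark :: "nat \<Rightarrow> 'v"

definition neighbors :: "('v, 'n::finite, 'z) tropical_type_scheme \<Rightarrow> 'v \<Rightarrow> 'v set" where
  "neighbors G v = {w. (v, w) \<in> edges G \<or> (w, v) \<in> edges G}"

definition valence :: "('v, 'n::finite, 'z) tropical_type_scheme \<Rightarrow> 'v \<Rightarrow> nat" where
  "valence G v = card {e \<in> edges G. fst e = v \<or> snd e = v}"

definition leaves :: "('v, 'n::finite, 'z) tropical_type_scheme \<Rightarrow> 'v set" where
  "leaves G = {v \<in> verts G. valence G v = 1}"

definition external_edges :: "('v, 'n::finite, 'z) tropical_type_scheme \<Rightarrow> ('v \<times> 'v) set" where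
  "external_edges G = {e \<in> edges G. fst e \<in> leaves G \<or> snd e \<in> leaves G}"

definition internal_edges :: "('v, 'n::finite, 'z) tropical_type_scheme \<Rightarrow> ('v \<times> 'v) set" where
  "internal_edges G = edges G - external_edges G"

definition simple_path :: "('v, 'n::finite, 'z) tropical_type_scheme \<Rightarrow> 'v \<Rightarrow> 'v list \<Rightarrow> 'v \<Rightarrow> bool" where
  "simple_path G u xs w \<longleftrightarrow> xs \<noteq> [] \<and> hd xs = u \<and> last xs = w \<and> distinct xs \<and> set xs \<subseteq> verts G
     \<and> (\<forall>i. Suc i < length xs \<longrightarrow> xs ! Suc i \<in> neighbors G (xs ! i))"

definition is_tree :: "('v, 'n::finite, 'z) tropical_type_scheme \<Rightarrow> bool" where
  "is_tree G \<longleftrightarrow> finite (verts G) \<and> verts G \<noteq> {}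
     \<and> edges G \<subseteq> verts G \<times> verts G
     \<and> (\<forall>u w. (u, w) \<in> edges G \<longrightarrow> u \<noteq> w \<and> (w, u) \<notin> edges G)
     \<and> (\<forall>u\<in>verts G. \<forall>w\<in>verts G. \<exists>!xs. simple_path G u xs w)"

definition discrete_type ::
    "(real ^ 'n) set set \<Rightarrow> nat \<Rightarrow> ('v, 'n::finite) tropical_type \<Rightarrow> bool" where
  "discrete_type F n G \<longleftrightarrow> is_tree G
     \<and> (\<forall>v\<in>verts G. valence G v \<in> {1, 2, 3})
     \<and> bij_betw (mark G) {1..n} {v \<in> verts G. valence G v = 2}
     \<and> (\<forall>e\<in>external_edges G. snd e \<notin> leaves G \<and> mvec G e \<in> normals F)
     \<and> (\<forall>e\<in>internal_edges G. mvec G e \<noteq> 0)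
     \<and> (\<forall>v\<in>verts G - leaves G.
          (\<Sum>e | e \<in> edges G \<and> snd e = v. mvec G e) = (\<Sum>e | e \<in> edges G \<and> fst e = v. mvec G e))"

definition has_degree ::
    "(real ^ 'n) set set \<Rightarrow> ('v, 'n::finite) tropical_type \<Rightarrow> (int ^ 'n \<Rightarrow> int) \<Rightarrow> bool" where
  "has_degree F G \<beta> \<longleftrightarrow>
     (\<forall>b\<in>normals F. \<beta> b = int (card {e \<in> external_edges G. mvec G e = b}))"


section \<open>Moduli space and evaluation maps\<close>

text \<open>A point consists of the sink location and, for every internal edge \<open>e\<close>, the pair
  \<open>(\<tau>\<^sub>e, \<phi>\<^sub>e)\<close> of its length and twist.\<close>

type_synonym ('v, 'n) mpt = "'n pt \<times> ('v \<times> 'v \<Rightarrow> real \<times> real)"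

definition step :: "('v, 'n::finite) tropical_type \<Rightarrow> ('v \<times> 'v \<Rightarrow> real \<times> real) \<Rightarrow> 'v \<times> 'v \<Rightarrow> 'n pt" where
  "step G y = (\<lambda>(u, w).
     if (u, w) \<in> edges G
     then (fst (y (u, w)) *\<^sub>R ivec (mvec G (u, w)), snd (y (u, w)) *\<^sub>R ivec (mvec G (u, w)))
     else - (fst (y (w, u)) *\<^sub>R ivec (mvec G (w, u)), snd (y (w, u)) *\<^sub>R ivec (mvec G (w, u))))"

definition ev :: "('v, 'n::finite) tropical_type \<Rightarrow> 'v \<Rightarrow> 'v \<Rightarrow> ('v, 'n) mpt \<Rightarrow> 'n pt" where
  "ev G R v = (\<lambda>(x, y). let xs = (THE xs. simple_path G R xs v)
     in x + (\<Sum>s\<leftarrow>zip xs (tl xs). step G y s))"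

text \<open>In these coordinates the evaluation map is linear, hence equal to its own derivative.\<close>

definition ev_pullback ::
    "('v, 'n::finite) tropical_type \<Rightarrow> 'v \<Rightarrow> 'v \<Rightarrow> 'n tform \<Rightarrow> (('v, 'n) mpt, ('v, 'n) mpt) form" where
  "ev_pullback G R v = pullback (ev G R v) (\<lambda>_. ev G R v)"

definition moduli_measure :: "('v, 'n::finite) tropical_type \<Rightarrow> ('v, 'n) mpt measure" where
  "moduli_measure G = torus_measure \<Otimes>\<^sub>M
     (\<Pi>\<^sub>M e\<in>internal_edges G. restrict_space lborel {0<..} \<Otimes>\<^sub>M restrict_space lborel {0..<2 * pi})"

text \<open>The oriented frame: the frame of the sink location, followed by the vectors \<open>\<partial>/\<partial>\<phi>\<^sub>e\<close>,
  \<open>\<partial>/\<partial>\<tau>\<^sub>e\<close> (in this order) for every internal edge.\<close>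

definition moduli_frame :: "('v, 'n::finite) tropical_type \<Rightarrow> ('v, 'n) mpt list" where
  "moduli_frame G = map (\<lambda>x. (x, \<lambda>_. (0, 0))) torus_frame @
     concat (map (\<lambda>e. [(0, (\<lambda>_. (0, 0))(e := (0, 1))), (0, (\<lambda>_. (0, 0))(e := (1, 0)))])
       (enum_of (internal_edges G)))"

definition moduli_integral ::
    "('v, 'n::finite) tropical_type \<Rightarrow> (('v, 'n) mpt, ('v, 'n) mpt) form \<Rightarrow> real" where
  "moduli_integral G \<omega> = (LINT x | moduli_measure G. \<omega> x (moduli_frame G))"


section \<open>The A-model\<close>

text \<open>A state \<open>\<Sum>\<^sub>m |\<omega>\<^sub>m, m\<rangle>\<close> is the finitely supported function \<open>m \<mapsto> \<omega>\<^sub>m\<close>.  The operators are defined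
  by their formulas on arbitrary forms on the torus, because \<open>K\<close> need not preserve smoothness at infinity.\<close>

type_synonym 'n state = "int ^ 'n \<Rightarrow> 'n tform"

definition ket :: "'n::finite tform \<Rightarrow> int ^ 'n \<Rightarrow> 'n state" where
  "ket \<omega> m = (\<lambda>m'. if m' = m then \<omega> else (\<lambda>_ _. 0))"

text \<open>On \<open>U(1)\<^sup>N\<close>-invariant forms the full exterior derivative is \<open>\<Sum> dr\<^sup>i \<partial>/\<partial>r\<^sup>i\<close>.\<close>

definition Q_op :: "'n::finite state \<Rightarrow> 'n state" where
  "Q_op s = (\<lambda>m. ext_d (s m))"

definition G_plus :: "'n::finite state \<Rightarrow> 'n state" where
  "G_plus s = (\<lambda>m. contract (ivec m, 0) (s m))"

definition G_minus :: "'n::finite state \<Rightarrow> 'n state" where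
  "G_minus s = (\<lambda>m. contract (0, ivec m) (s m))"

definition H_op :: "'n::finite state \<Rightarrow> 'n state" where
  "H_op s = (\<lambda>m. add_form (Q_op (G_plus s) m) (G_plus (Q_op s) m))"

definition exp_neg_H :: "real \<Rightarrow> 'n::finite state \<Rightarrow> 'n state" where
  "exp_neg_H t s = (\<lambda>m. pullback (\<lambda>(r, \<phi>). (r - t *\<^sub>R ivec m, \<phi>)) (\<lambda>_ v. v) (s m))"

definition K_op :: "'n::finite state \<Rightarrow> 'n state" where
  "K_op s = (\<lambda>m x vs. LINT t:{0..}|lborel. exp_neg_H t (G_plus s) m x vs)"

definition mu2 :: "'n::finite state \<Rightarrow> 'n state \<Rightarrow> 'n state" where
  "mu2 s t = (\<lambda>m x vs. \<Sum>k | s k \<noteq> (\<lambda>_ _. 0). (s k \<and>\<^sub>f t (m - k)) x vs)"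

definition pairing :: "'n::finite state \<Rightarrow> 'n state \<Rightarrow> real" where
  "pairing s t = (\<Sum>k | s k \<noteq> (\<lambda>_ _. 0). X_integral (s k \<and>\<^sub>f t (- k)))"

definition mu3_0 :: "'n::finite state \<Rightarrow> 'n state \<Rightarrow> 'n state \<Rightarrow> real" where
  "mu3_0 u v w = pairing u (mu2 v w)"

definition divisor_state :: "int ^ 'n::finite \<Rightarrow> 'n state" where
  "divisor_state b = ket (fun_form (\<lambda>_. 1)) b"

definition observable :: "'n::finite tform \<Rightarrow> 'n state \<Rightarrow> 'n state" where
  "observable \<gamma> s = (\<lambda>m. \<gamma> \<and>\<^sub>f s m)"

definition propagator :: "'n::finite state \<Rightarrow> 'n state" where
  "propagator s = (\<lambda>m. scale_form (2 * pi) (K_op (G_minus s) m))"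

text \<open>The translations \<open>exp_neg_H t\<close> are generated by \<open>- H\<close>.\<close>

lemma H_op_apply:
  "H_op s m x vs = frechet_derivative (\<lambda>y. s m y vs) (at x) (ivec m, 0)"
proof -
  have "ext_d (s m) x ((ivec m, 0) # vs)
      = frechet_derivative (\<lambda>y. s m y vs) (at x) (ivec m, 0) - ext_d (contract (ivec m, 0) (s m)) x vs"
    unfolding ext_d_def contract_def length_Cons sum.lessThan_Suc_shift
    by (simp add: sum_negf)
  then show ?thesis
    by (simp add: H_op_def Q_op_def G_plus_def add_form_def contract_def)
qed

lemma exp_neg_H_derivative:
  assumes "\<And>y. (\<lambda>y. s m y vs) differentiable (at y)"
  shows "((\<lambda>t. exp_neg_H t s m x vs) has_real_derivative - exp_neg_H t (H_op s) m x vs) (at t)"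
proof -
  obtain r \<phi> where x: "x = (r, \<phi>)" by (cases x)
  let ?y = "(r - t *\<^sub>R ivec m, \<phi>)"
  let ?D = "frechet_derivative (\<lambda>y. s m y vs) (at ?y)"
  have D: "((\<lambda>y. s m y vs) has_derivative ?D) (at ?y)"
    using assms frechet_derivative_works by blast
  have c: "((\<lambda>t. (r - t *\<^sub>R ivec m, \<phi>)) has_derivative (\<lambda>h. (- (h *\<^sub>R ivec m), 0))) (at t)"
    by (auto intro!: derivative_eq_intros)
  have "((\<lambda>t. s m (r - t *\<^sub>R ivec m, \<phi>) vs) has_derivative (\<lambda>h. ?D (- (h *\<^sub>R ivec m), 0))) (at t)"
    using has_derivative_compose[OF c D] by simp
  also have "(\<lambda>h. ?D (- (h *\<^sub>R ivec m), 0)) = (\<lambda>h. h * - ?D (ivec m, 0))"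
  proof
    fix h
    interpret linear ?D using D has_derivative_linear by blast
    have "(- (h *\<^sub>R ivec m), 0) = (- h) *\<^sub>R (ivec m, 0 :: real ^ 'a)" by simp
    then show "?D (- (h *\<^sub>R ivec m), 0) = h * - ?D (ivec m, 0)"
      by (simp only: scaleR) simp
  qed
  finally have "((\<lambda>t. s m (r - t *\<^sub>R ivec m, \<phi>) vs) has_real_derivative - ?D (ivec m, 0)) (at t)"
    by (rule has_derivative_imp_has_field_derivative) (simp add: mult.commute)
  then show ?thesis
    by (simp add: exp_neg_H_def pullback_def x H_op_apply)
qed


section \<open>Special trees and amplitudes\<close>

text \<open>A branch includes its outgoing edge, which leads towards the sink: that edge is external for
  \<open>Leaf\<close> and internal for the other two constructors.  Leaves carry the vertex, two-valent vertices
  the index of the marked point.\<close>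

datatype 'v branch = Leaf 'v | Obs nat "'v branch" | Mult "'v branch" "'v branch"

datatype 'v special_tree =
    Sink2 nat "'v branch" "'v branch"
  | Sink3 "'v branch" "'v branch" "'v branch"

text \<open>\<open>branch_at G n p v t\<close>: the part of the tree behind \<open>v\<close>, seen from its neighbor \<open>p\<close>, is \<open>t\<close>.
  The incoming edges of a vertex are taken in any order.\<close>

inductive branch_at ::
    "('v, 'n::finite) tropical_type \<Rightarrow> nat \<Rightarrow> 'v \<Rightarrow> 'v \<Rightarrow> 'v branch \<Rightarrow> bool" for G n where
  "\<lbrakk> neighbors G v = {p}; v \<in> verts G \<rbrakk> \<Longrightarrow> branch_at G n p v (Leaf v)"
| "\<lbrakk> \<alpha> \<in> {1..n}; v = mark G \<alpha>; neighbors G v = {p, w}; p \<noteq> w; branch_at G n v w t \<rbrakk>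
   \<Longrightarrow> branch_at G n p v (Obs \<alpha> t)"
| "\<lbrakk> neighbors G v = {p, w1, w2}; distinct [p, w1, w2];
     branch_at G n v w1 t1; branch_at G n v w2 t2 \<rbrakk>
   \<Longrightarrow> branch_at G n p v (Mult t1 t2)"

inductive special_tree_of ::
    "('v, 'n::finite) tropical_type \<Rightarrow> nat \<Rightarrow> 'v \<Rightarrow> 'v special_tree \<Rightarrow> bool" for G n where
  "\<lbrakk> \<alpha> \<in> {1..n}; R = mark G \<alpha>; neighbors G R = {w1, w2}; w1 \<noteq> w2;
     branch_at G n R w1 t1; branch_at G n R w2 t2 \<rbrakk>
   \<Longrightarrow> special_tree_of G n R (Sink2 \<alpha> t1 t2)"
| "\<lbrakk> neighbors G R = {w1, w2, w3}; distinct [w1, w2, w3];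
     branch_at G n R w1 t1; branch_at G n R w2 t2; branch_at G n R w3 t3 \<rbrakk>
   \<Longrightarrow> special_tree_of G n R (Sink3 t1 t2 t3)"

lemma card_neighbors:
  assumes "is_tree G"
  shows "card (neighbors G v) = valence G v"
proof -
  have *: "u \<noteq> w \<and> (w, u) \<notin> edges G" if "(u, w) \<in> edges G" for u w
    using assms that unfolding is_tree_def by blast
  have "inj_on (\<lambda>e. if fst e = v then snd e else fst e) {e \<in> edges G. fst e = v \<or> snd e = v}"
  proof (rule inj_onI)
    fix e e'
    assume e: "e \<in> {e \<in> edges G. fst e = v \<or> snd e = v}"
      and e': "e' \<in> {e \<in> edges G. fst e = v \<or> snd e = v}"
      and eq: "(if fst e = v then snd e else fst e) = (if fst e' = v then snd e' else fst e')"
    obtain a b a' b' where ab: "e = (a, b)" "e' = (a', b')" by (cases e; cases e')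
    have in_G: "(a, b) \<in> edges G" "(a', b') \<in> edges G" and ends: "a = v \<or> b = v" "a' = v \<or> b' = v"
      using e e' ab by simp_all
    show "e = e'"
    proof (cases "a = v"; cases "a' = v")
      assume "a = v" "a' = v"
      then show ?thesis using eq ab by simp
    next
      assume "a = v" "a' \<noteq> v"
      then show ?thesis using eq ab ends in_G *[OF in_G(1)] by simp
    next
      assume "a \<noteq> v" "a' = v"
      then show ?thesis using eq ab ends in_G *[OF in_G(2)] by simp
    next
      assume "a \<noteq> v" "a' \<noteq> v"
      then show ?thesis using eq ab ends by simp
    qed
  qed
  moreover have "(\<lambda>e. if fst e = v then snd e else fst e) ` {e \<in> edges G. fst e = v \<or> snd e = v}
      = neighbors G v"
  proof (intro subset_antisym subsetI)
    fix w assume "w \<in> neighbors G v"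
    then consider "(v, w) \<in> edges G" | "(w, v) \<in> edges G" by (auto simp: neighbors_def)
    then show "w \<in> (\<lambda>e. if fst e = v then snd e else fst e) ` {e \<in> edges G. fst e = v \<or> snd e = v}"
    proof cases
      case 1 then show ?thesis by (intro image_eqI[of _ _ "(v, w)"]) simp_all
    next
      case 2 then show ?thesis using *[OF 2] by (intro image_eqI[of _ _ "(w, v)"]) simp_all
    qed
  next
    fix w assume "w \<in> (\<lambda>e. if fst e = v then snd e else fst e) ` {e \<in> edges G. fst e = v \<or> snd e = v}"
    then obtain a b where "(a, b) \<in> edges G" "a = v \<or> b = v" "w = (if a = v then b else a)" by auto
    then show "w \<in> neighbors G v" by (cases "a = v") (simp_all add: neighbors_def)
  qed
  ultimately show ?thesis
    unfolding valence_def using card_image by fastforce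
qed

lemma simple_path_snoc:
  assumes tree: "is_tree G" and path: "simple_path G R (xs @ [p, v]) v"
    and w: "w \<in> neighbors G v" "w \<noteq> p"
  shows "simple_path G R (xs @ [p, v, w]) w"
proof -
  have wv: "w \<in> verts G" "w \<noteq> v" "v \<in> verts G" "v \<in> neighbors G w"
    using tree w by (auto simp: is_tree_def neighbors_def)
  have "w \<notin> set xs"
  proof
    assume "w \<in> set xs"
    then obtain as bs where xs: "xs = as @ w # bs" by (auto simp: in_set_conv_decomp)
    have adj: "(w # bs @ [p, v]) ! Suc i \<in> neighbors G ((w # bs @ [p, v]) ! i)"
      if "Suc i < length (w # bs @ [p, v])" for i
    proof -
      have "Suc (length as + i) < length (xs @ [p, v])" using that xs by simp
      then have "(xs @ [p, v]) ! Suc (length as + i) \<in> neighbors G ((xs @ [p, v]) ! (length as + i))"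
        using path unfolding simple_path_def by blast
      moreover have "xs @ [p, v] = as @ (w # bs @ [p, v])" using xs by simp
      ultimately show ?thesis
        by (simp add: nth_append_length_plus flip: add_Suc_right del: nth_Cons_Suc append.simps)
    qed
    have "simple_path G w (w # bs @ [p, v]) v"
      using path adj by (auto simp: simple_path_def xs)
    moreover have "simple_path G w [w, v] v"
      using wv by (auto simp: simple_path_def)
    moreover have "\<exists>!xs. simple_path G w xs v"
      using tree wv by (auto simp: is_tree_def)
    ultimately have "w # bs @ [p, v] = [w, v]" by blast
    then show False by simp
  qed
  moreover have "(xs @ [p, v, w]) ! Suc i \<in> neighbors G ((xs @ [p, v, w]) ! i)"
    if "Suc i < length (xs @ [p, v, w])" for i
  proof (cases "Suc i < length (xs @ [p, v])")
    case True
    then have "(xs @ [p, v]) ! Suc i \<in> neighbors G ((xs @ [p, v]) ! i)"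
      using path by (simp add: simple_path_def)
    moreover have "(xs @ [p, v, w]) ! j = (xs @ [p, v]) ! j" if "j < length (xs @ [p, v])" for j
      using nth_append_left[OF that, of "[w]"] by simp
    ultimately show ?thesis using True by (metis Suc_lessD)
  next
    case False
    then have "i = Suc (length xs)" using that by simp
    then show ?thesis using w by (simp add: nth_append)
  qed
  moreover have "hd (xs @ [p, v, w]) = R" "distinct (xs @ [p, v])" "set (xs @ [p, v]) \<subseteq> verts G"
    using path by (simp_all add: simple_path_def hd_append split: if_splits)
  ultimately show ?thesis
    using w wv unfolding simple_path_def by simp
qed

lemma branch_exists:
  assumes G: "discrete_type F n G" and "simple_path G R (xs @ [p, v]) v"
  shows "\<exists>t. branch_at G n p v t"
  using assms(2)
proof (induction "card (verts G) - length xs" arbitrary: xs p v rule: less_induct)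
  case less
  have tree: "is_tree G" using G by (simp add: discrete_type_def)
  then have fin: "finite (verts G)" by (simp add: is_tree_def)
  have v: "v \<in> verts G" using less.prems by (auto simp: simple_path_def)
  have "(xs @ [p, v]) ! Suc (length xs) \<in> neighbors G ((xs @ [p, v]) ! length xs)"
    using less.prems unfolding simple_path_def by auto
  then have p: "p \<in> neighbors G v" by (auto simp: nth_append neighbors_def)
  have "length (xs @ [p, v]) \<le> card (verts G)"
    using less.prems fin by (metis card_mono distinct_card simple_path_def)
  then have len: "card (verts G) - length (xs @ [p]) < card (verts G) - length xs" by simp
  have IH: "\<exists>t. branch_at G n v w t" if "w \<in> neighbors G v" "w \<noteq> p" for w
    using less.hyps[OF len, of v w] simple_path_snoc[OF tree less.prems that] by simp
  have val: "valence G v = card (neighbors G v)" using card_neighbors[OF tree] by simp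
  have "valence G v \<in> {1, 2, 3}" using G v by (auto simp: discrete_type_def)
  then consider "valence G v = 1" | "valence G v = 2" | "valence G v = 3" by auto
  then show ?case
  proof cases
    case 1
    then have "neighbors G v = {p}" using p val by (metis card_1_singletonE singletonD)
    then show ?thesis using v branch_at.intros(1) by metis
  next
    case 2
    then have "card (neighbors G v - {p}) = 1" using p val by simp
    then obtain w where "neighbors G v - {p} = {w}" by (auto simp: card_1_singleton_iff)
    then have w: "neighbors G v = {p, w}" "p \<noteq> w" using p by auto
    have "v \<in> mark G ` {1..n}" using 2 v G by (auto simp: discrete_type_def bij_betw_def)
    then obtain \<alpha> where "\<alpha> \<in> {1..n}" "v = mark G \<alpha>" by auto
    moreover obtain t where "branch_at G n v w t" using IH w by auto
    ultimately show ?thesis using w branch_at.intros(2) by metis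
  next
    case 3
    then have "card (neighbors G v - {p}) = 2" using p val by simp
    then obtain w1 w2 where "neighbors G v - {p} = {w1, w2}" "w1 \<noteq> w2" by (auto simp: card_2_iff)
    then have w: "neighbors G v = {p, w1, w2}" "distinct [p, w1, w2]" using p by auto
    obtain t1 where "branch_at G n v w1 t1" using IH[of w1] w by auto
    moreover obtain t2 where "branch_at G n v w2 t2" using IH[of w2] w by auto
    ultimately show ?thesis using w branch_at.intros(3) by metis
  qed
qed

lemma special_tree_exists:
  assumes G: "discrete_type F n G" and R: "R \<in> verts G - leaves G"
  shows "\<exists>T. special_tree_of G n R T"
proof -
  have tree: "is_tree G" using G by (simp add: discrete_type_def)
  have br: "\<exists>t. branch_at G n R w t" if "w \<in> neighbors G R" for w
  proof -
    have "R \<noteq> w" "w \<in> verts G" "R \<in> verts G"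
      using that tree by (auto simp: neighbors_def is_tree_def)
    then have "simple_path G R ([] @ [R, w]) w" using that by (auto simp: simple_path_def)
    then show ?thesis using branch_exists[OF G] by blast
  qed
  have val: "valence G R = card (neighbors G R)" using card_neighbors[OF tree] by simp
  have "valence G R \<in> {2, 3}" using G R by (auto simp: discrete_type_def leaves_def)
  then consider "valence G R = 2" | "valence G R = 3" by auto
  then show ?thesis
  proof cases
    case 1
    then obtain w1 w2 where w: "neighbors G R = {w1, w2}" "w1 \<noteq> w2"
      using val by (auto simp: card_2_iff)
    have "R \<in> mark G ` {1..n}" using 1 R G by (auto simp: discrete_type_def bij_betw_def)
    then obtain \<alpha> where "\<alpha> \<in> {1..n}" "R = mark G \<alpha>" by auto
    moreover obtain t1 where "branch_at G n R w1 t1" using br[of w1] w by auto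
    moreover obtain t2 where "branch_at G n R w2 t2" using br[of w2] w by auto
    ultimately show ?thesis using w special_tree_of.intros(1) by metis
  next
    case 2
    then obtain w1 w2 w3 where w: "neighbors G R = {w1, w2, w3}" "distinct [w1, w2, w3]"
      using val by (auto simp: card_3_iff)
    obtain t1 where "branch_at G n R w1 t1" using br[of w1] w by auto
    moreover obtain t2 where "branch_at G n R w2 t2" using br[of w2] w by auto
    moreover obtain t3 where "branch_at G n R w3 t3" using br[of w3] w by auto
    ultimately show ?thesis using w special_tree_of.intros(2) by metis
  qed
qed

primrec branch_state ::
    "(nat \<Rightarrow> 'n::finite state \<Rightarrow> 'n state) \<Rightarrow> ('v \<Rightarrow> 'n state) \<Rightarrow> 'v branch \<Rightarrow> 'n state" where
  "branch_state obs ins (Leaf v) = ins v"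
| "branch_state obs ins (Obs \<alpha> t) = propagator (obs \<alpha> (branch_state obs ins t))"
| "branch_state obs ins (Mult t1 t2) =
     propagator (mu2 (branch_state obs ins t1) (branch_state obs ins t2))"

primrec amplitude ::
    "(nat \<Rightarrow> 'n::finite state \<Rightarrow> 'n state) \<Rightarrow> ('v \<Rightarrow> 'n state) \<Rightarrow> 'v special_tree \<Rightarrow> real" where
  "amplitude obs ins (Sink2 \<alpha> t1 t2) =
     pairing (branch_state obs ins t1) (obs \<alpha> (branch_state obs ins t2))"
| "amplitude obs ins (Sink3 t1 t2 t3) =
     mu3_0 (branch_state obs ins t1) (branch_state obs ins t2) (branch_state obs ins t3)"

definition leaf_state :: "('v, 'n::finite) tropical_type \<Rightarrow> 'v \<Rightarrow> 'n state" where
  "leaf_state G v = divisor_state (mvec G (THE e. e \<in> edges G \<and> fst e = v))"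

end

theory Submission
  imports Defs "HOL-Library.Function_Algebras" "HOL-Library.Sublist"
begin

section \<open>Algebra of the wedge product\<close>

text \<open>The moduli space is integrated one edge at a time. Root the curve at the sink; an
  internal edge with vector m, directed towards the sink, then cuts off a subtree. Its length and
  twist translate exactly the marked points behind it, by -m times the length in the radii and by -m
  times the twist in the angles. So the two frame vectors of the edge, inserted into the wedge of
  the pulled back forms, reach only the factors behind the edge and act there as contractions with
  (0, m) and (m, 0); the two minus signs cancel. These contractions are G_- and G_+. Since the forms
  are torus invariant, the twist integrates to 2 pi, and integrating the translated form over the
  length is the integral that defines K. Integrating out an edge is therefore the propagator 2 pi K
  G_-.

  The other ingredients match likewise: a trivalent vertex multiplies the forms of two subtrees with
  disjoint edges (\<open>mu2\<close>), a marked point multiplies by its form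
  (\<open>observable\<close>), an unbounded edge contributes the form 1 with its charge
  (\<open>divisor_state\<close>), and the integral over the sink position is the pairing. Balancing
  makes the charge carried by a state equal to the vector of its edge. The even degrees of the
  forms, and the fact that edge frames come in pairs, remove all signs from reorderings.

  \<open>tform_eq_eval_wedge\<close> evaluates the global form on the frame by recursion over the
  tree, \<open>propagator_eq_integral\<close> and \<open>tstate_eq_ket\<close> identify the A-model
  states with its partial integrals, and \<open>moduli_integral_eq\<close> with
  \<open>pairing_tstate\<close> compares the total integrals. \<open>branch_tree\<close> and
  \<open>special_tree\<close> extract the rooted tree from the discrete type, and
  \<open>card_leaves\<close> counts the divisor states.

  The analytic content is absolute convergence, without which the integrals could not be exchanged.
  On the chart of a cone \<sigma> a form is a polynomial in bounded functions and differentials of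
  monomials z^u. Such a differential has size at most a constant times exp(u.r), with u.r
  nonpositive over the region -\<sigma>, and it annihilates every radial direction on which u
  vanishes. A product of them, evaluated on a frame that contains all unbounded directions, is
  therefore either zero or exponentially small in all of these directions
  (\<open>decay_term_bound\<close>). As the fan is complete, finitely many choices of one cone per
  marked point cover all curves (\<open>eval_wedge_bound\<close>).\<close>

definition grade_sign :: "('p, 'v) form \<Rightarrow> ('p, 'v) form" where
  "grade_sign \<omega> = (\<lambda>x vs. (-1) ^ length vs * \<omega> x vs)"

section \<open>Exterior algebra of mixed-degree forms\<close>

lemma wedge_Nil: "(\<omega> \<and>\<^sub>f \<eta>) x [] = \<omega> x [] * \<eta> x []"
  by (simp add: wedge_def shuffle_sign_def)

lemma Pow_lessThan_Suc:
  "Pow {..<Suc k} = (\<lambda>S. insert 0 (Suc ` S)) ` Pow {..<k} \<union> (`) Suc ` Pow {..<k}"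
proof -
  have "Pow (Suc ` {..<k}) = (`) Suc ` Pow {..<k}"
    using image_Pow_surj[OF refl, of Suc "{..<k}"] by simp
  then show ?thesis
    by (simp add: lessThan_Suc_eq_insert_0 Pow_insert image_image Un_commute)
qed

lemma shuffle_sign_insert_0: "shuffle_sign (insert 0 (Suc ` S)) (Suc k) = shuffle_sign S k"
proof -
  have "{(i, j). i < Suc k \<and> j < i \<and> i \<in> insert 0 (Suc ` S) \<and> j \<notin> insert 0 (Suc ` S)}
      = map_prod Suc Suc ` {(i, j). i < k \<and> j < i \<and> i \<in> S \<and> j \<notin> S}"
    (is "?A = ?B")
  proof (intro subset_antisym subsetI)
    fix p assume "p \<in> ?A"
    then obtain i j where "p = (Suc i, Suc j)" "i < k" "j < i" "i \<in> S" "j \<notin> S"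
      by (cases p) (auto simp: gr0_conv_Suc image_iff)
    then show "p \<in> ?B" by auto
  qed auto
  moreover have "inj_on (map_prod Suc Suc) X" for X
    by (auto simp: inj_on_def)
  ultimately show ?thesis
    by (simp add: shuffle_sign_def card_image)
qed

text \<open>Position 0 goes to the second factor, so each element of \<open>S\<close> has to pass it
  once.\<close>

lemma shuffle_sign_image_Suc:
  assumes "S \<subseteq> {..<k}"
  shows "shuffle_sign (Suc ` S) (Suc k) = (-1) ^ card S * shuffle_sign S k"
proof -
  let ?I = "{(i, j). i < k \<and> j < i \<and> i \<in> S \<and> j \<notin> S}"
  have "{(i, j). i < Suc k \<and> j < i \<and> i \<in> Suc ` S \<and> j \<notin> Suc ` S}
      = map_prod Suc Suc ` ?I \<union> (\<lambda>i. (Suc i, 0)) ` S" (is "?A = ?B")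
  proof (intro subset_antisym subsetI)
    fix p assume "p \<in> ?A"
    then obtain i j where p: "p = (Suc i, j)" "i < k" "j < Suc i" "i \<in> S" "j \<notin> Suc ` S"
      by (cases p) auto
    then show "p \<in> ?B" by (cases j) auto
  next
    fix p assume "p \<in> ?B"
    then show "p \<in> ?A" using assms by auto
  qed
  moreover have fin: "finite ?I"
    by (rule finite_subset[of _ "{..<k} \<times> {..<k}"]) auto
  moreover have "finite S" using assms finite_subset by blast
  moreover have "inj_on (map_prod Suc Suc) ?I" "inj_on (\<lambda>i. (Suc i, 0::nat)) S"
    by (auto simp: inj_on_def)
  moreover have "map_prod Suc Suc ` ?I \<inter> (\<lambda>i. (Suc i, 0)) ` S = {}" by auto
  ultimately show ?thesis
    by (simp add: shuffle_sign_def card_Un_disjoint card_image power_add)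
qed

text \<open>This derivation rule, together with the value on the empty list, determines the wedge
  product; the algebraic laws below follow from it by induction on the list of vectors.\<close>

lemma contract_wedge:
  fixes \<omega> \<eta> :: "('p, 'v) form"
  shows "contract v (\<omega> \<and>\<^sub>f \<eta>) = add_form (contract v \<omega> \<and>\<^sub>f \<eta>) (grade_sign \<omega> \<and>\<^sub>f contract v \<eta>)"
proof (intro ext)
  fix x and vs :: "'v list"
  let ?k = "length vs"
  let ?f = "\<lambda>S. shuffle_sign S (Suc ?k) * \<omega> x (nths (v # vs) S) * \<eta> x (nths (v # vs) (- S))"
  have "contract v (\<omega> \<and>\<^sub>f \<eta>) x vs = (\<Sum>S\<in>Pow {..<Suc ?k}. ?f S)"
    by (simp add: contract_def wedge_def)
  \<comment> \<open>The subsets are split according to the factor that receives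
    \<open>v\<close>.\<close>
  also have "\<dots> = (\<Sum>S\<in>(\<lambda>S. insert 0 (Suc ` S)) ` Pow {..<?k}. ?f S) + (\<Sum>S\<in>(`) Suc ` Pow {..<?k}. ?f S)"
    unfolding Pow_lessThan_Suc by (rule sum.union_disjoint) auto
  also have "(\<Sum>S\<in>(\<lambda>S. insert 0 (Suc ` S)) ` Pow {..<?k}. ?f S)
      = (\<Sum>S\<in>Pow {..<?k}. ?f (insert 0 (Suc ` S)))"
    by (subst sum.reindex) (auto intro!: inj_on_inverseI[where g = "\<lambda>X. {j. Suc j \<in> X}"])
  also have "\<dots> = (contract v \<omega> \<and>\<^sub>f \<eta>) x vs"
  proof -
    have "{j. Suc j \<in> insert 0 (Suc ` S)} = S" "{j. Suc j \<in> - insert 0 (Suc ` S)} = - S" for S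
      by auto
    then show ?thesis
      unfolding wedge_def contract_def
      by (intro sum.cong refl) (simp only: nths_Cons shuffle_sign_insert_0, simp)
  qed
  also have "(\<Sum>S\<in>(`) Suc ` Pow {..<?k}. ?f S) = (\<Sum>S\<in>Pow {..<?k}. ?f (Suc ` S))"
    by (subst sum.reindex) (auto simp: inj_on_def inj_image_eq_iff)
  also have "\<dots> = (grade_sign \<omega> \<and>\<^sub>f contract v \<eta>) x vs"
  proof -
    have "?f (Suc ` S) = shuffle_sign S ?k * grade_sign \<omega> x (nths vs S) * contract v \<eta> x (nths vs (- S))"
      if "S \<in> Pow {..<?k}" for S
    proof -
      have "{j. Suc j \<in> Suc ` S} = S" "{j. Suc j \<in> - Suc ` S} = - S" by auto
      moreover have "length (nths vs S) = card S"
        using that by (auto simp: length_nths intro!: arg_cong[of _ _ card])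
      ultimately show ?thesis
        using that by (simp add: nths_Cons shuffle_sign_image_Suc grade_sign_def contract_def)
    qed
    then show ?thesis unfolding wedge_def by (intro sum.cong) auto
  qed
  finally show "contract v (\<omega> \<and>\<^sub>f \<eta>) x vs
      = add_form (contract v \<omega> \<and>\<^sub>f \<eta>) (grade_sign \<omega> \<and>\<^sub>f contract v \<eta>) x vs"
    by (simp add: add_form_def)
qed

lemma form_Cons: "\<omega> x (v # vs) = contract v \<omega> x vs"
  by (simp add: contract_def)

lemma wedge_Cons:
  "(\<omega> \<and>\<^sub>f \<eta>) x (v # vs) = (contract v \<omega> \<and>\<^sub>f \<eta>) x vs + (grade_sign \<omega> \<and>\<^sub>f contract v \<eta>) x vs"
  by (simp add: form_Cons contract_wedge add_form_def)

lemma wedge_add_left: "add_form \<omega> \<omega>' \<and>\<^sub>f \<eta> = add_form (\<omega> \<and>\<^sub>f \<eta>) (\<omega>' \<and>\<^sub>f \<eta>)"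
  by (simp add: wedge_def add_form_def algebra_simps sum.distrib)

lemma wedge_add_right: "\<omega> \<and>\<^sub>f add_form \<eta> \<eta>' = add_form (\<omega> \<and>\<^sub>f \<eta>) (\<omega> \<and>\<^sub>f \<eta>')"
  by (simp add: wedge_def add_form_def algebra_simps sum.distrib)

lemma wedge_scale_left: "scale_form a \<omega> \<and>\<^sub>f \<eta> = scale_form a (\<omega> \<and>\<^sub>f \<eta>)"
  by (simp add: wedge_def scale_form_def algebra_simps sum_distrib_left)

lemma wedge_scale_right: "\<omega> \<and>\<^sub>f scale_form a \<eta> = scale_form a (\<omega> \<and>\<^sub>f \<eta>)"
  by (simp add: wedge_def scale_form_def algebra_simps sum_distrib_left)

lemma wedge_zero_left: "(\<lambda>_ _. 0) \<and>\<^sub>f \<eta> = (\<lambda>_ _. 0)"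
  by (simp add: wedge_def)

lemma wedge_zero_right: "\<omega> \<and>\<^sub>f (\<lambda>_ _. 0) = (\<lambda>_ _. 0)"
  by (simp add: wedge_def)

lemma grade_sign_grade_sign: "grade_sign (grade_sign \<omega>) = \<omega>"
  by (simp add: grade_sign_def fun_eq_iff left_minus_one_mult_self)

lemma contract_grade_sign: "contract v (grade_sign \<omega>) = scale_form (- 1) (grade_sign (contract v \<omega>))"
  by (simp add: contract_def grade_sign_def scale_form_def)

lemma contract_scale: "contract v (scale_form a \<omega>) = scale_form a (contract v \<omega>)"
  by (simp add: contract_def scale_form_def)

lemma grade_sign_wedge: "grade_sign (\<omega> \<and>\<^sub>f \<eta>) = grade_sign \<omega> \<and>\<^sub>f grade_sign \<eta>"
proof -
  have "grade_sign (\<omega> \<and>\<^sub>f \<eta>) x vs = (grade_sign \<omega> \<and>\<^sub>f grade_sign \<eta>) x vs" for x vs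
  proof (induction vs arbitrary: \<omega> \<eta>)
    case Nil
    show ?case by (simp add: grade_sign_def wedge_Nil)
  next
    case (Cons v vs)
    have "grade_sign (\<omega> \<and>\<^sub>f \<eta>) x (v # vs)
        = - (grade_sign (contract v \<omega> \<and>\<^sub>f \<eta>) x vs + grade_sign (grade_sign \<omega> \<and>\<^sub>f contract v \<eta>) x vs)"
      by (simp add: grade_sign_def wedge_Cons algebra_simps)
    also have "\<dots> = (grade_sign \<omega> \<and>\<^sub>f grade_sign \<eta>) x (v # vs)"
      unfolding Cons.IH wedge_Cons contract_grade_sign wedge_scale_left wedge_scale_right
      by (simp add: scale_form_def)
    finally show ?case .
  qed
  then show ?thesis by blast
qed

lemma wedge_assoc: "(\<omega> \<and>\<^sub>f \<eta>) \<and>\<^sub>f \<theta> = \<omega> \<and>\<^sub>f \<eta> \<and>\<^sub>f \<theta>"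
proof -
  have "((\<omega> \<and>\<^sub>f \<eta>) \<and>\<^sub>f \<theta>) x vs = (\<omega> \<and>\<^sub>f \<eta> \<and>\<^sub>f \<theta>) x vs" for x vs
  proof (induction vs arbitrary: \<omega> \<eta> \<theta>)
    case Nil
    show ?case by (simp add: wedge_Nil)
  next
    case (Cons v vs)
    show ?case
      unfolding wedge_Cons[of "\<omega> \<and>\<^sub>f \<eta>"] wedge_Cons[of \<omega>] contract_wedge grade_sign_wedge
        wedge_add_left wedge_add_right
      unfolding add_form_def Cons.IH by simp
  qed
  then show ?thesis by blast
qed

text \<open>Contraction exchanges even and odd forms, so the induction needs both sign rules at
  once; in the odd rule \<open>grade_sign\<close> on \<eta> carries the sign.\<close>

lemma wedge_commute_graded:
  "(grade_sign \<omega> = \<omega> \<longrightarrow> (\<omega> \<and>\<^sub>f \<eta>) x vs = (\<eta> \<and>\<^sub>f \<omega>) x vs)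
   \<and> (grade_sign \<omega> = scale_form (- 1) \<omega> \<longrightarrow> (\<omega> \<and>\<^sub>f \<eta>) x vs = (grade_sign \<eta> \<and>\<^sub>f \<omega>) x vs)"
proof (induction vs arbitrary: \<omega> \<eta>)
  case Nil
  show ?case by (simp add: wedge_Nil grade_sign_def)
next
  case (Cons v vs)
  have ss: "scale_form (-1) (scale_form (-1) \<omega>) = \<omega>" for \<omega> :: "('a, 'b) form"
    by (simp add: scale_form_def)
  have c: "grade_sign (contract v \<omega>) = scale_form (-1) (contract v (grade_sign \<omega>))"
    by (simp add: contract_grade_sign ss)
  show ?case
  proof (intro conjI impI)
    assume e: "grade_sign \<omega> = \<omega>"
    then have "grade_sign (contract v \<omega>) = scale_form (-1) (contract v \<omega>)" using c by simp
    then have "(contract v \<omega> \<and>\<^sub>f \<eta>) x vs = (grade_sign \<eta> \<and>\<^sub>f contract v \<omega>) x vs"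
      using Cons.IH by blast
    moreover have "(\<omega> \<and>\<^sub>f contract v \<eta>) x vs = (contract v \<eta> \<and>\<^sub>f \<omega>) x vs"
      using Cons.IH e by blast
    ultimately show "(\<omega> \<and>\<^sub>f \<eta>) x (v # vs) = (\<eta> \<and>\<^sub>f \<omega>) x (v # vs)"
      by (simp add: wedge_Cons e)
  next
    assume o: "grade_sign \<omega> = scale_form (-1) \<omega>"
    then have "grade_sign (contract v \<omega>) = contract v \<omega>" using c by (simp add: contract_scale ss)
    then have "(contract v \<omega> \<and>\<^sub>f \<eta>) x vs = (\<eta> \<and>\<^sub>f contract v \<omega>) x vs"
      using Cons.IH by blast
    moreover have "(\<omega> \<and>\<^sub>f contract v \<eta>) x vs = (grade_sign (contract v \<eta>) \<and>\<^sub>f \<omega>) x vs"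
      using Cons.IH o by blast
    ultimately show "(\<omega> \<and>\<^sub>f \<eta>) x (v # vs) = (grade_sign \<eta> \<and>\<^sub>f \<omega>) x (v # vs)"
      unfolding wedge_Cons o contract_grade_sign wedge_scale_left grade_sign_grade_sign
      by (simp add: scale_form_def)
  qed
qed

lemma wedge_commute_even:
  assumes "grade_sign \<omega> = \<omega>"
  shows "\<omega> \<and>\<^sub>f \<eta> = \<eta> \<and>\<^sub>f \<omega>"
  by (intro ext mp[OF conjunct1[OF wedge_commute_graded]] assms)

lemma grade_sign_even:
  assumes "has_form_degree k \<omega>" "even k"
  shows "grade_sign \<omega> = \<omega>"
proof (intro ext)
  fix x vs
  show "grade_sign \<omega> x vs = \<omega> x vs"
    using assms by (cases "length vs = k") (auto simp: has_form_degree_def grade_sign_def)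
qed

lemma grade_sign_one: "grade_sign (fun_form f) = fun_form f"
  by (auto simp: grade_sign_def fun_form_def fun_eq_iff)

lemma contract_fun_form: "contract v (fun_form f) = (\<lambda>_ _. 0)"
  by (simp add: contract_def fun_form_def fun_eq_iff)

lemma wedge_one_left:
  fixes \<omega> :: "('p, 'v) form"
  shows "fun_form (\<lambda>_. 1) \<and>\<^sub>f \<omega> = \<omega>"
proof -
  let ?one = "fun_form (\<lambda>_. 1) :: ('p, 'v) form"
  have "(?one \<and>\<^sub>f \<omega>) x vs = \<omega> x vs" for x vs
  proof (induction vs arbitrary: \<omega>)
    case Nil
    have "?one x [] = 1" by (simp add: fun_form_def)
    then show ?case unfolding wedge_Nil by simp
  next
    case (Cons v vs)
    show ?case
      unfolding wedge_Cons contract_fun_form grade_sign_one wedge_zero_left Cons.IH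
      by (simp add: contract_def)
  qed
  then show ?thesis by blast
qed

lemma wedge_list_append: "wedge_list (\<omega>s @ \<eta>s) = wedge_list \<omega>s \<and>\<^sub>f wedge_list \<eta>s"
  by (induction \<omega>s) (simp_all add: wedge_list_def wedge_one_left wedge_assoc)

lemma wedge_list_Cons: "wedge_list (\<omega> # \<omega>s) = \<omega> \<and>\<^sub>f wedge_list \<omega>s"
  by (simp add: wedge_list_def)

lemma wedge_list_Nil: "wedge_list [] = fun_form (\<lambda>_. 1)"
  by (simp add: wedge_list_def)

text \<open>This is where evenness of the degrees enters: the recursion over the tree meets the
  marked points in its own order, which is immaterial for even forms.\<close>

lemma wedge_list_permute:
  assumes "mset \<omega>s = mset \<eta>s" "\<And>\<omega>. \<omega> \<in> set \<omega>s \<Longrightarrow> grade_sign \<omega> = \<omega>"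
  shows "wedge_list \<omega>s = wedge_list \<eta>s"
  using assms
proof (induction \<omega>s arbitrary: \<eta>s)
  case Nil
  then show ?case by simp
next
  case (Cons \<omega> \<omega>s)
  then have "\<omega> \<in> set \<eta>s" by (metis list.set_intros(1) mset_eq_setD)
  then obtain as bs where \<eta>s: "\<eta>s = as @ \<omega> # bs" by (auto simp: in_set_conv_decomp)
  then have "wedge_list \<omega>s = wedge_list (as @ bs)"
    using Cons.prems by (intro Cons.IH) simp_all
  moreover have "\<omega> \<and>\<^sub>f wedge_list as = wedge_list as \<and>\<^sub>f \<omega>"
    using Cons.prems by (intro wedge_commute_even) simp
  ultimately show ?case
    by (simp add: \<eta>s wedge_list_Cons wedge_list_append flip: wedge_assoc)
qed

lemma pullback_wedge: "pullback f D (\<omega> \<and>\<^sub>f \<eta>) = pullback f D \<omega> \<and>\<^sub>f pullback f D \<eta>"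
  by (simp add: pullback_def wedge_def nths_map)

lemma pullback_add: "pullback f D (add_form \<omega> \<eta>) = add_form (pullback f D \<omega>) (pullback f D \<eta>)"
  by (simp add: pullback_def add_form_def)

lemma pullback_fun_form: "pullback f D (fun_form g) = fun_form (\<lambda>x. g (f x))"
  by (simp add: pullback_def fun_form_def fun_eq_iff)

lemma grade_sign_pullback: "grade_sign (pullback f D \<omega>) = pullback f D (grade_sign \<omega>)"
  by (simp add: pullback_def grade_sign_def)

subsection \<open>Alternating forms\<close>

definition antisym_form :: "('p, 'v) form \<Rightarrow> bool" where
  "antisym_form \<omega> \<longleftrightarrow> (\<forall>x us v w vs. \<omega> x (us @ v # w # vs) = - \<omega> x (us @ w # v # vs))"

definition multilinear_form :: "('p, 'v::real_vector) form \<Rightarrow> bool" where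
  "multilinear_form \<omega> \<longleftrightarrow> (\<forall>x us vs. linear (\<lambda>v. \<omega> x (us @ v # vs)))"

definition alternating_form :: "('p, 'v::real_vector) form \<Rightarrow> bool" where
  "alternating_form \<omega> \<longleftrightarrow> antisym_form \<omega> \<and> multilinear_form \<omega>"

lemma antisym_formD: "antisym_form \<omega> \<Longrightarrow> \<omega> x (us @ v # w # vs) = - \<omega> x (us @ w # v # vs)"
  unfolding antisym_form_def by blast

lemma antisym_formI:
  "(\<And>x us v w vs. \<omega> x (us @ v # w # vs) = - \<omega> x (us @ w # v # vs)) \<Longrightarrow> antisym_form \<omega>"
  unfolding antisym_form_def by blast

lemma multilinear_formD: "multilinear_form \<omega> \<Longrightarrow> linear (\<lambda>v. \<omega> x (us @ v # vs))"
  by (simp add: multilinear_form_def)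

lemma antisym_form_contract:
  assumes "antisym_form \<omega>"
  shows "antisym_form (contract u \<omega>)"
  unfolding antisym_form_def contract_def
proof (intro allI)
  fix x us v w vs
  show "\<omega> x (u # us @ v # w # vs) = - \<omega> x (u # us @ w # v # vs)"
    using antisym_formD[OF assms, of x "u # us" v w vs] by simp
qed

lemma antisym_form_grade_sign:
  assumes "antisym_form \<omega>"
  shows "antisym_form (grade_sign \<omega>)"
proof (rule antisym_formI)
  fix x us v w vs
  show "grade_sign \<omega> x (us @ v # w # vs) = - grade_sign \<omega> x (us @ w # v # vs)"
    using antisym_formD[OF assms, of x us v w vs] by (simp add: grade_sign_def)
qed

lemma contract_contract:
  assumes "antisym_form \<omega>"
  shows "contract v (contract w \<omega>) = scale_form (-1) (contract w (contract v \<omega>))"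
proof (intro ext)
  fix x vs
  show "contract v (contract w \<omega>) x vs = scale_form (-1) (contract w (contract v \<omega>)) x vs"
    using antisym_formD[OF assms, of x "[]" w v vs] by (simp add: contract_def scale_form_def)
qed

lemma antisym_form_wedge:
  assumes "antisym_form \<omega>" "antisym_form \<eta>"
  shows "antisym_form (\<omega> \<and>\<^sub>f \<eta>)"
proof -
  have "(\<omega> \<and>\<^sub>f \<eta>) x (us @ v # w # vs) = - (\<omega> \<and>\<^sub>f \<eta>) x (us @ w # v # vs)" for x us v w vs
    using assms
  proof (induction us arbitrary: \<omega> \<eta>)
    case Nil
    note cc = contract_contract[OF Nil(1), of v w] contract_contract[OF Nil(2), of v w]
    show ?case
      unfolding append_Nil wedge_Cons contract_grade_sign cc wedge_scale_left wedge_scale_right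
        grade_sign_grade_sign
      by (simp add: scale_form_def)
  next
    case (Cons u us)
    then show ?case
      by (simp add: wedge_Cons antisym_form_contract antisym_form_grade_sign)
  qed
  then show ?thesis unfolding antisym_form_def by blast
qed

lemma multilinear_form_contract:
  assumes "multilinear_form \<omega>"
  shows "multilinear_form (contract u \<omega>)"
  unfolding multilinear_form_def contract_def
proof (intro allI)
  fix x us vs
  show "linear (\<lambda>v. \<omega> x (u # us @ v # vs))"
    using multilinear_formD[OF assms, of x "u # us" vs] by simp
qed

lemma multilinear_form_grade_sign:
  assumes "multilinear_form \<omega>"
  shows "multilinear_form (grade_sign \<omega>)"
  unfolding multilinear_form_def grade_sign_def
proof (intro allI)
  fix x us vs
  interpret linear "\<lambda>v. \<omega> x (us @ v # vs)" by (rule multilinear_formD[OF assms])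
  show "linear (\<lambda>v. (-1) ^ length (us @ v # vs) * \<omega> x (us @ v # vs))"
    by (rule linearI) (simp_all add: add scale algebra_simps)
qed

lemma contract_linear:
  assumes "multilinear_form \<omega>"
  shows "contract (v + w) \<omega> = add_form (contract v \<omega>) (contract w \<omega>)"
    and "contract (a *\<^sub>R v) \<omega> = scale_form a (contract v \<omega>)"
proof -
  have lin: "linear (\<lambda>v. \<omega> x (v # vs))" for x vs
    using multilinear_formD[OF assms, of x "[]" vs] by simp
  then show "contract (v + w) \<omega> = add_form (contract v \<omega>) (contract w \<omega>)"
    and "contract (a *\<^sub>R v) \<omega> = scale_form a (contract v \<omega>)"
    unfolding contract_def add_form_def scale_form_def
    by (simp_all only: linear_add[OF lin] linear_scale[OF lin] real_scaleR_def)
qed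

lemma multilinear_form_wedge:
  assumes "multilinear_form \<omega>" "multilinear_form \<eta>"
  shows "multilinear_form (\<omega> \<and>\<^sub>f \<eta>)"
proof -
  have "linear (\<lambda>v. (\<omega> \<and>\<^sub>f \<eta>) x (us @ v # vs))" for x us vs
    using assms
  proof (induction us arbitrary: \<omega> \<eta>)
    case Nil
    show ?case
      unfolding append_Nil wedge_Cons
      by (rule linearI; unfold contract_linear[OF Nil(1)] contract_linear[OF Nil(2)] wedge_add_left
          wedge_add_right wedge_scale_left wedge_scale_right; simp add: add_form_def scale_form_def algebra_simps)
  next
    case (Cons u us)
    then show ?case
      by (simp add: wedge_Cons multilinear_form_contract multilinear_form_grade_sign linear_compose_add)
  qed
  then show ?thesis unfolding multilinear_form_def by blast
qed

lemma alternating_form_wedge: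
  "alternating_form \<omega> \<Longrightarrow> alternating_form \<eta> \<Longrightarrow> alternating_form (\<omega> \<and>\<^sub>f \<eta>)"
  by (simp add: alternating_form_def antisym_form_wedge multilinear_form_wedge)

lemma alternating_form_add:
  assumes "alternating_form \<omega>" "alternating_form \<eta>"
  shows "alternating_form (add_form \<omega> \<eta>)"
  unfolding alternating_form_def
proof
  show "antisym_form (add_form \<omega> \<eta>)"
  proof (rule antisym_formI)
    fix x us v w vs
    show "add_form \<omega> \<eta> x (us @ v # w # vs) = - add_form \<omega> \<eta> x (us @ w # v # vs)"
      using antisym_formD[of \<omega> x us v w vs] antisym_formD[of \<eta> x us v w vs] assms
      by (simp add: alternating_form_def add_form_def)
  qed
  show "multilinear_form (add_form \<omega> \<eta>)"
    using assms by (simp add: alternating_form_def multilinear_form_def add_form_def linear_compose_add)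
qed

lemma alternating_form_fun_form: "alternating_form (fun_form f)"
  by (simp add: alternating_form_def antisym_form_def multilinear_form_def fun_form_def linear_zero)

lemma alternating_form_pullback:
  assumes "alternating_form \<omega>" "\<And>x. linear (D x)"
  shows "alternating_form (pullback f D \<omega>)"
  unfolding alternating_form_def
proof
  show "antisym_form (pullback f D \<omega>)"
  proof (rule antisym_formI)
    fix x us v w vs
    have "antisym_form \<omega>" using assms(1) by (simp add: alternating_form_def)
    from antisym_formD[OF this, of "f x" "map (D x) us" "D x v" "D x w" "map (D x) vs"]
    show "pullback f D \<omega> x (us @ v # w # vs) = - pullback f D \<omega> x (us @ w # v # vs)"
      by (simp add: pullback_def)
  qed
  have "linear (\<lambda>v. \<omega> (f x) (map (D x) us @ D x v # map (D x) vs))" for x us vs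
    using linear_compose[OF assms(2), of "\<lambda>v. \<omega> (f x) (map (D x) us @ v # map (D x) vs)"] assms(1)
    by (simp add: alternating_form_def multilinear_form_def o_def)
  then show "multilinear_form (pullback f D \<omega>)"
    by (simp add: multilinear_form_def pullback_def)
qed

lemma antisym_form_move:
  assumes "antisym_form \<omega>"
  shows "\<omega> x (us @ ws @ v # vs) = (-1) ^ length ws * \<omega> x (us @ v # ws @ vs)"
proof (induction ws arbitrary: us)
  case Nil
  then show ?case by simp
next
  case (Cons w ws)
  have "\<omega> x (us @ (w # ws) @ v # vs) = (-1) ^ length ws * \<omega> x ((us @ [w]) @ v # ws @ vs)"
    using Cons.IH[of "us @ [w]"] by simp
  also have "\<dots> = (-1) ^ length ws * - \<omega> x (us @ v # w # ws @ vs)"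
    using antisym_formD[OF assms, of x us w v "ws @ vs"] by simp
  finally show ?case by simp
qed

text \<open>Once the two equal arguments have been made adjacent, exchanging them shows that the
  value is its own negative.\<close>

lemma antisym_form_eq_0:
  assumes "antisym_form \<omega>" "i < j" "j < length vs" "vs ! i = vs ! j"
  shows "\<omega> x vs = 0"
proof -
  define us ws rs v where "us = take i vs" and "ws = take (j - Suc i) (drop (Suc i) vs)"
    and "rs = drop (Suc j) vs" and "v = vs ! j"
  have "drop (Suc i) vs = ws @ drop (j - Suc i) (drop (Suc i) vs)" 
    by (simp only: ws_def append_take_drop_id)
  also have "drop (j - Suc i) (drop (Suc i) vs) = v # rs"
    using assms by (simp add: v_def rs_def Cons_nth_drop_Suc)
  finally have vs: "vs = us @ v # ws @ v # rs"
    using id_take_nth_drop[of i vs] assms by (simp add: us_def v_def)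
  have "\<omega> x vs = (-1) ^ length ws * \<omega> x (us @ v # v # ws @ rs)"
    using antisym_form_move[OF assms(1), of x "us @ [v]" ws v rs] by (simp add: vs)
  moreover have "\<omega> x (us @ v # v # ws @ rs) = 0"
    using antisym_formD[OF assms(1), of x us v v] by simp
  ultimately show ?thesis by simp
qed

lemma antisym_form_move_even:
  assumes "antisym_form \<omega>" "even (length ps)"
  shows "\<omega> x (us @ ws @ ps @ vs) = \<omega> x (us @ ps @ ws @ vs)"
proof -
  have *: "\<omega> x (us @ ws @ ps @ vs) = (-1) ^ (length ws * length ps) * \<omega> x (us @ ps @ ws @ vs)" for us
  proof (induction ps arbitrary: us)
    case Nil
    then show ?case by simp
  next
    case (Cons p ps)
    have "\<omega> x (us @ ws @ (p # ps) @ vs) = (-1) ^ length ws * \<omega> x ((us @ [p]) @ ws @ ps @ vs)"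
      using antisym_form_move[OF assms(1)] by simp
    also have "\<dots> = (-1) ^ length ws * ((-1) ^ (length ws * length ps) * \<omega> x ((us @ [p]) @ ps @ ws @ vs))"
      by (simp only: Cons.IH)
    finally show ?case by (simp add: power_add)
  qed
  show ?thesis using assms(2) by (simp add: * power_mult mult.commute)
qed

text \<open>Blocks of even length commute with everything, so the arbitrary enumeration of internal
  edges in \<open>moduli_frame\<close> can be replaced by the order in which a tree lists
  them.\<close>

lemma antisym_form_concat_pairs:
  assumes "antisym_form \<omega>" "mset es = mset es'" "\<And>e. even (length (f e))"
  shows "\<omega> x (us @ concat (map f es) @ vs) = \<omega> x (us @ concat (map f es') @ vs)"
  using assms(2)
proof (induction es arbitrary: us es')
  case Nil
  then show ?case by simp
next
  case (Cons e es)
  then have "e \<in> set es'" by (metis list.set_intros(1) mset_eq_setD)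
  then obtain as bs where es': "es' = as @ e # bs" by (auto simp: in_set_conv_decomp)
  have "\<omega> x (us @ concat (map f (e # es)) @ vs) = \<omega> x ((us @ f e) @ concat (map f es) @ vs)" by simp
  also have "\<dots> = \<omega> x ((us @ f e) @ concat (map f (as @ bs)) @ vs)"
    using Cons.prems es' by (intro Cons.IH) simp
  also have "\<dots> = \<omega> x (us @ f e @ concat (map f as) @ concat (map f bs) @ vs)" by simp
  also have "\<dots> = \<omega> x (us @ concat (map f as) @ f e @ concat (map f bs) @ vs)"
    by (rule antisym_form_move_even[OF assms(1) assms(3), symmetric])
  finally show ?case by (simp add: es')
qed

section \<open>Decay of products of differentials in the directions they do not annihilate\<close>

section \<open>Exponential decay\<close>

text \<open>This makes \<open>('v, 'n) mpt\<close> a real vector space, on which the evaluation maps are linear.\<close>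

instantiation "fun" :: (type, real_vector) real_vector
begin

definition scaleR_fun :: "real \<Rightarrow> ('a \<Rightarrow> 'b) \<Rightarrow> 'a \<Rightarrow> 'b" where
  "scaleR_fun a f = (\<lambda>x. a *\<^sub>R f x)"

instance
  by standard (simp_all add: scaleR_fun_def fun_eq_iff algebra_simps)

end

text \<open>An injective linear map of finite-dimensional spaces is bounded below, here for the l1
  norms. The induction on \<open>J\<close> is Gaussian elimination and produces an explicit
  constant.\<close>

lemma functionals_bounded_below:
  fixes a :: "'l \<Rightarrow> 'j \<Rightarrow> real"
  assumes "finite J" "finite L"
    and "\<And>z. \<forall>l\<in>L. (\<Sum>j\<in>J. z j * a l j) = 0 \<Longrightarrow> \<forall>j\<in>J. z j = 0"
  shows "\<exists>c>0. \<forall>z. c * (\<Sum>j\<in>J. \<bar>z j\<bar>) \<le> (\<Sum>l\<in>L. \<bar>\<Sum>j\<in>J. z j * a l j\<bar>)"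
  using assms(1,3)
proof (induction J arbitrary: a)
  case empty
  show ?case by (intro exI[of _ 1]) simp
next
  case (insert e J)
  define T where "T z l = (\<Sum>j\<in>insert e J. z j * a l j)" for z l
  have "\<exists>l0\<in>L. a l0 e \<noteq> 0"
  proof (rule ccontr)
    assume "\<not> ?thesis"
    then have "a l e = 0" if "l \<in> L" for l using that by blast
    then have "\<forall>l\<in>L. (\<Sum>j\<in>insert e J. (if j = e then 1 else 0) * a l j) = 0"
      by (simp add: insert.hyps sum.neutral)
    then show False using insert.prems[of "\<lambda>j. if j = e then 1 else 0"] by auto
  qed
  then obtain l0 where l0: "l0 \<in> L" "a l0 e \<noteq> 0" by blast
  \<comment> \<open>Row \<open>l0\<close> is the pivot row for the variable \<open>e\<close>:
    subtracting \<open>r l\<close> times this row removes \<open>e\<close> from row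
    \<open>l\<close>.\<close>
  define r where "r l = a l e / a l0 e" for l
  define a' where "a' l j = a l j - r l * a l0 j" for l j
  have a': "(\<Sum>j\<in>J. z j * a' l j) = T z l - r l * T z l0" for z l
  proof -
    have "r l * a l0 e = a l e" using l0 by (simp add: r_def)
    then show ?thesis
      by (simp add: T_def insert.hyps a'_def algebra_simps sum_subtractf sum_distrib_left)
  qed
  have "\<forall>j\<in>J. z j = 0" if z: "\<forall>l\<in>L. (\<Sum>j\<in>J. z j * a' l j) = 0" for z
  proof -
    \<comment> \<open>Back substitution: the value at \<open>e\<close> is chosen to make the pivot
      row vanish.\<close>
    define z' where "z' = z(e := - (\<Sum>j\<in>J. z j * a l0 j) / a l0 e)"
    have eq: "(\<Sum>j\<in>J. z' j * b j) = (\<Sum>j\<in>J. z j * b j)" for b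
      using insert.hyps by (intro sum.cong) (auto simp: z'_def)
    then have "T z' l0 = 0"
      using l0 by (simp add: T_def insert.hyps(1,2) del: fun_upd_apply) (simp add: z'_def)
    then have "\<forall>l\<in>L. T z' l = 0" using a'[of z'] z by (simp add: eq)
    then have "\<forall>j\<in>insert e J. z' j = 0" unfolding T_def by (rule insert.prems)
    then show ?thesis using insert.hyps by (auto simp: z'_def split: if_splits)
  qed
  from insert.IH[OF this] obtain c where c: "c > 0"
    and IH: "\<And>z. c * (\<Sum>j\<in>J. \<bar>z j\<bar>) \<le> (\<Sum>l\<in>L. \<bar>\<Sum>j\<in>J. z j * a' l j\<bar>)" by blast
  define q where "q = \<bar>a l0 e\<bar>"
  define A where "A = (\<Sum>j\<in>J. \<bar>a l0 j\<bar>)"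
  define B where "B = (\<Sum>l\<in>L. \<bar>r l\<bar>)"
  \<comment> \<open>\<open>K\<close> combines the two estimates below: \<open>Z\<close> is at most
    (1 + B) / c times \<open>S\<close>, and the entry at \<open>e\<close> is at most S / q + (A / q)
    Z.\<close>
  define K where "K = 1 / q + (A / q + 1) * ((1 + B) / c)"
  have q: "q > 0" "A \<ge> 0" "B \<ge> 0" using l0 by (auto simp: q_def A_def B_def sum_nonneg)
  then have K: "K > 0" using c by (auto simp: K_def intro!: add_pos_nonneg)
  have "(\<Sum>j\<in>insert e J. \<bar>z j\<bar>) \<le> K * (\<Sum>l\<in>L. \<bar>T z l\<bar>)" for z
  proof -
    define S where "S = (\<Sum>l\<in>L. \<bar>T z l\<bar>)"
    define Z where "Z = (\<Sum>j\<in>J. \<bar>z j\<bar>)"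
    have T0: "\<bar>T z l0\<bar> \<le> S" unfolding S_def using assms(2) l0(1) by (intro member_le_sum) auto
    have "c * Z \<le> (\<Sum>l\<in>L. \<bar>T z l - r l * T z l0\<bar>)" using IH[of z] by (simp add: a' Z_def)
    also have "\<dots> \<le> (\<Sum>l\<in>L. \<bar>T z l\<bar> + \<bar>r l\<bar> * \<bar>T z l0\<bar>)"
      by (intro sum_mono) (metis abs_mult abs_triangle_ineq4)
    also have "\<dots> = S + B * \<bar>T z l0\<bar>" by (simp add: sum.distrib S_def B_def sum_distrib_right)
    also have "\<dots> \<le> S + B * S" using T0 q by (simp add: mult_left_mono)
    finally have Z: "Z \<le> (1 + B) / c * S" using c by (simp add: field_simps)
    have "z e * a l0 e = T z l0 - (\<Sum>j\<in>J. z j * a l0 j)" by (simp add: T_def insert.hyps)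
    then have "\<bar>z e\<bar> * q = \<bar>T z l0 - (\<Sum>j\<in>J. z j * a l0 j)\<bar>" by (simp add: q_def flip: abs_mult)
    also have "\<dots> \<le> \<bar>T z l0\<bar> + \<bar>\<Sum>j\<in>J. z j * a l0 j\<bar>" by (rule abs_triangle_ineq4)
    also have "\<bar>\<Sum>j\<in>J. z j * a l0 j\<bar> \<le> (\<Sum>j\<in>J. \<bar>z j\<bar> * A)"
    proof (rule order_trans[OF sum_abs sum_mono])
      fix j assume "j \<in> J"
      then have "\<bar>a l0 j\<bar> \<le> A" unfolding A_def using insert.hyps by (intro member_le_sum) auto
      then show "\<bar>z j * a l0 j\<bar> \<le> \<bar>z j\<bar> * A" by (simp add: abs_mult mult_left_mono)
    qed
    also have "\<dots> = A * Z" by (simp add: Z_def sum_distrib_left mult.commute)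
    finally have "\<bar>z e\<bar> * q \<le> S + A * Z" using T0 by simp
    then have "\<bar>z e\<bar> \<le> S / q + A / q * Z" using q by (simp add: field_simps)
    then have "(\<Sum>j\<in>insert e J. \<bar>z j\<bar>) \<le> S / q + (A / q + 1) * Z"
      using insert.hyps by (simp add: Z_def algebra_simps)
    also have "\<dots> \<le> S / q + (A / q + 1) * ((1 + B) / c * S)"
      using Z q by (intro add_left_mono mult_left_mono) auto
    also have "\<dots> = K * S" by (simp add: K_def algebra_simps add_divide_distrib)
    finally show ?thesis by (simp add: S_def)
  qed
  then have "\<forall>z. 1 / K * (\<Sum>j\<in>insert e J. \<bar>z j\<bar>) \<le> (\<Sum>l\<in>L. \<bar>T z l\<bar>)"
    using K by (simp add: field_simps)
  then show ?case using K unfolding T_def by (intro exI[of _ "1 / K"]) simp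
qed

text \<open>The functionals \<open>L\<close> are the exponents of the monomials whose differentials occur in a term;
  \<open>H\<close> stands for the directions that do not move the angles.\<close>

definition decay_term :: "'w set \<Rightarrow> 'w set \<Rightarrow> ('w::real_vector, 'w) form \<Rightarrow> bool" where
  "decay_term H A \<omega> \<longleftrightarrow> alternating_form \<omega> \<and> (\<exists>L. finite L
     \<and> (\<forall>l\<in>L. linear l \<and> (\<forall>x\<in>A. l x \<le> 0))
     \<and> (\<forall>x vs. (\<exists>v \<in> set vs \<inter> H. \<forall>l\<in>L. l v = 0) \<longrightarrow> \<omega> x vs = 0)
     \<and> (\<forall>vs. \<exists>C\<ge>0. \<forall>x\<in>A. \<bar>\<omega> x vs\<bar> \<le> C * exp (\<Sum>l\<in>L. l x)))"

text \<open>Different terms of a form carry different sets of functionals, hence the closure under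
  sums.\<close>

inductive decay_form :: "'w set \<Rightarrow> 'w set \<Rightarrow> ('w::real_vector, 'w) form \<Rightarrow> bool" for H A where
  decay_term: "decay_term H A \<omega> \<Longrightarrow> decay_form H A \<omega>"
| add: "decay_form H A \<omega> \<Longrightarrow> decay_form H A \<eta> \<Longrightarrow> decay_form H A (add_form \<omega> \<eta>)"

lemma decay_form_alternating: "decay_form H A \<omega> \<Longrightarrow> alternating_form \<omega>"
  by (induction rule: decay_form.induct) (simp_all add: decay_term_def alternating_form_add)

lemma set_nths_cases:
  assumes "v \<in> set vs"
  shows "v \<in> set (nths vs S) \<or> v \<in> set (nths vs (- S))"
  using assms by (auto simp: set_nths in_set_conv_nth)

text \<open>The product takes the union of the functionals: a vector annihilated by all of them
  kills whichever factor receives it, and the bounds multiply.\<close>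

lemma decay_term_wedge:
  assumes "decay_term H A \<omega>" "decay_term H A \<eta>"
  shows "decay_term H A (\<omega> \<and>\<^sub>f \<eta>)"
proof -
  from assms(1) obtain L where L: "finite L" "\<forall>l\<in>L. linear l \<and> (\<forall>x\<in>A. l x \<le> 0)"
    "\<forall>x vs. (\<exists>v \<in> set vs \<inter> H. \<forall>l\<in>L. l v = 0) \<longrightarrow> \<omega> x vs = 0"
    "\<forall>vs. \<exists>C\<ge>0. \<forall>x\<in>A. \<bar>\<omega> x vs\<bar> \<le> C * exp (\<Sum>l\<in>L. l x)"
    unfolding decay_term_def by blast
  from assms(2) obtain M where M: "finite M" "\<forall>l\<in>M. linear l \<and> (\<forall>x\<in>A. l x \<le> 0)"
    "\<forall>x vs. (\<exists>v \<in> set vs \<inter> H. \<forall>l\<in>M. l v = 0) \<longrightarrow> \<eta> x vs = 0"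
    "\<forall>vs. \<exists>C\<ge>0. \<forall>x\<in>A. \<bar>\<eta> x vs\<bar> \<le> C * exp (\<Sum>l\<in>M. l x)"
    unfolding decay_term_def by blast
  from L(4) obtain C where C: "\<And>vs. C vs \<ge> 0" "\<And>vs x. x \<in> A \<Longrightarrow> \<bar>\<omega> x vs\<bar> \<le> C vs * exp (\<Sum>l\<in>L. l x)"
    by metis
  from M(4) obtain D where D: "\<And>vs. D vs \<ge> 0" "\<And>vs x. x \<in> A \<Longrightarrow> \<bar>\<eta> x vs\<bar> \<le> D vs * exp (\<Sum>l\<in>M. l x)"
    by metis
  have "(\<omega> \<and>\<^sub>f \<eta>) x vs = 0" if "v \<in> set vs" "v \<in> H" "\<forall>l\<in>L \<union> M. l v = 0" for x vs v
    unfolding wedge_def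
  proof (intro sum.neutral ballI)
    fix S
    show "shuffle_sign S (length vs) * \<omega> x (nths vs S) * \<eta> x (nths vs (- S)) = 0"
      using set_nths_cases[OF that(1), of S]
    proof
      assume "v \<in> set (nths vs S)"
      then have "\<omega> x (nths vs S) = 0" using L(3) that by blast
      then show ?thesis by simp
    next
      assume "v \<in> set (nths vs (- S))"
      then have "\<eta> x (nths vs (- S)) = 0" using M(3) that by blast
      then show ?thesis by simp
    qed
  qed
  moreover have "\<exists>K\<ge>0. \<forall>x\<in>A. \<bar>(\<omega> \<and>\<^sub>f \<eta>) x vs\<bar> \<le> K * exp (\<Sum>l\<in>L \<union> M. l x)" for vs
  proof (intro exI conjI ballI)
    let ?K = "\<Sum>S\<in>Pow {..<length vs}. C (nths vs S) * D (nths vs (- S))"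
    show "?K \<ge> 0" using C D by (intro sum_nonneg) simp
    fix x assume x: "x \<in> A"
    \<comment> \<open>A functional common to both factors occurs once in the union; dropping its
      second copy only weakens the bound, since it is nonpositive on \<open>A\<close>.\<close>
    have "(\<Sum>l\<in>L. l x) + (\<Sum>l\<in>M. l x) = (\<Sum>l\<in>L \<union> M. l x) + (\<Sum>l\<in>L \<inter> M. l x)"
      using sum.union_inter[OF L(1) M(1)] by metis
    moreover have "(\<Sum>l\<in>L \<inter> M. l x) \<le> 0" using L(2) x by (intro sum_nonpos) auto
    ultimately have e: "exp (\<Sum>l\<in>L. l x) * exp (\<Sum>l\<in>M. l x) \<le> exp (\<Sum>l\<in>L \<union> M. l x)"
      by (simp flip: exp_add)
    have "\<bar>(\<omega> \<and>\<^sub>f \<eta>) x vs\<bar> \<le> (\<Sum>S\<in>Pow {..<length vs}. \<bar>\<omega> x (nths vs S)\<bar> * \<bar>\<eta> x (nths vs (- S))\<bar>)"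
      unfolding wedge_def
      by (intro order_trans[OF sum_abs sum_mono]) (simp add: abs_mult shuffle_sign_def power_abs)
    also have "\<dots> \<le> (\<Sum>S\<in>Pow {..<length vs}. C (nths vs S) * D (nths vs (- S)) * exp (\<Sum>l\<in>L \<union> M. l x))"
    proof (rule sum_mono)
      fix S
      have "\<bar>\<omega> x (nths vs S)\<bar> * \<bar>\<eta> x (nths vs (- S))\<bar>
          \<le> (C (nths vs S) * exp (\<Sum>l\<in>L. l x)) * (D (nths vs (- S)) * exp (\<Sum>l\<in>M. l x))"
        using C D x by (intro mult_mono) auto
      also have "\<dots> = C (nths vs S) * D (nths vs (- S)) * (exp (\<Sum>l\<in>L. l x) * exp (\<Sum>l\<in>M. l x))"
        by simp
      also have "\<dots> \<le> C (nths vs S) * D (nths vs (- S)) * exp (\<Sum>l\<in>L \<union> M. l x)"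
        using C(1) D(1) by (intro mult_left_mono[OF e]) simp
      finally show "\<bar>\<omega> x (nths vs S)\<bar> * \<bar>\<eta> x (nths vs (- S))\<bar>
          \<le> C (nths vs S) * D (nths vs (- S)) * exp (\<Sum>l\<in>L \<union> M. l x)" .
    qed
    finally show "\<bar>(\<omega> \<and>\<^sub>f \<eta>) x vs\<bar> \<le> ?K * exp (\<Sum>l\<in>L \<union> M. l x)"
      by (simp add: sum_distrib_right)
  qed
  moreover have "alternating_form (\<omega> \<and>\<^sub>f \<eta>)"
    using assms by (simp add: decay_term_def alternating_form_wedge)
  ultimately show ?thesis
    using L(1,2) M(1,2) unfolding decay_term_def by (intro conjI exI[of _ "L \<union> M"]) blast+
qed

lemma decay_form_wedge:
  assumes "decay_form H A \<omega>" "decay_form H A \<eta>"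
  shows "decay_form H A (\<omega> \<and>\<^sub>f \<eta>)"
  using assms(1)
proof (induction rule: decay_form.induct)
  case (decay_term \<omega>)
  from assms(2) show ?case
    by (induction rule: decay_form.induct)
      (simp_all add: decay_term decay_term_wedge decay_form.intros wedge_add_right)
next
  case (add \<omega> \<omega>')
  then show ?case by (simp add: wedge_add_left decay_form.add)
qed

lemma decay_form_fun_form:
  assumes "\<forall>x\<in>A. \<bar>f x\<bar> \<le> C"
  shows "decay_form H A (fun_form f)"
proof (rule decay_form.decay_term)
  have "\<exists>C\<ge>0. \<forall>x\<in>A. \<bar>fun_form f x vs\<bar> \<le> C * exp (\<Sum>l\<in>{}. l x)" for vs :: "'a list"
    using assms by (intro exI[of _ "max 0 C"]) (fastforce simp: fun_form_def le_max_iff_disj)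
  then show "decay_term H A (fun_form f)"
    unfolding decay_term_def
    by (intro conjI alternating_form_fun_form exI[of _ "{}"]) (auto simp: fun_form_def)
qed

lemma decay_form_wedge_list:
  assumes "\<And>\<omega>. \<omega> \<in> set \<omega>s \<Longrightarrow> decay_form H A \<omega>"
  shows "decay_form H A (wedge_list \<omega>s)"
  using assms
  by (induction \<omega>s) (auto simp: wedge_list_Nil wedge_list_Cons decay_form_wedge
      intro!: decay_form_fun_form[of _ _ 1])

text \<open>If the directions \<open>d j\<close> are not separated by the functionals of a term, then a combination of
  them is annihilated by the term, and by multilinearity so is every list containing all of them.\<close>

lemma decay_term_bound:
  assumes \<omega>: "decay_term H A \<omega>" and H: "subspace H"
    and d: "finite J" "\<And>j. j \<in> J \<Longrightarrow> d j \<in> H" "inj_on d J" "d ` J \<subseteq> set vs"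
  shows "\<exists>C c. c > 0 \<and> C \<ge> 0 \<and> (\<forall>z. p + (\<Sum>j\<in>J. z j *\<^sub>R d j) \<in> A \<longrightarrow>
      \<bar>\<omega> (p + (\<Sum>j\<in>J. z j *\<^sub>R d j)) vs\<bar> \<le> C * exp (- c * (\<Sum>j\<in>J. \<bar>z j\<bar>)))"
proof -
  from \<omega> obtain L where L: "finite L" "\<forall>l\<in>L. linear l \<and> (\<forall>x\<in>A. l x \<le> 0)"
    and "\<forall>x vs. (\<exists>v \<in> set vs \<inter> H. \<forall>l\<in>L. l v = 0) \<longrightarrow> \<omega> x vs = 0"
    and bd: "\<forall>vs. \<exists>C\<ge>0. \<forall>x\<in>A. \<bar>\<omega> x vs\<bar> \<le> C * exp (\<Sum>l\<in>L. l x)"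
    unfolding decay_term_def by blast
  then have kill: "\<omega> x vs = 0" if "v \<in> set vs" "v \<in> H" "\<forall>l\<in>L. l v = 0" for x vs v
    using that by blast
  from \<omega> have alt: "antisym_form \<omega>" "multilinear_form \<omega>"
    by (auto simp: decay_term_def alternating_form_def)
  have lin: "l (p + (\<Sum>j\<in>J. z j *\<^sub>R d j)) = l p + (\<Sum>j\<in>J. z j * l (d j))" if "l \<in> L" for l p z
    using L(2) that by (simp add: linear_add linear_sum linear_scale)
  show ?thesis
  \<comment> \<open>If the functionals separate the directions, their nonpositivity on
    \<open>A\<close> together with \<open>functionals_bounded_below\<close> forces decay in every
    coordinate of \<open>z\<close>.\<close>
  proof (cases "\<forall>z. (\<forall>l\<in>L. (\<Sum>j\<in>J. z j * l (d j)) = 0) \<longrightarrow> (\<forall>j\<in>J. z j = 0)")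
    case True
    then obtain c where c: "c > 0"
      and lb: "\<And>z. c * (\<Sum>j\<in>J. \<bar>z j\<bar>) \<le> (\<Sum>l\<in>L. \<bar>\<Sum>j\<in>J. z j * l (d j)\<bar>)"
      using functionals_bounded_below[OF d(1) L(1), of "\<lambda>l j. l (d j)"] by blast
    from bd obtain C where C: "C \<ge> 0" "\<And>x. x \<in> A \<Longrightarrow> \<bar>\<omega> x vs\<bar> \<le> C * exp (\<Sum>l\<in>L. l x)" by blast
    define K where "K = (\<Sum>l\<in>L. \<bar>l p\<bar>)"
    have "\<bar>\<omega> (p + (\<Sum>j\<in>J. z j *\<^sub>R d j)) vs\<bar> \<le> C * exp K * exp (- c * (\<Sum>j\<in>J. \<bar>z j\<bar>))"
      if A: "p + (\<Sum>j\<in>J. z j *\<^sub>R d j) \<in> A" for z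
    proof -
      let ?x = "p + (\<Sum>j\<in>J. z j *\<^sub>R d j)"
      \<comment> \<open>A nonpositive number is minus its absolute value; the reverse triangle
        inequality then splits off the part coming from \<open>p\<close>.\<close>
      have "l ?x \<le> \<bar>l p\<bar> - \<bar>\<Sum>j\<in>J. z j * l (d j)\<bar>" if "l \<in> L" for l
      proof -
        have "l ?x \<le> 0" using L(2) that A by blast
        then show ?thesis using lin[OF that, of p z] by linarith
      qed
      then have "(\<Sum>l\<in>L. l ?x) \<le> (\<Sum>l\<in>L. \<bar>l p\<bar> - \<bar>\<Sum>j\<in>J. z j * l (d j)\<bar>)" by (rule sum_mono)
      also have "\<dots> \<le> K - c * (\<Sum>j\<in>J. \<bar>z j\<bar>)" using lb[of z] by (simp add: sum_subtractf K_def)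
      finally have "exp (\<Sum>l\<in>L. l ?x) \<le> exp K * exp (- c * (\<Sum>j\<in>J. \<bar>z j\<bar>))"
        by (simp flip: exp_add)
      then have "C * exp (\<Sum>l\<in>L. l ?x) \<le> C * (exp K * exp (- c * (\<Sum>j\<in>J. \<bar>z j\<bar>)))"
        using C(1) by (rule mult_left_mono)
      then show ?thesis using C(2)[OF A] by (simp add: mult.assoc)
    qed
    then show ?thesis using C(1) c by (intro exI[of _ "C * exp K"] exI[of _ c]) auto
  next
    case False
    then obtain z j0 where z: "\<forall>l\<in>L. (\<Sum>j\<in>J. z j * l (d j)) = 0" and j0: "j0 \<in> J" "z j0 \<noteq> 0"
      by blast
    define w where "w = (\<Sum>j\<in>J. z j *\<^sub>R d j)"
    have w: "\<forall>l\<in>L. l w = 0" "w \<in> H"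
      using z L(2) H d by (auto simp: w_def linear_sum linear_scale intro!: subspace_sum subspace_scale)
    obtain i where i: "i < length vs" "vs ! i = d j0" using d(4) j0 by (metis image_subset_iff in_set_conv_nth)
    have "\<omega> x vs = 0" for x
    proof -
      let ?f = "\<lambda>v. \<omega> x (take i vs @ v # drop (Suc i) vs)"
      have f: "linear ?f" using alt(2) by (simp add: multilinear_form_def)
      \<comment> \<open>Position \<open>i\<close> belongs to \<open>d j0\<close>; placing another
        \<open>d j\<close> there repeats an argument of the list.\<close>
      have "?f (d j) = 0" if j: "j \<in> J" "j \<noteq> j0" for j
      proof -
        obtain k where k: "k < length vs" "vs ! k = d j"
          using d(4) j by (metis image_subset_iff in_set_conv_nth)
        then have "k \<noteq> i" using i d(3) j j0 by (metis inj_on_def)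
        let ?vs = "vs[i := d j]"
        have "?vs ! i = ?vs ! k" "length ?vs = length vs" using i k \<open>k \<noteq> i\<close> by auto
        then have "\<omega> x ?vs = 0"
          using antisym_form_eq_0[OF alt(1), of i k ?vs] antisym_form_eq_0[OF alt(1), of k i ?vs]
            \<open>k \<noteq> i\<close> i(1) k(1) by (metis nat_neq_iff)
        then show ?thesis using i(1) by (simp add: upd_conv_take_nth_drop)
      qed
      then have "?f w = (\<Sum>j\<in>J. if j = j0 then z j0 * ?f (d j0) else 0)"
        unfolding w_def linear_sum[OF f] linear_scale[OF f] by (intro sum.cong) auto
      also have "\<dots> = z j0 * ?f (d j0)" using d(1) j0 by simp
      also have "?f (d j0) = \<omega> x vs" using i by (metis id_take_nth_drop)
      finally have "z j0 * \<omega> x vs = ?f w" by simp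
      also have "\<dots> = 0" using w by (intro kill[of w]) auto
      finally show ?thesis using j0 by simp
    qed
    then show ?thesis by (intro exI[of _ 0] exI[of _ 1]) simp
  qed
qed

lemma decay_form_bound:
  assumes "decay_form H A \<omega>" "subspace H"
    and "finite J" "\<And>j. j \<in> J \<Longrightarrow> d j \<in> H" "inj_on d J" "d ` J \<subseteq> set vs"
  shows "\<exists>C c. c > 0 \<and> C \<ge> 0 \<and> (\<forall>z. p + (\<Sum>j\<in>J. z j *\<^sub>R d j) \<in> A \<longrightarrow>
      \<bar>\<omega> (p + (\<Sum>j\<in>J. z j *\<^sub>R d j)) vs\<bar> \<le> C * exp (- c * (\<Sum>j\<in>J. \<bar>z j\<bar>)))"
  using assms(1)
proof (induction rule: decay_form.induct)
  case (decay_term \<omega>)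
  then show ?case by (rule decay_term_bound[OF _ assms(2-6)])
next
  case (add \<omega> \<eta>)
  let ?x = "\<lambda>z. p + (\<Sum>j\<in>J. z j *\<^sub>R d j)" and ?e = "\<lambda>c z. exp (- c * (\<Sum>j\<in>J. \<bar>z j\<bar>))"
  from add.IH(1) obtain C c where C: "c > 0" "C \<ge> 0"
    and b: "\<forall>z. ?x z \<in> A \<longrightarrow> \<bar>\<omega> (?x z) vs\<bar> \<le> C * ?e c z" by (elim exE conjE)
  from add.IH(2) obtain C' c' where C': "c' > 0" "C' \<ge> 0"
    and b': "\<forall>z. ?x z \<in> A \<longrightarrow> \<bar>\<eta> (?x z) vs\<bar> \<le> C' * ?e c' z" by (elim exE conjE)
  have "\<bar>add_form \<omega> \<eta> (?x z) vs\<bar> \<le> (C + C') * ?e (min c c') z" if "?x z \<in> A" for z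
  proof -
    have "\<bar>add_form \<omega> \<eta> (?x z) vs\<bar> \<le> C * ?e c z + C' * ?e c' z"
      using b[rule_format, OF that] b'[rule_format, OF that] unfolding add_form_def by linarith
    also have "\<dots> \<le> C * ?e (min c c') z + C' * ?e (min c c') z"
      using C C' by (intro add_mono mult_left_mono) (auto intro!: mult_right_mono sum_nonneg)
    finally show ?thesis by (simp add: algebra_simps)
  qed
  then show ?case using C C' by (intro exI[of _ "C + C'"] exI[of _ "min c c'"]) auto
qed

section \<open>Regular monomials on a chart: derivatives, bounds and decay\<close>

subsection \<open>Forms on toric charts\<close>

lemma ext_d_fun_form:
  fixes h :: "'a::real_normed_vector \<Rightarrow> real"
  shows "ext_d (fun_form h) = (\<lambda>x vs. if length vs = 1 then frechet_derivative h (at x) (hd vs) else 0)"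
proof (intro ext)
  fix x and vs :: "'a list"
  consider "length vs = 0" | "length vs = 1" | "length vs > 1" by linarith
  then show "ext_d (fun_form h) x vs = (if length vs = 1 then frechet_derivative h (at x) (hd vs) else 0)"
  proof cases
    case 2
    then obtain v where "vs = [v]" by (auto simp: length_Suc_conv)
    then show ?thesis by (simp add: ext_d_def fun_form_def)
  next
    case 3
    have "take i vs @ drop (Suc i) vs \<noteq> []" if "i < length vs" for i
    proof -
      have "length (take i vs @ drop (Suc i) vs) \<noteq> 0" using 3 that by simp
      then show ?thesis unfolding length_0_conv .
    qed
    then have "frechet_derivative (\<lambda>y. fun_form h y (take i vs @ drop (Suc i) vs)) (at x) = (\<lambda>_. 0)"
      if "i < length vs" for i
      unfolding fun_form_def using that by (simp del: append_is_Nil_conv)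
    then show ?thesis using 3 by (simp add: ext_d_def)
  qed (simp add: ext_d_def)
qed

lemma norm_monomial: "norm (monomial u x) = exp (ivec u \<bullet> fst x)"
  by (simp add: monomial_def case_prod_unfold)

lemma monomial_has_derivative:
  "(monomial u has_derivative
    (\<lambda>v. monomial u x * Complex (ivec u \<bullet> fst v) (ivec u \<bullet> snd v))) (at x)"
proof -
  have eq: "monomial u = (\<lambda>x. exp (complex_of_real (ivec u \<bullet> fst x) + \<i> * complex_of_real (ivec u \<bullet> snd x)))"
    by (simp add: monomial_def fun_eq_iff case_prod_unfold Complex_eq)
  let ?g = "\<lambda>x. complex_of_real (ivec u \<bullet> fst x) + \<i> * complex_of_real (ivec u \<bullet> snd x)"
  have "(?g has_derivative ?g) (at x)"
    by (auto intro!: derivative_eq_intros)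
  moreover have "(exp has_derivative (\<lambda>h. exp (?g x) * h)) (at (?g x))"
    using DERIV_exp[of "?g x"] unfolding has_field_derivative_def .
  ultimately have "((\<lambda>x. exp (?g x)) has_derivative (\<lambda>v. exp (?g x) * ?g v)) (at x)"
    by (rule has_derivative_compose)
  then show ?thesis
    unfolding eq Complex_eq .
qed

lemma continuous_on_monomial: "continuous_on S (monomial u)"
  by (rule has_derivative_continuous_on)
    (rule has_derivative_at_withinI[OF monomial_has_derivative])

lemma ext_d_Re_monomial:
  "ext_d (fun_form (\<lambda>x. Re (monomial u x))) = (\<lambda>x vs. if length vs = 1
     then Re (monomial u x * Complex (ivec u \<bullet> fst (hd vs)) (ivec u \<bullet> snd (hd vs))) else 0)"
  unfolding ext_d_fun_form
  by (simp add: frechet_derivative_at[OF has_derivative_Re[OF monomial_has_derivative], symmetric] cong: if_cong)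

lemma ext_d_Im_monomial:
  "ext_d (fun_form (\<lambda>x. Im (monomial u x))) = (\<lambda>x vs. if length vs = 1
     then Im (monomial u x * Complex (ivec u \<bullet> fst (hd vs)) (ivec u \<bullet> snd (hd vs))) else 0)"
  unfolding ext_d_fun_form
  by (simp add: frechet_derivative_at[OF has_derivative_Im[OF monomial_has_derivative], symmetric] cong: if_cong)

lemma alternating_one_form:
  assumes "\<And>x. linear (l x)"
  shows "alternating_form (\<lambda>x vs. if length vs = 1 then l x (hd vs) else 0)"
proof -
  have "linear (\<lambda>v. if length (us @ v # vs) = 1 then l x (hd (us @ v # vs)) else 0)" for x us vs
    using assms[of x] by (cases us; cases vs) (simp_all add: module_hom_zero)
  then show ?thesis
    by (auto simp: alternating_form_def antisym_form_def multilinear_form_def)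
qed

text \<open>The differential of z^u is z^u (u.dr + i u.dphi), and the modulus of z^u is exp(u.r). So
  the single functional \<open>lam\<close>, which is u.r, governs the size and also, among
  directions that fix the angles, the kernel. The map \<open>f\<close> stands for real or imaginary
  part.\<close>

lemma decay_form_d_monomial:
  fixes e :: "'w::real_vector \<Rightarrow> 'n::finite pt"
  assumes e: "linear e" and A: "\<And>x. x \<in> A \<Longrightarrow> - fst (e x) \<in> \<sigma>" and H: "\<And>v. v \<in> H \<Longrightarrow> snd (e v) = 0"
    and u: "u \<in> dual_monoid \<sigma>" and f: "linear f" "\<And>z :: complex. \<bar>f z\<bar> \<le> norm z"
  shows "decay_form H A (pullback e (\<lambda>_. e) (\<lambda>x vs. if length vs = 1
     then f (monomial u x * Complex (ivec u \<bullet> fst (hd vs)) (ivec u \<bullet> snd (hd vs))) else 0))"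
proof (rule decay_form.decay_term)
  define l where "l x v = f (monomial u x * Complex (ivec u \<bullet> fst v) (ivec u \<bullet> snd v))" for x :: "'n pt" and v
  define lam where "lam p = ivec u \<bullet> fst (e p)" for p
  have lin: "linear (\<lambda>v. Complex (ivec u \<bullet> fst v) (ivec u \<bullet> snd v))"
    by (rule linearI) (auto simp: complex_eq_iff inner_add_right)
  have "linear (l x)" for x
  proof -
    have "l x = f \<circ> ((\<lambda>z. monomial u x * z) \<circ> (\<lambda>v. Complex (ivec u \<bullet> fst v) (ivec u \<bullet> snd v)))"
      by (simp add: l_def fun_eq_iff)
    then show ?thesis
      using linear_compose[OF linear_compose[OF lin linear_times] f(1)] by metis
  qed
  then have alt: "alternating_form (pullback e (\<lambda>_. e) (\<lambda>x vs. if length vs = 1 then l x (hd vs) else 0))"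
    by (intro alternating_form_pullback alternating_one_form e)
  have lam: "linear lam" "\<forall>x\<in>A. lam x \<le> 0"
  proof -
    show "linear lam"
      using e by (intro linearI) (auto simp: lam_def linear_add linear_scale inner_add_right)
    show "\<forall>x\<in>A. lam x \<le> 0" using u A by (force simp: dual_monoid_def lam_def)
  qed
  have kill: "pullback e (\<lambda>_. e) (\<lambda>x vs. if length vs = 1 then l x (hd vs) else 0) x vs = 0"
    if v: "v \<in> set vs" "v \<in> H" "lam v = 0" for x vs v
  proof (cases "length vs = 1")
    case True
    then have "vs = [v]" using v by (auto simp: length_Suc_conv)
    moreover have "Complex 0 0 = 0" by (simp add: complex_eq_iff)
    ultimately show ?thesis
      using v H[of v] f(1) by (simp add: pullback_def l_def lam_def linear_0)
  qed (simp add: pullback_def)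
  have bound: "\<bar>pullback e (\<lambda>_. e) (\<lambda>x vs. if length vs = 1 then l x (hd vs) else 0) x vs\<bar>
      \<le> norm (Complex (ivec u \<bullet> fst (e (hd vs))) (ivec u \<bullet> snd (e (hd vs)))) * exp (\<Sum>l\<in>{lam}. l x)" for x vs
  proof (cases "length vs = 1")
    case True
    then have "hd (map e vs) = e (hd vs)" by (cases vs) auto
    then show ?thesis
      using True order_trans[OF f(2) norm_mult_ineq]
      by (simp add: pullback_def l_def lam_def norm_mult norm_monomial mult.commute)
        (metis f(2) norm_mult norm_monomial mult.commute)
  qed (simp add: pullback_def)
  have "decay_term H A (pullback e (\<lambda>_. e) (\<lambda>x vs. if length vs = 1 then l x (hd vs) else 0))"
    unfolding decay_term_def
    using lam kill bound norm_ge_zero by (intro conjI alt exI[of _ "{lam}"]) blast+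
  then show "decay_term H A (pullback e (\<lambda>_. e) (\<lambda>x vs. if length vs = 1
     then f (monomial u x * Complex (ivec u \<bullet> fst (hd vs)) (ivec u \<bullet> snd (hd vs))) else 0))"
    unfolding l_def .
qed

text \<open>Over -\<sigma> every regular monomial lies in the closed unit disc. The argument of
  \<open>f\<close> therefore stays in a product of discs and points, which is compact by
  Tychonoff.\<close>

lemma chart_function_bounded:
  assumes "finite U" "U \<subseteq> dual_monoid \<sigma>" "smooth f"
  shows "\<exists>C. \<forall>x. - fst x \<in> \<sigma> \<longrightarrow> \<bar>f (\<lambda>u. if u \<in> U then monomial u x else 0)\<bar> \<le> C"
proof -
  define K where "K = PiE UNIV (\<lambda>u. if u \<in> U then cball 0 1 else {0 :: complex})"
  have "compactin (product_topology (\<lambda>_. euclidean) UNIV) K"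
    unfolding K_def compactin_PiE by simp
  then have "compact K" by (simp add: euclidean_product_topology)
  moreover have "continuous_on K f"
    using assms(3) by (cases rule: smooth.cases) (auto intro: continuous_on_subset)
  ultimately have "compact (f ` K)" by (rule compact_continuous_image[rotated])
  then obtain C where C: "\<And>y. y \<in> K \<Longrightarrow> \<bar>f y\<bar> \<le> C"
    using compact_imp_bounded[of "f ` K"] by (auto simp: bounded_iff)
  have "(\<lambda>u. if u \<in> U then monomial u x else 0) \<in> K" if "- fst x \<in> \<sigma>" for x
    using that assms(2) by (force simp: K_def norm_monomial dual_monoid_def)
  then show ?thesis using C by blast
qed

text \<open>In the application \<open>e\<close> is an evaluation map and \<open>A\<close> consists
  of curves whose marked point lies over -\<sigma>. Bounded functions and differentials of monomials
  decay, and the operations that generate the other chart forms preserve decay.\<close>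

lemma decay_form_chart:
  fixes e :: "'w::real_vector \<Rightarrow> 'n::finite pt"
  assumes "\<omega> \<in> chart_forms \<sigma>"
    and e: "linear e" "\<And>x. x \<in> A \<Longrightarrow> - fst (e x) \<in> \<sigma>" "\<And>v. v \<in> H \<Longrightarrow> snd (e v) = 0"
  shows "decay_form H A (pullback e (\<lambda>_. e) \<omega>)"
  using assms(1)
proof (induction rule: chart_forms.induct)
  case (smooth_fun U f)
  then obtain C where "\<forall>x. - fst x \<in> \<sigma> \<longrightarrow> \<bar>f (\<lambda>u. if u \<in> U then monomial u x else 0)\<bar> \<le> C"
    using chart_function_bounded by blast
  then show ?case
    unfolding pullback_fun_form using e(2) by (intro decay_form_fun_form[of _ _ C]) blast
next
  case (d_Re u)
  show ?case unfolding ext_d_Re_monomial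
    by (intro decay_form_d_monomial[where \<sigma> = \<sigma>] e d_Re abs_Re_le_cmod bounded_linear.linear[OF bounded_linear_Re])
next
  case (d_Im u)
  show ?case unfolding ext_d_Im_monomial
    by (intro decay_form_d_monomial[where \<sigma> = \<sigma>] e d_Im abs_Im_le_cmod bounded_linear.linear[OF bounded_linear_Im])
next
  case (wedge \<omega> \<eta>)
  then show ?case by (simp add: pullback_wedge decay_form_wedge)
next
  case (add \<omega> \<eta>)
  then show ?case by (simp add: pullback_add decay_form.add)
qed

text \<open>Alternation is part of \<open>decay_form\<close>, so decay for the identity map over the
  empty region already gives it.\<close>

lemma chart_form_alternating:
  fixes \<omega> :: "'n::finite tform"
  assumes "\<omega> \<in> chart_forms \<sigma>"
  shows "alternating_form \<omega>"
proof -
  have "pullback (\<lambda>x. x) (\<lambda>_ x. x) \<omega> = \<omega>" by (simp add: pullback_def)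
  moreover have "linear (\<lambda>x :: 'n pt. x)" by (rule linearI) simp_all
  ultimately show ?thesis
    using decay_form_alternating[OF decay_form_chart[OF assms, of "\<lambda>x. x" "{}" "{}"]] by simp
qed

lemma chart_form_continuous:
  assumes "\<omega> \<in> chart_forms \<sigma>"
  shows "continuous_on UNIV (\<lambda>x. \<omega> x vs)"
  using assms
proof (induction arbitrary: vs rule: chart_forms.induct)
  case (smooth_fun U f)
  from smooth_fun(3) have "continuous_on UNIV f" by (cases rule: smooth.cases) auto
  moreover have "continuous_on UNIV (\<lambda>x u. if u \<in> U then monomial u x else 0)"
  proof (rule continuous_on_coordinatewise_then_product)
    fix u
    show "continuous_on UNIV (\<lambda>x. if u \<in> U then monomial u x else 0)"
      by (cases "u \<in> U") (simp_all add: continuous_on_monomial)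
  qed
  ultimately have "continuous_on UNIV (\<lambda>x. f (\<lambda>u. if u \<in> U then monomial u x else 0))"
    by (rule continuous_on_compose2) simp
  then show ?case by (cases "vs = []") (simp_all add: fun_form_def)
next
  case (d_Re u)
  show ?case unfolding ext_d_Re_monomial
    by (cases "length vs = 1") (auto intro!: continuous_intros continuous_on_monomial)
next
  case (d_Im u)
  show ?case unfolding ext_d_Im_monomial
    by (cases "length vs = 1") (auto intro!: continuous_intros continuous_on_monomial)
next
  case (wedge \<omega> \<eta>)
  then show ?case unfolding wedge_def by (intro continuous_intros)
next
  case (add \<omega> \<eta>)
  then show ?case unfolding add_form_def by (intro continuous_intros)
qed

section \<open>The integrand of the moduli space for abstract evaluation maps\<close>

section \<open>Wedge products of pullbacks\<close>

text \<open>Each \<open>g \<alpha>\<close> also serves as its own derivative, as is right for the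
  linear evaluation maps.\<close>

definition eval_wedge :: "(nat \<Rightarrow> 'n tform) \<Rightarrow> (nat \<Rightarrow> 'w \<Rightarrow> 'n::finite pt) \<Rightarrow> nat list \<Rightarrow> ('w, 'w) form" where
  "eval_wedge \<gamma> g ms = wedge_list (map (\<lambda>\<alpha>. pullback (g \<alpha>) (\<lambda>_. g \<alpha>) (\<gamma> \<alpha>)) ms)"

lemma eval_wedge_Nil: "eval_wedge \<gamma> g [] = fun_form (\<lambda>_. 1)"
  by (simp add: eval_wedge_def wedge_list_Nil)

lemma eval_wedge_Cons:
  "eval_wedge \<gamma> g (\<alpha> # ms) = pullback (g \<alpha>) (\<lambda>_. g \<alpha>) (\<gamma> \<alpha>) \<and>\<^sub>f eval_wedge \<gamma> g ms"
  by (simp add: eval_wedge_def wedge_list_Cons)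

lemma eval_wedge_append:
  "eval_wedge \<gamma> g (ms @ ms') = eval_wedge \<gamma> g ms \<and>\<^sub>f eval_wedge \<gamma> g ms'"
  by (simp add: eval_wedge_def wedge_list_append)

lemma eval_wedge_cong:
  "(\<And>\<alpha>. \<alpha> \<in> set ms \<Longrightarrow> g \<alpha> = h \<alpha>) \<Longrightarrow> eval_wedge \<gamma> g ms = eval_wedge \<gamma> h ms"
  unfolding eval_wedge_def by (intro arg_cong[of _ _ wedge_list] map_cong refl) simp

lemma pullback_eval_wedge:
  "pullback f (\<lambda>_. f) (eval_wedge \<gamma> g ms) = eval_wedge \<gamma> (\<lambda>\<alpha> p. g \<alpha> (f p)) ms"
proof (induction ms)
  case Nil
  show ?case by (simp add: eval_wedge_Nil pullback_fun_form)
next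
  case (Cons \<alpha> ms)
  have "pullback f (\<lambda>_. f) (pullback (g \<alpha>) (\<lambda>_. g \<alpha>) (\<gamma> \<alpha>))
      = pullback (\<lambda>p. g \<alpha> (f p)) (\<lambda>_ p. g \<alpha> (f p)) (\<gamma> \<alpha>)"
    by (simp add: pullback_def o_def)
  then show ?case by (simp add: eval_wedge_Cons pullback_wedge Cons.IH)
qed

text \<open>The form sees its point and its arguments only through the maps
  \<open>g \<alpha>\<close>. This allows a frame to be exchanged for another one with the same
  images.\<close>

lemma eval_wedge_eq:
  assumes "length vs = length vs'"
    and "\<And>\<alpha>. \<alpha> \<in> set ms \<Longrightarrow> \<gamma> \<alpha> (g \<alpha> p) = \<gamma> \<alpha> (g \<alpha> p')"
    and "\<And>\<alpha>. \<alpha> \<in> set ms \<Longrightarrow> map (g \<alpha>) vs = map (g \<alpha>) vs'"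
  shows "eval_wedge \<gamma> g ms p vs = eval_wedge \<gamma> g ms p' vs'"
  using assms
proof (induction ms arbitrary: vs vs')
  case Nil
  then have "vs = [] \<longleftrightarrow> vs' = []" by auto
  then show ?case by (simp add: eval_wedge_Nil fun_form_def)
next
  case (Cons \<alpha> ms)
  have len: "length (nths vs S) = length (nths vs' S)" for S
    using Cons.prems(1) by (simp add: length_nths)
  have "eval_wedge \<gamma> g ms p (nths vs S) = eval_wedge \<gamma> g ms p' (nths vs' S)" for S
  proof (rule Cons.IH)
    show "map (g \<beta>) (nths vs S) = map (g \<beta>) (nths vs' S)" if "\<beta> \<in> set ms" for \<beta>
      using Cons.prems(3)[of \<beta>] that by (simp flip: nths_map)
  qed (use len Cons.prems(2) in simp_all)
  moreover have "map (g \<alpha>) (nths vs S) = map (g \<alpha>) (nths vs' S)" for S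
    using Cons.prems(3)[of \<alpha>] by (simp flip: nths_map)
  moreover have "\<gamma> \<alpha> (g \<alpha> p) = \<gamma> \<alpha> (g \<alpha> p')" using Cons.prems(2) by simp
  ultimately show ?case
    unfolding eval_wedge_Cons wedge_def pullback_def Cons.prems(1) by simp
qed

section \<open>Vectors in the kernel of a form\<close>

definition kills :: "('p, 'v) form \<Rightarrow> 'v \<Rightarrow> bool" where
  "kills \<omega> v \<longleftrightarrow> (\<forall>x vs. v \<in> set vs \<longrightarrow> \<omega> x vs = 0)"

lemma killsD: "kills \<omega> v \<Longrightarrow> v \<in> set vs \<Longrightarrow> \<omega> x vs = 0"
  by (simp add: kills_def)

lemma kills_wedge:
  assumes "kills \<omega> v" "kills \<eta> v"
  shows "kills (\<omega> \<and>\<^sub>f \<eta>) v"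
  unfolding kills_def
proof (intro allI impI)
  fix x vs assume v: "v \<in> set vs"
  have "\<omega> x (nths vs S) = 0 \<or> \<eta> x (nths vs (- S)) = 0" for S
    using set_nths_cases[OF v, of S] assms by (auto dest: killsD)
  then show "(\<omega> \<and>\<^sub>f \<eta>) x vs = 0"
    unfolding wedge_def by (intro sum.neutral) auto
qed

lemma kills_pullback:
  assumes "multilinear_form \<omega>" "D v = 0"
  shows "kills (pullback f (\<lambda>_. D) \<omega>) v"
  unfolding kills_def
proof (intro allI impI)
  fix x vs assume "v \<in> set vs"
  then obtain us ws where "vs = us @ v # ws" by (auto simp: in_set_conv_decomp)
  then show "pullback f (\<lambda>_. D) \<omega> x vs = 0"
    using linear_0[OF multilinear_formD[OF assms(1), of "f x" "map D us" "map D ws"]] assms(2)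
    by (simp add: pullback_def)
qed

lemma kills_eval_wedge:
  assumes "\<And>\<alpha>. \<alpha> \<in> set ms \<Longrightarrow> multilinear_form (\<gamma> \<alpha>)" "\<And>\<alpha>. \<alpha> \<in> set ms \<Longrightarrow> g \<alpha> v = 0"
  shows "kills (eval_wedge \<gamma> g ms) v"
  using assms
proof (induction ms)
  case Nil
  show ?case by (auto simp: kills_def eval_wedge_Nil fun_form_def)
next
  case (Cons \<alpha> ms)
  then show ?case
    unfolding eval_wedge_Cons by (intro kills_wedge kills_pullback Cons.IH) simp_all
qed

lemma kills_contract: "kills \<omega> v \<Longrightarrow> contract v \<omega> = (\<lambda>_ _. 0)"
  by (simp add: kills_def contract_def fun_eq_iff)

lemma kills_grade_sign: "kills \<omega> v \<Longrightarrow> kills (grade_sign \<omega>) v"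
  by (simp add: kills_def grade_sign_def)

text \<open>In the derivation rule the term that contracts \<eta> vanishes, so all of
  \<open>ps\<close> enters the left factor.\<close>

lemma wedge_contract_left:
  assumes "\<And>v. v \<in> set ps \<Longrightarrow> kills \<eta> v"
  shows "(\<omega> \<and>\<^sub>f \<eta>) x (ps @ vs) = ((\<lambda>x ws. \<omega> x (ps @ ws)) \<and>\<^sub>f \<eta>) x vs"
  using assms
proof (induction ps arbitrary: \<omega>)
  case Nil
  then show ?case by simp
next
  case (Cons p ps)
  have "(\<omega> \<and>\<^sub>f \<eta>) x ((p # ps) @ vs) = (contract p \<omega> \<and>\<^sub>f \<eta>) x (ps @ vs)"
    using Cons.prems by (simp add: wedge_Cons kills_contract wedge_zero_right)
  also have "\<dots> = ((\<lambda>x ws. contract p \<omega> x (ps @ ws)) \<and>\<^sub>f \<eta>) x vs"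
    using Cons.prems by (intro Cons.IH) simp
  finally show ?case by (simp add: contract_def)
qed

text \<open>Every vector that passes \<omega> applies \<open>grade_sign\<close> to it; an even
  number of vectors, such as the frames of edges, leaves no sign.\<close>

lemma wedge_contract_right:
  assumes "\<And>v. v \<in> set ps \<Longrightarrow> kills \<omega> v" "even (length ps)"
  shows "(\<omega> \<and>\<^sub>f \<eta>) x (ps @ vs) = (\<omega> \<and>\<^sub>f (\<lambda>x ws. \<eta> x (ps @ ws))) x vs"
proof -
  have "(\<omega> \<and>\<^sub>f \<eta>) x (ps @ vs)
      = ((if even (length ps) then \<omega> else grade_sign \<omega>) \<and>\<^sub>f (\<lambda>x ws. \<eta> x (ps @ ws))) x vs"
    using assms(1)
  proof (induction ps arbitrary: \<omega> \<eta>)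
    case Nil
    then show ?case by simp
  next
    case (Cons p ps)
    have "(\<omega> \<and>\<^sub>f \<eta>) x ((p # ps) @ vs) = (grade_sign \<omega> \<and>\<^sub>f contract p \<eta>) x (ps @ vs)"
      using Cons.prems by (simp add: wedge_Cons kills_contract wedge_zero_left)
    also have "\<dots> = ((if even (length ps) then grade_sign \<omega> else grade_sign (grade_sign \<omega>))
        \<and>\<^sub>f (\<lambda>x ws. contract p \<eta> x (ps @ ws))) x vs"
      using Cons.prems by (intro Cons.IH kills_grade_sign) simp
    finally show ?case by (simp add: contract_def grade_sign_grade_sign)
  qed
  then show ?thesis using assms(2) by simp
qed

section \<open>Torus-invariant forms: invariance, measurability and uniform decay\<close>

lemma trop_form_chart:
  assumes "\<omega> \<in> trop_forms F" "\<sigma> \<in> F"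
  shows "\<omega> \<in> chart_forms \<sigma>"
  using assms by (simp add: trop_forms_def)

lemma complete_fan_nonempty:
  assumes "complete_fan F"
  shows "\<exists>\<sigma>. \<sigma> \<in> F"
  using assms by (auto simp: complete_fan_def)

lemma trop_form_alternating:
  assumes "complete_fan F" "\<omega> \<in> trop_forms F"
  shows "alternating_form \<omega>"
proof -
  obtain \<sigma> where "\<sigma> \<in> F" using complete_fan_nonempty[OF assms(1)] ..
  then show ?thesis using chart_form_alternating trop_form_chart[OF assms(2)] by blast
qed

lemma trop_form_continuous:
  assumes "complete_fan F" "\<omega> \<in> trop_forms F"
  shows "continuous_on UNIV (\<lambda>x. \<omega> x vs)"
proof -
  obtain \<sigma> where "\<sigma> \<in> F" using complete_fan_nonempty[OF assms(1)] ..
  then show ?thesis using chart_form_continuous trop_form_chart[OF assms(2)] by blast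
qed

lemma trop_form_invariant:
  assumes "\<omega> \<in> trop_forms F" "fst x = fst x'"
  shows "\<omega> x = \<omega> x'"
proof
  fix vs
  obtain r \<phi> \<phi>' where x: "x = (r, \<phi>)" "x' = (r, \<phi>')" using assms(2) by (cases x; cases x') auto
  have "\<forall>r \<phi> \<phi>' vs. \<omega> (r, \<phi>) vs = \<omega> (r, \<phi>') vs" using assms(1) by (simp add: trop_forms_def)
  then show "\<omega> x vs = \<omega> x' vs" unfolding x by blast
qed

lemma alternating_eval_wedge:
  assumes "\<And>\<alpha>. \<alpha> \<in> set ms \<Longrightarrow> alternating_form (\<gamma> \<alpha>)" "\<And>\<alpha>. \<alpha> \<in> set ms \<Longrightarrow> linear (g \<alpha>)"
  shows "alternating_form (eval_wedge \<gamma> g ms)"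
  using assms
proof (induction ms)
  case Nil
  show ?case by (simp add: eval_wedge_Nil alternating_form_fun_form)
next
  case (Cons \<alpha> ms)
  then show ?case
    unfolding eval_wedge_Cons by (intro alternating_form_wedge alternating_form_pullback Cons.IH) simp_all
qed

lemma measurable_wedge:
  assumes "\<And>vs. (\<lambda>x. \<omega> (q x) vs) \<in> borel_measurable M" "\<And>vs. (\<lambda>x. \<eta> (q x) vs) \<in> borel_measurable M"
  shows "(\<lambda>x. (\<omega> \<and>\<^sub>f \<eta>) (q x) vs) \<in> borel_measurable M"
  unfolding wedge_def by (intro borel_measurable_sum borel_measurable_times borel_measurable_const assms)

lemma measurable_eval_wedge:
  fixes q :: "'x \<Rightarrow> 'w" and g :: "nat \<Rightarrow> 'w \<Rightarrow> 'n::finite pt"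
  assumes "complete_fan F" "\<And>\<alpha>. \<alpha> \<in> set ms \<Longrightarrow> \<gamma> \<alpha> \<in> trop_forms F"
    and "\<And>\<alpha>. \<alpha> \<in> set ms \<Longrightarrow> (\<lambda>x. g \<alpha> (q x)) \<in> borel_measurable M"
  shows "(\<lambda>x. eval_wedge \<gamma> g ms (q x) vs) \<in> borel_measurable M"
  using assms(2,3)
proof (induction ms arbitrary: vs)
  case Nil
  show ?case by (simp add: eval_wedge_Nil fun_form_def)
next
  case (Cons \<alpha> ms)
  show ?case unfolding eval_wedge_Cons
  proof (rule measurable_wedge)
    fix vs
    show "(\<lambda>x. eval_wedge \<gamma> g ms (q x) vs) \<in> borel_measurable M"
      using Cons.prems by (intro Cons.IH) simp_all
    have "(\<lambda>x. \<gamma> \<alpha> x (map (g \<alpha>) vs)) \<in> borel_measurable borel"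
      by (intro borel_measurable_continuous_onI trop_form_continuous[OF assms(1)] Cons.prems) simp
    from measurable_compose[OF Cons.prems(2) this, of \<alpha>]
    show "(\<lambda>x. pullback (g \<alpha>) (\<lambda>_. g \<alpha>) (\<gamma> \<alpha>) (q x) vs) \<in> borel_measurable M"
      by (simp add: pullback_def)
  qed
qed

text \<open>All convergence rests on this estimate. One cone is chosen for each marked point; on the
  region where every marked point lies over minus its cone, each factor is a decay form. By
  completeness of the fan finitely many such regions cover the whole space, and the smallest rate
  with the sum of the constants serves for all of them.\<close>

lemma eval_wedge_bound:
  fixes g :: "nat \<Rightarrow> 'w::real_vector \<Rightarrow> 'n::finite pt"
  assumes F: "complete_fan F" and \<gamma>: "\<And>\<alpha>. \<alpha> \<in> set ms \<Longrightarrow> \<gamma> \<alpha> \<in> trop_forms F"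
    and g: "\<And>\<alpha>. \<alpha> \<in> set ms \<Longrightarrow> linear (g \<alpha>)"
    and d: "finite J" "\<And>j \<alpha>. j \<in> J \<Longrightarrow> \<alpha> \<in> set ms \<Longrightarrow> snd (g \<alpha> (d j)) = 0" "inj_on d J" "d ` J \<subseteq> set vs"
  shows "\<exists>C c. c > 0 \<and> C \<ge> 0 \<and> (\<forall>z. \<bar>eval_wedge \<gamma> g ms (p + (\<Sum>j\<in>J. z j *\<^sub>R d j)) vs\<bar>
      \<le> C * exp (- c * (\<Sum>j\<in>J. \<bar>z j\<bar>)))"
proof -
  let ?x = "\<lambda>z. p + (\<Sum>j\<in>J. z j *\<^sub>R d j)"
  define H where "H = {v. \<forall>\<alpha>\<in>set ms. snd (g \<alpha> v) = 0}"
  \<comment> \<open>The sign reflects the convention that the monomials of the chart of \<sigma> are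
    bounded for \<open>r\<close> in -\<sigma>.\<close>
  define A where "A s = {p. \<forall>\<alpha>\<in>set ms. - fst (g \<alpha> p) \<in> s \<alpha>}" for s
  define P where "P = (\<Pi>\<^sub>E \<alpha>\<in>set ms. F)"
  have H: "subspace H"
    using g by (auto simp: H_def subspace_def linear_add linear_scale linear_0)
  define good where "good s C c \<longleftrightarrow> c > 0 \<and> C \<ge> 0 \<and> (\<forall>z. ?x z \<in> A s \<longrightarrow>
      \<bar>eval_wedge \<gamma> g ms (?x z) vs\<bar> \<le> C * exp (- c * (\<Sum>j\<in>J. \<bar>z j\<bar>)))" for s C c
  have "\<exists>C c. good s C c" if s: "s \<in> P" for s
    unfolding good_def
  proof (rule decay_form_bound)
    show "decay_form H (A s) (eval_wedge \<gamma> g ms)"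
      unfolding eval_wedge_def
    proof (rule decay_form_wedge_list)
      fix \<omega> assume "\<omega> \<in> set (map (\<lambda>\<alpha>. pullback (g \<alpha>) (\<lambda>_. g \<alpha>) (\<gamma> \<alpha>)) ms)"
      then obtain \<alpha> where \<alpha>: "\<alpha> \<in> set ms" "\<omega> = pullback (g \<alpha>) (\<lambda>_. g \<alpha>) (\<gamma> \<alpha>)" by auto
      have "s \<alpha> \<in> F" using s \<alpha>(1) by (auto simp: P_def)
      then show "decay_form H (A s) \<omega>"
        unfolding \<alpha>(2)
        by (intro decay_form_chart[where \<sigma> = "s \<alpha>"] trop_form_chart[OF \<gamma>] \<alpha> g)
          (use \<alpha>(1) in \<open>auto simp: A_def H_def\<close>)
    qed
    show "subspace H" "finite J" "inj_on d J" "d ` J \<subseteq> set vs" by (fact H d)+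
    show "d j \<in> H" if "j \<in> J" for j using d(2) that by (simp add: H_def)
  qed
  then obtain C c where good: "\<And>s. s \<in> P \<Longrightarrow> good s (C s) (c s)" by metis
  then have C: "\<And>s. s \<in> P \<Longrightarrow> c s > 0" "\<And>s. s \<in> P \<Longrightarrow> C s \<ge> 0"
    by (simp_all add: good_def)
  have b: "\<bar>eval_wedge \<gamma> g ms (?x z) vs\<bar> \<le> C s * exp (- c s * (\<Sum>j\<in>J. \<bar>z j\<bar>))"
    if "s \<in> P" "?x z \<in> A s" for s z
    using good[OF that(1)] that(2) unfolding good_def by blast
  have "finite F" using F by (simp add: complete_fan_def)
  then have fin: "finite P" by (auto simp: P_def intro!: finite_PiE)
  have ex: "\<exists>s\<in>P. y \<in> A s" for y
  proof -
    have "\<forall>\<alpha>. \<exists>\<sigma>. \<sigma> \<in> F \<and> - fst (g \<alpha> y) \<in> \<sigma>"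
      using F by (auto simp: complete_fan_def)
    then obtain s where "\<And>\<alpha>. s \<alpha> \<in> F \<and> - fst (g \<alpha> y) \<in> s \<alpha>" by metis
    then show ?thesis
      by (intro bexI[of _ "restrict s (set ms)"]) (auto simp: P_def A_def)
  qed
  then have ne: "P \<noteq> {}" by auto
  define c0 where "c0 = Min (c ` P)"
  have c0: "c0 > 0" "\<And>s. s \<in> P \<Longrightarrow> c0 \<le> c s"
    using C(1) fin ne by (auto simp: c0_def)
  have "\<bar>eval_wedge \<gamma> g ms (?x z) vs\<bar> \<le> (\<Sum>s\<in>P. C s) * exp (- c0 * (\<Sum>j\<in>J. \<bar>z j\<bar>))" for z
  proof -
    obtain s where s: "s \<in> P" "?x z \<in> A s" using ex by blast
    have "\<bar>eval_wedge \<gamma> g ms (?x z) vs\<bar> \<le> C s * exp (- c s * (\<Sum>j\<in>J. \<bar>z j\<bar>))"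
      by (rule b[OF s])
    also have "\<dots> \<le> (\<Sum>s\<in>P. C s) * exp (- c0 * (\<Sum>j\<in>J. \<bar>z j\<bar>))"
    proof (rule mult_mono)
      show "C s \<le> (\<Sum>s\<in>P. C s)" using C(2) fin s(1) by (intro member_le_sum) auto
      show "exp (- c s * (\<Sum>j\<in>J. \<bar>z j\<bar>)) \<le> exp (- c0 * (\<Sum>j\<in>J. \<bar>z j\<bar>))"
        using c0(2)[OF s(1)] by (auto intro!: mult_right_mono sum_nonneg)
    qed (auto intro!: sum_nonneg C)
    finally show ?thesis .
  qed
  moreover have "(\<Sum>s\<in>P. C s) \<ge> 0" using C(2) by (rule sum_nonneg)
  ultimately show ?thesis using c0(1) by (intro exI conjI allI)
qed

section \<open>Rooted trees, positions of marks and the integrand of a subtree\<close>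

section \<open>Curves as trees\<close>

text \<open>\<open>Edge e t\<close> attaches a bounded edge to the root of \<open>t\<close>, \<open>End b\<close> is an unbounded edge with
  vector \<open>b\<close>.  All edges are directed towards the root, so their vectors follow from the ends by
  the balancing condition.\<close>

datatype ('e, 'b) ctree =
    End 'b
  | Mark nat "('e, 'b) ctree"
  | Join "('e, 'b) ctree" "('e, 'b) ctree"
  | Edge 'e "('e, 'b) ctree"

primrec tvec :: "('e, 'b::monoid_add) ctree \<Rightarrow> 'b" where
  "tvec (End b) = b"
| "tvec (Mark \<alpha> t) = tvec t"
| "tvec (Join t1 t2) = tvec t1 + tvec t2"
| "tvec (Edge e t) = tvec t"

primrec tedges :: "('e, 'b) ctree \<Rightarrow> 'e list" where
  "tedges (End b) = []"
| "tedges (Mark \<alpha> t) = tedges t"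
| "tedges (Join t1 t2) = tedges t1 @ tedges t2"
| "tedges (Edge e t) = e # tedges t"

primrec tmarks :: "('e, 'b) ctree \<Rightarrow> nat list" where
  "tmarks (End b) = []"
| "tmarks (Mark \<alpha> t) = \<alpha> # tmarks t"
| "tmarks (Join t1 t2) = tmarks t1 @ tmarks t2"
| "tmarks (Edge e t) = tmarks t"

type_synonym ('e, 'n) cpt = "'n pt \<times> ('e \<Rightarrow> real \<times> real)"

definition shift :: "'e \<Rightarrow> int ^ 'n \<Rightarrow> ('e, 'n::finite) cpt \<Rightarrow> ('e, 'n) cpt" where
  "shift e m p = (fst p - (fst (snd p e) *\<^sub>R ivec m, snd (snd p e) *\<^sub>R ivec m), snd p)"

text \<open>Edges point towards the root, so what lies behind an edge with vector m is found by
  subtracting m times its length and twist from the root position. The value at \<open>End\<close>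
  is a dummy: an \<open>End\<close> has no marks.\<close>

primrec tpos :: "('e, int ^ 'n::finite) ctree \<Rightarrow> nat \<Rightarrow> ('e, 'n) cpt \<Rightarrow> 'n pt" where
  "tpos (End b) \<alpha> = fst"
| "tpos (Mark \<beta> t) \<alpha> = (if \<alpha> = \<beta> then fst else tpos t \<alpha>)"
| "tpos (Join t1 t2) \<alpha> = (if \<alpha> \<in> set (tmarks t1) then tpos t1 \<alpha> else tpos t2 \<alpha>)"
| "tpos (Edge e t) \<alpha> = (\<lambda>p. tpos t \<alpha> (shift e (tvec t) p))"

text \<open>The integrand of the state at the root of \<open>t\<close>, for fixed lengths and twists \<open>y\<close>.\<close>

primrec tform ::
    "(nat \<Rightarrow> 'n tform) \<Rightarrow> ('e \<Rightarrow> real \<times> real) \<Rightarrow> ('e, int ^ 'n::finite) ctree \<Rightarrow> 'n tform" where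
  "tform \<gamma> y (End b) = fun_form (\<lambda>_. 1)"
| "tform \<gamma> y (Mark \<alpha> t) = \<gamma> \<alpha> \<and>\<^sub>f tform \<gamma> y t"
| "tform \<gamma> y (Join t1 t2) = tform \<gamma> y t1 \<and>\<^sub>f tform \<gamma> y t2"
| "tform \<gamma> y (Edge e t) = (\<lambda>x vs. tform \<gamma> y t (fst (shift e (tvec t) (x, y)))
     ((0, ivec (tvec t)) # (ivec (tvec t), 0) # vs))"

definition edge_frame :: "'e \<Rightarrow> ('e, 'n::finite) cpt list" where
  "edge_frame e = [(0, (\<lambda>_. (0, 0))(e := (0, 1))), (0, (\<lambda>_. (0, 0))(e := (1, 0)))]"

definition sink_vec :: "'n pt \<Rightarrow> ('e, 'n::finite) cpt" where
  "sink_vec v = (v, \<lambda>_. (0, 0))"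

lemma linear_shift: "linear (shift e m)"
  by (rule linearI) (auto simp: shift_def plus_fun_def scaleR_fun_def algebra_simps)

lemma linear_tpos: "linear (tpos t \<alpha>)"
proof (induction t)
  case (Edge e t)
  show ?case using linear_compose[OF linear_shift Edge] by (simp add: o_def)
qed (auto simp: linear_fst)

lemma tpos_agree:
  "(\<And>e. e \<in> set (tedges t) \<Longrightarrow> y e = y' e) \<Longrightarrow> tpos t \<alpha> (x, y) = tpos t \<alpha> (x, y')"
  by (induction t arbitrary: x) (auto simp: shift_def)

text \<open>Lengths and twists of edges outside a subtree do not move its marks, which puts their
  frame vectors into the kernel of the form of that subtree.\<close>

lemma tpos_vertical:
  assumes "\<And>e. e \<in> set (tedges t) \<Longrightarrow> y e = 0"
  shows "tpos t \<alpha> (0, y) = 0"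
proof -
  have "tpos t \<alpha> (0, y) = tpos t \<alpha> (0, 0)"
    by (rule tpos_agree) (simp add: assms)
  also have "\<dots> = 0" using linear_0[OF linear_tpos] by (simp add: zero_prod_def)
  finally show ?thesis .
qed

lemma fst_tpos_agree:
  "fst x = fst x' \<Longrightarrow> (\<And>e. e \<in> set (tedges t) \<Longrightarrow> fst (y e) = fst (y' e))
    \<Longrightarrow> fst (tpos t \<alpha> (x, y)) = fst (tpos t \<alpha> (x', y'))"
  by (induction t arbitrary: x x') (auto simp: shift_def)

lemma snd_tpos_agree:
  "snd x = snd x' \<Longrightarrow> (\<And>e. e \<in> set (tedges t) \<Longrightarrow> snd (y e) = snd (y' e))
    \<Longrightarrow> snd (tpos t \<alpha> (x, y)) = snd (tpos t \<alpha> (x', y'))"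
  by (induction t arbitrary: x x') (auto simp: shift_def)

lemma eval_wedge_Mark:
  assumes "\<alpha> \<notin> set (tmarks t)"
  shows "eval_wedge \<gamma> (tpos (Mark \<alpha> t)) (tmarks (Mark \<alpha> t))
    = pullback fst (\<lambda>_. fst) (\<gamma> \<alpha>) \<and>\<^sub>f eval_wedge \<gamma> (tpos t) (tmarks t)"
proof -
  have "eval_wedge \<gamma> (tpos (Mark \<alpha> t)) (tmarks t) = eval_wedge \<gamma> (tpos t) (tmarks t)"
    using assms by (intro eval_wedge_cong) auto
  then show ?thesis by (simp add: eval_wedge_Cons)
qed

lemma eval_wedge_Join:
  assumes "set (tmarks t1) \<inter> set (tmarks t2) = {}"
  shows "eval_wedge \<gamma> (tpos (Join t1 t2)) (tmarks (Join t1 t2))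
    = eval_wedge \<gamma> (tpos t1) (tmarks t1) \<and>\<^sub>f eval_wedge \<gamma> (tpos t2) (tmarks t2)"
proof -
  have "eval_wedge \<gamma> (tpos (Join t1 t2)) (tmarks t1) = eval_wedge \<gamma> (tpos t1) (tmarks t1)"
    by (intro eval_wedge_cong) auto
  moreover have "eval_wedge \<gamma> (tpos (Join t1 t2)) (tmarks t2) = eval_wedge \<gamma> (tpos t2) (tmarks t2)"
    using assms by (intro eval_wedge_cong) auto
  ultimately show ?thesis by (simp add: eval_wedge_append)
qed

lemma eval_wedge_Edge:
  "eval_wedge \<gamma> (tpos (Edge e t)) (tmarks (Edge e t))
    = pullback (shift e (tvec t)) (\<lambda>_. shift e (tvec t)) (eval_wedge \<gamma> (tpos t) (tmarks t))"
proof -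
  have "tpos (Edge e t) = (\<lambda>\<alpha> p. tpos t \<alpha> (shift e (tvec t) p))" by (simp add: fun_eq_iff)
  then show ?thesis by (simp only: pullback_eval_wedge tmarks.simps)
qed

lemma set_edge_frames:
  assumes "v \<in> set (concat (map edge_frame es))"
  shows "\<exists>y. v = (0, y) \<and> (\<forall>e. e \<notin> set es \<longrightarrow> y e = 0)"
proof -
  from assms obtain e where e: "e \<in> set es" "v \<in> set (edge_frame e)" by auto
  then obtain b where "v = (0, (\<lambda>_. (0, 0))(e := b))"
    by (auto simp: edge_frame_def)
  then show ?thesis
    using e by (intro exI[of _ "(\<lambda>_. (0, 0))(e := b)"]) (auto simp: zero_prod_def)
qed

lemma wedge_sink_vec:
  "(\<omega> \<and>\<^sub>f \<eta>) (x, y) (map sink_vec vs)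
    = ((\<lambda>x vs. \<omega> (x, y) (map sink_vec vs)) \<and>\<^sub>f (\<lambda>x vs. \<eta> (x, y) (map sink_vec vs))) x vs"
  by (simp add: wedge_def nths_map)

text \<open>The frame is distributed over the factors: the two vectors of an edge reach only the
  marks behind this edge, and there they act as contractions with the edge vector. Hence the
  recursive \<open>tform\<close> is the value of the global form on the frames of all edges.\<close>

lemma tform_eq_eval_wedge:
  fixes t :: "('e, int ^ 'n::finite) ctree"
  assumes "distinct (tedges t)" "distinct (tmarks t)" "\<And>\<alpha>. \<alpha> \<in> set (tmarks t) \<Longrightarrow> alternating_form (\<gamma> \<alpha>)"
  shows "tform \<gamma> y t x vs
    = eval_wedge \<gamma> (tpos t) (tmarks t) (x, y) (concat (map edge_frame (tedges t)) @ map sink_vec vs)"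
  using assms
proof (induction t arbitrary: x vs)
  case (End b)
  show ?case by (simp add: eval_wedge_Nil fun_form_def)
next
  case (Mark \<alpha> t)
  let ?fr = "concat (map edge_frame (tedges t)) :: ('e, 'n) cpt list"
  let ?W = "eval_wedge \<gamma> (tpos t) (tmarks t)"
  have IH: "tform \<gamma> y t x vs = ?W (x, y) (?fr @ map sink_vec vs)" for x vs
    using Mark.prems by (intro Mark.IH) simp_all
  \<comment> \<open>The mark sits at the root, which no length or twist moves.\<close>
  have "kills (pullback fst (\<lambda>_. fst) (\<gamma> \<alpha>)) v" if "v \<in> set ?fr" for v
  proof -
    from set_edge_frames[OF that] obtain y where "v = (0, y)" by blast
    then show ?thesis
      using Mark.prems(3)[of \<alpha>] by (intro kills_pullback) (auto simp: alternating_form_def)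
  qed
  moreover have "even (length ?fr)"
    by (simp add: length_concat o_def edge_frame_def sum_list_triv)
  ultimately have "(pullback fst (\<lambda>_. fst) (\<gamma> \<alpha>) \<and>\<^sub>f ?W) (x, y) (?fr @ map sink_vec vs)
      = (pullback fst (\<lambda>_. fst) (\<gamma> \<alpha>) \<and>\<^sub>f (\<lambda>p ws. ?W p (?fr @ ws))) (x, y) (map sink_vec vs)"
    by (intro wedge_contract_right)
  also have "\<dots> = (\<gamma> \<alpha> \<and>\<^sub>f tform \<gamma> y t) x vs"
    unfolding wedge_sink_vec by (simp add: IH wedge_def pullback_def o_def sink_vec_def)
  finally show ?case
    using Mark.prems(2) by (subst eval_wedge_Mark) simp_all
next
  case (Join t1 t2)
  let ?fr1 = "concat (map edge_frame (tedges t1)) :: ('e, 'n) cpt list"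
  let ?fr2 = "concat (map edge_frame (tedges t2)) :: ('e, 'n) cpt list"
  let ?W1 = "eval_wedge \<gamma> (tpos t1) (tmarks t1)"
  let ?W2 = "eval_wedge \<gamma> (tpos t2) (tmarks t2)"
  have IH1: "tform \<gamma> y t1 x vs = ?W1 (x, y) (?fr1 @ map sink_vec vs)" for x vs
    using Join.prems by (intro Join.IH(1)) simp_all
  have IH2: "tform \<gamma> y t2 x vs = ?W2 (x, y) (?fr2 @ map sink_vec vs)" for x vs
    using Join.prems by (intro Join.IH(2)) simp_all
  have k1: "kills ?W2 v" if "v \<in> set ?fr1" for v
  proof (rule kills_eval_wedge)
    fix \<alpha> assume "\<alpha> \<in> set (tmarks t2)"
    then show "multilinear_form (\<gamma> \<alpha>)" using Join.prems(3) by (simp add: alternating_form_def)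
    from set_edge_frames[OF that] obtain y
      where "v = (0, y)" "\<forall>e. e \<notin> set (tedges t1) \<longrightarrow> y e = 0" by blast
    then show "tpos t2 \<alpha> v = 0" using Join.prems(1) by (auto intro!: tpos_vertical)
  qed
  have k2: "kills (\<lambda>p ws. ?W1 p (?fr1 @ ws)) v" if "v \<in> set ?fr2" for v
  proof -
    have "kills ?W1 v"
    proof (rule kills_eval_wedge)
      fix \<alpha> assume "\<alpha> \<in> set (tmarks t1)"
      then show "multilinear_form (\<gamma> \<alpha>)" using Join.prems(3) by (simp add: alternating_form_def)
      from set_edge_frames[OF that] obtain y
        where "v = (0, y)" "\<forall>e. e \<notin> set (tedges t2) \<longrightarrow> y e = 0" by blast
      then show "tpos t1 \<alpha> v = 0" using Join.prems(1) by (auto intro!: tpos_vertical)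
    qed
    then show ?thesis by (simp add: kills_def)
  qed
  have "even (length ?fr2)"
    by (simp add: length_concat o_def edge_frame_def sum_list_triv)
  then have "((\<lambda>p ws. ?W1 p (?fr1 @ ws)) \<and>\<^sub>f ?W2) (x, y) (?fr2 @ map sink_vec vs)
      = ((\<lambda>p ws. ?W1 p (?fr1 @ ws)) \<and>\<^sub>f (\<lambda>p ws. ?W2 p (?fr2 @ ws))) (x, y) (map sink_vec vs)"
    by (intro wedge_contract_right k2)
  also have "\<dots> = (tform \<gamma> y t1 \<and>\<^sub>f tform \<gamma> y t2) x vs"
    unfolding wedge_sink_vec by (simp add: IH1 IH2 wedge_def)
  finally have "(tform \<gamma> y t1 \<and>\<^sub>f tform \<gamma> y t2) x vs
      = (?W1 \<and>\<^sub>f ?W2) (x, y) (?fr1 @ ?fr2 @ map sink_vec vs)"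
    using wedge_contract_left[where ps = "?fr1" and \<eta> = "?W2" and \<omega> = "?W1" and x = "(x, y)"
        and vs = "?fr2 @ map sink_vec vs", OF k1] by (simp only:)
  then show ?case
    using Join.prems(2) by (subst eval_wedge_Join) simp_all
next
  case (Edge e t)
  let ?fr = "concat (map edge_frame (tedges t)) :: ('e, 'n) cpt list"
  let ?W = "eval_wedge \<gamma> (tpos t) (tmarks t)"
  let ?m = "ivec (tvec t) :: real ^ 'n"
  let ?s = "shift e (tvec t)"
  let ?pair = "[sink_vec (0, ?m), sink_vec (?m, 0)] :: ('e, 'n) cpt list"
  let ?pair' = "[(- 1) *\<^sub>R sink_vec (0, ?m), (- 1) *\<^sub>R sink_vec (?m, 0)] :: ('e, 'n) cpt list"
  have W: "antisym_form ?W" "multilinear_form ?W"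
    using alternating_eval_wedge[of "tmarks t" \<gamma> "tpos t"] Edge.prems(3) linear_tpos
    by (auto simp: alternating_form_def)
  have e: "e \<notin> set (tedges t)" using Edge.prems(1) by simp
  have fixed: "?s v = v" if "snd v e = (0, 0)" for v :: "('e, 'n) cpt"
    using that by (simp add: shift_def zero_prod_def[symmetric] prod_eq_iff)
  have fr: "map ?s ?fr = ?fr"
  proof (rule map_idI)
    fix v assume "v \<in> set ?fr"
    from set_edge_frames[OF this] obtain y
      where "v = (0, y)" "\<forall>e. e \<notin> set (tedges t) \<longrightarrow> y e = 0" by blast
    then show "?s v = v" using e by (intro fixed) (simp add: zero_prod_def)
  qed
  have sv: "map ?s (map sink_vec vs) = map sink_vec vs"
    by (rule map_idI) (auto intro!: fixed simp: sink_vec_def)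
  have drop: "tpos t \<alpha> (a, (\<lambda>_. (0, 0))(e := b)) = tpos t \<alpha> (a, \<lambda>_. (0, 0))" for \<alpha> a b
    using e by (intro tpos_agree) auto
  have "eval_wedge \<gamma> (tpos (Edge e t)) (tmarks (Edge e t)) (x, y)
      (edge_frame e @ ?fr @ map sink_vec vs)
    = ?W (?s (x, y)) (map ?s (edge_frame e) @ ?fr @ map sink_vec vs)"
    unfolding eval_wedge_Edge pullback_def by (simp only: map_append fr sv)
  \<comment> \<open>To the marks behind \<open>e\<close>, the frame vectors of \<open>e\<close> look
    like translations of the root by -m, first in the angles and then in the radii.\<close>
  also have "\<dots> = ?W (?s (x, y)) (?pair' @ ?fr @ map sink_vec vs)"
  proof (rule eval_wedge_eq)
    fix \<alpha>
    have "map (tpos t \<alpha>) (map ?s (edge_frame e)) = map (tpos t \<alpha>) ?pair'"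
      by (simp add: edge_frame_def shift_def drop sink_vec_def scaleR_fun_def)
    then show "map (tpos t \<alpha>) (map ?s (edge_frame e) @ ?fr @ map sink_vec vs)
        = map (tpos t \<alpha>) (?pair' @ ?fr @ map sink_vec vs)"
      by (simp only: map_append)
  qed (simp_all add: edge_frame_def)
  \<comment> \<open>The two minus signs cancel by multilinearity.\<close>
  also have "\<dots> = ?W (?s (x, y)) (?pair @ ?fr @ map sink_vec vs)"
  proof -
    let ?r = "?fr @ map sink_vec vs"
    have "?W (?s (x, y)) ([] @ (- 1) *\<^sub>R sink_vec (0, ?m) # (- 1) *\<^sub>R sink_vec (?m, 0) # ?r)
        = - ?W (?s (x, y)) ([] @ sink_vec (0, ?m) # (- 1) *\<^sub>R sink_vec (?m, 0) # ?r)"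
      by (subst linear_scale[OF multilinear_formD[OF W(2)]]) simp
    also have "\<dots> = ?W (?s (x, y)) ([sink_vec (0, ?m)] @ sink_vec (?m, 0) # ?r)"
      using linear_scale[OF multilinear_formD[OF W(2), of "?s (x, y)" "[sink_vec (0, ?m)]" ?r], of "- 1" "sink_vec (?m, 0)"]
      by simp
    finally show ?thesis by simp
  qed
  also have "\<dots> = ?W (?s (x, y)) ([] @ ?fr @ ?pair @ map sink_vec vs)"
    using antisym_form_move_even[OF W(1), of ?fr "?s (x, y)" "[]" ?pair "map sink_vec vs"]
    by (simp add: length_concat o_def edge_frame_def sum_list_triv)
  also have "\<dots> = tform \<gamma> y t (fst (?s (x, y))) ((0, ?m) # (?m, 0) # vs)"
    using Edge.IH[of "fst (?s (x, y))" "(0, ?m) # (?m, 0) # vs"] Edge.prems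
    by (simp add: shift_def)
  finally show ?case
    unfolding tform.simps tedges.simps list.map concat.simps append_assoc by (rule sym)
qed

section \<open>Measures on the factors of the moduli space\<close>

section \<open>Integration over lengths and twists\<close>

definition edge_measure :: "(real \<times> real) measure" where
  "edge_measure = restrict_space lborel {0<..} \<Otimes>\<^sub>M restrict_space lborel {0..<2 * pi}"

lemma sigma_finite_restrict_lborel: "S \<in> sets borel \<Longrightarrow> sigma_finite_measure (restrict_space lborel S)"
  by (intro sigma_finite_measure_restrict_space) (simp_all add: sigma_finite_lborel)

lemma finite_measure_circle: "finite_measure (restrict_space lborel {0..<2 * pi})"
  by (rule finite_measureI) (simp add: emeasure_restrict_space space_restrict_space)

text \<open>The origin of the factor 2 pi in the propagator.\<close>

lemma measure_circle: "measure (restrict_space lborel {0..<2 * pi}) (space (restrict_space lborel {0..<2 * pi})) = 2 * pi"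
  by (simp add: measure_restrict_space space_restrict_space)

lemma sigma_finite_pair_measure:
  assumes "sigma_finite_measure A" "sigma_finite_measure B"
  shows "sigma_finite_measure (A \<Otimes>\<^sub>M B)"
proof -
  interpret pair_sigma_finite A B using assms by (simp add: pair_sigma_finite_def)
  show ?thesis by unfold_locales
qed

lemma sigma_finite_edge_measure: "sigma_finite_measure edge_measure"
  unfolding edge_measure_def
  by (intro sigma_finite_pair_measure sigma_finite_restrict_lborel) simp_all

interpretation edges: product_sigma_finite "\<lambda>_. edge_measure"
  by (simp add: product_sigma_finite_def sigma_finite_edge_measure)

lemma sigma_finite_PiM_edges: "finite E \<Longrightarrow> sigma_finite_measure (\<Pi>\<^sub>M e\<in>E. edge_measure)"
  using edges.sigma_finite by blast

lemma integrable_pair_mult: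
  fixes f :: "'a \<Rightarrow> real" and g :: "'b \<Rightarrow> real"
  assumes "sigma_finite_measure A" "sigma_finite_measure B" "integrable A f" "integrable B g"
  shows "integrable (A \<Otimes>\<^sub>M B) (\<lambda>p. f (fst p) * g (snd p))"
proof -
  interpret pair_sigma_finite A B using assms(1,2) by (simp add: pair_sigma_finite_def)
  have [measurable]: "f \<in> borel_measurable A" "g \<in> borel_measurable B" using assms by auto
  show ?thesis
  proof (rule Fubini_integrable)
    show "integrable A (\<lambda>x. LINT y|B. norm (f (fst (x, y)) * g (snd (x, y))))"
      using assms(3) by (simp add: abs_mult)
    show "AE x in A. integrable B (\<lambda>y. f (fst (x, y)) * g (snd (x, y)))"
      using assms(4) by simp
  qed measurable
qed

text \<open>This includes the case that \<open>g\<close> is not integrable: then its lift is not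
  integrable either, because the second factor has positive mass, and both integrals take the
  default value 0.\<close>

lemma integral_pair_fst:
  fixes g :: "'a \<Rightarrow> real"
  assumes "sigma_finite_measure A" "finite_measure B" "measure B (space B) > 0"
  shows "(LINT p|(A \<Otimes>\<^sub>M B). g (fst p)) = measure B (space B) * (LINT x|A. g x)"
proof -
  interpret B: finite_measure B by fact
  interpret pair_sigma_finite A B
    using assms(1) B.sigma_finite_measure_axioms by (simp add: pair_sigma_finite_def)
  show ?thesis
  proof (cases "integrable A g")
    case True
    have "integrable (A \<Otimes>\<^sub>M B) (\<lambda>p. g (fst p) * 1)"
      using integrable_pair_mult[OF assms(1) B.sigma_finite_measure_axioms True, of "\<lambda>_. 1"] by simp
    then have "(LINT p|(A \<Otimes>\<^sub>M B). g (fst p)) = (LINT x|A. LINT y|B. g x)"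
      using integral_fst'[of "\<lambda>p. g (fst p)"] by simp
    then show ?thesis by (simp add: mult.commute)
  next
    case False
    have "\<not> integrable (A \<Otimes>\<^sub>M B) (\<lambda>p. g (fst p))"
    proof
      assume "integrable (A \<Otimes>\<^sub>M B) (\<lambda>p. g (fst p))"
      then have "integrable (A \<Otimes>\<^sub>M B) (case_prod (\<lambda>x y. g x))" by (simp add: case_prod_unfold)
      then have "AE y in B. integrable A g" by (rule AE_integrable_snd)
      with False have "AE y in B. False" by simp
      then have "emeasure B (space B) = 0" by (simp add: AE_iff_measurable[OF sets.top])
      then show False using assms(3) by (simp add: measure_def)
    qed
    with False show ?thesis by (simp add: not_integrable_integral_eq)
  qed
qed

section \<open>Integrability of the dominating exponentials\<close>

lemma integrable_exp_abs:
  assumes "c > 0"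
  shows "integrable lborel (\<lambda>x :: real. exp (- c * \<bar>x\<bar>))"
proof -
  have "(\<lambda>x. exp (- c * x)) absolutely_integrable_on {0..}"
    using assms by (intro nonnegative_absolutely_integrable_1 integrable_on_exp_minus_to_infinity) auto
  then have "integrable lebesgue (\<lambda>x. indicator {0..} x *\<^sub>R exp (- c * x))"
    by (simp add: set_integrable_def)
  then have 1: "integrable lborel (\<lambda>x. indicator {0..} x *\<^sub>R exp (- c * x))"
    by (subst (asm) integrable_completion) measurable
  then have 2: "integrable lborel (\<lambda>x. indicator {0..} (- x) *\<^sub>R exp (- c * - x))"
    using lborel_integrable_real_affine[OF 1, of "- 1" 0] by simp
  show ?thesis
    by (rule Bochner_Integration.integrable_bound[OF Bochner_Integration.integrable_add[OF 1 2]])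
      (auto simp: indicator_def)
qed

lemma integrable_exp_edge:
  assumes "c > 0"
  shows "integrable edge_measure (\<lambda>p. exp (- c * \<bar>fst p\<bar>))"
proof -
  have "set_integrable lborel {0<..} (\<lambda>x :: real. exp (- c * \<bar>x\<bar>))"
    unfolding set_integrable_def using integrable_exp_abs[OF assms]
    by (intro integrable_mult_indicator) auto
  then have "integrable (restrict_space lborel {0<..}) (\<lambda>x :: real. exp (- c * \<bar>x\<bar>))"
    by (simp add: integrable_restrict_space set_integrable_def)
  from integrable_pair_mult[OF sigma_finite_restrict_lborel
      finite_measure.axioms(1)[OF finite_measure_circle] this finite_measure.integrable_const[OF finite_measure_circle], of 1]
  show ?thesis by (simp add: edge_measure_def)
qed

lemma sum_vec_Basis:
  fixes x :: "real ^ 'n::finite" and f :: "real \<Rightarrow> real"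
  shows "(\<Sum>b\<in>Basis. f (x \<bullet> b)) = (\<Sum>j\<in>UNIV. f (x $ j))"
proof -
  have B: "(Basis :: (real ^ 'n) set) = range (\<lambda>j. axis j 1)"
    by (auto simp: Basis_vec_def)
  have "inj (\<lambda>j :: 'n. axis j (1 :: real))" by (auto simp: inj_on_def axis_eq_axis)
  then show ?thesis unfolding B by (subst sum.reindex) (simp_all add: inner_axis)
qed

text \<open>The l1 norm turns the exponential into a product over coordinates, so the
  one-dimensional case suffices.\<close>

lemma integrable_exp_vec:
  assumes "c > 0"
  shows "integrable lborel (\<lambda>x :: real ^ 'n::finite. exp (- c * (\<Sum>j\<in>UNIV. \<bar>x $ j\<bar>)))"
proof -
  interpret product_sigma_finite "\<lambda>_ :: real ^ 'n. lborel :: real measure"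
    by (simp add: product_sigma_finite_def sigma_finite_lborel)
  have [measurable]: "(\<lambda>x :: real ^ 'n. x $ j) \<in> borel_measurable borel" for j
    by (intro borel_measurable_continuous_onI continuous_intros)
  have eq: "(\<Sum>j\<in>UNIV. \<bar>(\<Sum>b\<in>Basis. f b *\<^sub>R b :: real ^ 'n) $ j\<bar>) = (\<Sum>b\<in>Basis. \<bar>f b\<bar>)" for f
    by (subst sum_vec_Basis[symmetric]) (intro sum.cong refl, simp)
  have "integrable (\<Pi>\<^sub>M b\<in>(Basis :: (real ^ 'n) set). lborel) (\<lambda>f. \<Prod>b\<in>Basis. exp (- c * \<bar>f b\<bar>))"
    using integrable_exp_abs[OF assms] by (intro product_integrable_prod) auto
  then have "integrable (\<Pi>\<^sub>M b\<in>(Basis :: (real ^ 'n) set). lborel)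
      (\<lambda>f. exp (- c * (\<Sum>j\<in>UNIV. \<bar>(\<Sum>b\<in>Basis. f b *\<^sub>R b :: real ^ 'n) $ j\<bar>)))"
    by (simp only: eq sum_distrib_left exp_sum[OF finite_Basis])
  then show ?thesis
    by (subst lborel_eq) (subst integrable_distr_eq; measurable)
qed

lemma sigma_finite_torus: "sigma_finite_measure (restrict_space lborel {\<phi> :: real ^ 'n::finite. \<forall>i. 0 \<le> \<phi> $ i \<and> \<phi> $ i < 2 * pi})"
  and finite_measure_torus: "finite_measure (restrict_space lborel {\<phi> :: real ^ 'n::finite. \<forall>i. 0 \<le> \<phi> $ i \<and> \<phi> $ i < 2 * pi})"
proof -
  let ?T = "{\<phi> :: real ^ 'n. \<forall>i. 0 \<le> \<phi> $ i \<and> \<phi> $ i < 2 * pi}"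
  have m: "(\<lambda>x :: real ^ 'n. x $ j) \<in> borel_measurable borel" for j
    by (intro borel_measurable_continuous_onI continuous_intros)
  have "?T = (\<Inter>i\<in>UNIV. (\<lambda>x. x $ i) -` {0..<2 * pi} \<inter> space borel)" by auto
  also have "\<dots> \<in> sets borel" by (intro sets.finite_INT measurable_sets[OF m]) auto
  finally have T: "?T \<in> sets borel" .
  then show "sigma_finite_measure (restrict_space lborel ?T)" by (rule sigma_finite_restrict_lborel)
  have "?T \<subseteq> cbox 0 (\<chi> i. 2 * pi)" by (auto simp: mem_box_cart less_imp_le)
  then have "emeasure lborel ?T \<le> emeasure lborel (cbox 0 (\<chi> i. 2 * pi) :: (real ^ 'n) set)"
    by (intro emeasure_mono) auto
  also have "\<dots> < \<infinity>" using emeasure_lborel_cbox_finite by simp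
  finally show "finite_measure (restrict_space lborel ?T)"
    using T by (intro finite_measureI) (simp add: emeasure_restrict_space space_restrict_space less_top)
qed

lemma sigma_finite_torus_measure: "sigma_finite_measure torus_measure"
  unfolding torus_measure_def
  by (intro sigma_finite_pair_measure sigma_finite_torus sigma_finite_lborel)

lemma integrable_exp_torus:
  assumes "c > 0"
  shows "integrable torus_measure (\<lambda>x :: 'n::finite pt. exp (- c * (\<Sum>j\<in>UNIV. \<bar>fst x $ j\<bar>)))"
  using integrable_pair_mult[OF sigma_finite_lborel sigma_finite_torus integrable_exp_vec[OF assms]
      finite_measure.integrable_const[OF finite_measure_torus], of 1]
  by (simp add: torus_measure_def)

lemma measurable_ident_restrict: "(\<lambda>x. x) \<in> borel_measurable (restrict_space lborel S)"
  by (rule measurable_restrict_space1) simp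

lemma measurable_edge_measure_ident: "(\<lambda>p. p) \<in> borel_measurable edge_measure"
proof -
  have "(\<lambda>p. (fst p, snd p)) \<in> borel_measurable edge_measure"
    unfolding edge_measure_def
    by (intro borel_measurable_Pair measurable_compose[OF measurable_fst measurable_ident_restrict]
        measurable_compose[OF measurable_snd measurable_ident_restrict])
  then show ?thesis by simp
qed

lemma measurable_torus_measure_ident: "(\<lambda>p :: 'n::finite pt. p) \<in> borel_measurable torus_measure"
proof -
  have "(\<lambda>p :: 'n pt. (fst p, snd p)) \<in> borel_measurable torus_measure"
    unfolding torus_measure_def
    by (intro borel_measurable_Pair measurable_compose[OF measurable_fst]
        measurable_compose[OF measurable_snd measurable_ident_restrict]) simp
  then show ?thesis by simp
qed

lemma measurable_edge_component:
  "e \<in> E \<Longrightarrow> (\<lambda>y. y e) \<in> borel_measurable (\<Pi>\<^sub>M e\<in>E. edge_measure)"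
  by (rule measurable_compose[OF measurable_component_singleton[of e E "\<lambda>_. edge_measure"]
        measurable_edge_measure_ident])

lemma measurable_tpos:
  fixes t :: "('e, int ^ 'n::finite) ctree"
  assumes "X \<in> borel_measurable M" "\<And>e. e \<in> set (tedges t) \<Longrightarrow> (\<lambda>w. Y w e) \<in> borel_measurable M"
  shows "(\<lambda>w. tpos t \<alpha> (X w, Y w)) \<in> borel_measurable M"
  using assms
proof (induction t arbitrary: X)
  case (End b)
  then show ?case by simp
next
  case (Mark \<beta> t)
  then show ?case by (cases "\<alpha> = \<beta>") simp_all
next
  case (Join t1 t2)
  then show ?case by (cases "\<alpha> \<in> set (tmarks t1)") simp_all
next
  case (Edge e t)
  have [measurable]: "X \<in> borel_measurable M" "(\<lambda>w. Y w e) \<in> borel_measurable M"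
    using Edge.prems by simp_all
  have f: "(\<lambda>w. fst (Y w e)) \<in> borel_measurable M" "(\<lambda>w. snd (Y w e)) \<in> borel_measurable M"
    by (auto intro!: measurable_compose[OF \<open>(\<lambda>w. Y w e) \<in> borel_measurable M\<close>]
        borel_measurable_continuous_onI continuous_intros)
  have "(\<lambda>w. (fst (Y w e) *\<^sub>R ivec (tvec t), snd (Y w e) *\<^sub>R ivec (tvec t)) :: 'n pt) \<in> borel_measurable M"
    by (intro borel_measurable_Pair borel_measurable_scaleR f borel_measurable_const)
  then have "(\<lambda>w. X w - (fst (Y w e) *\<^sub>R ivec (tvec t), snd (Y w e) *\<^sub>R ivec (tvec t))) \<in> borel_measurable M"
    by (intro borel_measurable_diff) simp_all
  from Edge.IH[OF this] show ?case using Edge.prems by (simp add: shift_def)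
qed

section \<open>Absolute convergence for a fixed tree\<close>

locale trop_data =
  fixes F :: "(real ^ 'n::finite) set set" and \<gamma> :: "nat \<Rightarrow> 'n tform"
    and t :: "('e, int ^ 'n) ctree"
  assumes fan: "complete_fan F"
    and trop: "\<And>\<alpha>. \<alpha> \<in> set (tmarks t) \<Longrightarrow> \<gamma> \<alpha> \<in> trop_forms F"
    and distinct_edges: "distinct (tedges t)"
    and distinct_marks: "distinct (tmarks t)"
begin

definition W :: "(('e, 'n) cpt, ('e, 'n) cpt) form" where
  "W = eval_wedge \<gamma> (tpos t) (tmarks t)"

lemma tform_eq_W: "tform \<gamma> y t x vs = W (x, y) (concat (map edge_frame (tedges t)) @ map sink_vec vs)"
  unfolding W_def using trop_form_alternating[OF fan trop]
  by (intro tform_eq_eval_wedge distinct_edges distinct_marks)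

text \<open>By torus invariance neither the angles of the root nor the twists affect the
  coefficients of the integrand.\<close>

lemma W_cong:
  assumes "fst x = fst x'" "\<And>e. e \<in> set (tedges t) \<Longrightarrow> fst (y e) = fst (y' e)"
  shows "W (x, y) vs = W (x', y') vs"
  unfolding W_def
proof (rule eval_wedge_eq)
  fix \<alpha> assume "\<alpha> \<in> set (tmarks t)"
  then show "\<gamma> \<alpha> (tpos t \<alpha> (x, y)) = \<gamma> \<alpha> (tpos t \<alpha> (x', y'))"
    by (intro trop_form_invariant[OF trop] fst_tpos_agree assms)
qed simp_all

lemma tform_cong:
  assumes "fst x = fst x'" "\<And>e. e \<in> set (tedges t) \<Longrightarrow> fst (y e) = fst (y' e)"
  shows "tform \<gamma> y t x vs = tform \<gamma> y' t x' vs"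
  unfolding tform_eq_W by (rule W_cong assms)+

lemma measurable_W:
  assumes "X \<in> borel_measurable M" "\<And>e. e \<in> set (tedges t) \<Longrightarrow> (\<lambda>w. Y w e) \<in> borel_measurable M"
  shows "(\<lambda>w. W (X w, Y w) vs) \<in> borel_measurable M"
  unfolding W_def
  by (rule measurable_eval_wedge[OF fan trop, where q = "\<lambda>w. (X w, Y w)"])
    (auto intro!: measurable_tpos assms)

definition edge_dir :: "'e \<Rightarrow> ('e, 'n) cpt" where
  "edge_dir e = (0, (\<lambda>_. (0, 0))(e := (1, 0)))"

definition radial_dir :: "'n \<Rightarrow> ('e, 'n) cpt" where
  "radial_dir j = ((axis j 1, 0), \<lambda>_. (0, 0))"

lemma sum_fun_apply: "(\<Sum>i\<in>I. f i) x = (\<Sum>i\<in>I. f i x)"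
  by (induction I rule: infinite_finite_induct) simp_all

lemma sum_edge_dir:
  assumes "finite E"
  shows "(\<Sum>e\<in>E. z e *\<^sub>R edge_dir e) = (0, \<lambda>e. if e \<in> E then (z e, 0) else (0, 0))"
proof -
  have "snd (\<Sum>e\<in>E. z e *\<^sub>R edge_dir e) e = (if e \<in> E then (z e, 0) else (0, 0))" for e
  proof -
    have "snd (\<Sum>e'\<in>E. z e' *\<^sub>R edge_dir e') e = (\<Sum>e'\<in>E. if e' = e then (z e, 0) else 0)"
      unfolding snd_sum sum_fun_apply
      by (intro sum.cong refl) (auto simp: scaleR_fun_def edge_dir_def zero_prod_def)
    also have "\<dots> = (if e \<in> E then (z e, 0) else (0, 0))" using assms by (simp add: zero_prod_def)
    finally show ?thesis .
  qed
  moreover have "fst (\<Sum>e\<in>E. z e *\<^sub>R edge_dir e) = 0" by (simp add: edge_dir_def fst_sum)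
  ultimately show ?thesis by (simp add: prod_eq_iff fun_eq_iff)
qed

lemma sum_radial_dir: "(\<Sum>j\<in>UNIV. r $ j *\<^sub>R radial_dir j) = ((r, 0), \<lambda>_. (0, 0))"
proof -
  have "(\<Sum>j\<in>UNIV. r $ j *\<^sub>R axis j 1) = r"
    by (simp add: vec_eq_iff axis_def if_distrib[of "(*) _"] cong: if_cong)
  then have "fst (\<Sum>j\<in>UNIV. r $ j *\<^sub>R radial_dir j) = (r, 0)"
    by (simp add: radial_dir_def fst_sum snd_sum prod_eq_iff)
  moreover have "snd (\<Sum>j\<in>UNIV. r $ j *\<^sub>R radial_dir j) e = (0, 0)" for e
    by (simp add: radial_dir_def snd_sum sum_fun_apply scaleR_fun_def zero_prod_def[symmetric])
  ultimately show ?thesis by (simp add: prod_eq_iff fun_eq_iff)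
qed

lemma snd_tpos_dir:
  "snd (tpos t \<alpha> (edge_dir e)) = 0" "snd (tpos t \<alpha> (radial_dir j)) = 0"
proof -
  have 0: "tpos t \<alpha> (0, \<lambda>_. (0, 0)) = 0"
    by (rule tpos_vertical) (simp add: zero_prod_def)
  have "snd (tpos t \<alpha> (edge_dir e)) = snd (tpos t \<alpha> (0, \<lambda>_. (0, 0)))"
    unfolding edge_dir_def by (rule snd_tpos_agree) auto
  then show "snd (tpos t \<alpha> (edge_dir e)) = 0" by (simp add: 0)
  have "snd (tpos t \<alpha> (radial_dir j)) = snd (tpos t \<alpha> (0, \<lambda>_. (0, 0)))"
    unfolding radial_dir_def by (rule snd_tpos_agree) auto
  then show "snd (tpos t \<alpha> (radial_dir j)) = 0" by (simp add: 0)
qed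

lemma inj_edge_dir: "inj_on edge_dir E"
proof (rule inj_onI)
  fix e e' assume "edge_dir e = edge_dir e'"
  then have "snd (edge_dir e) e = snd (edge_dir e') e" by simp
  then show "e = e'" by (auto simp: edge_dir_def split: if_splits)
qed

lemma edge_dir_in_frame: "edge_dir ` set (tedges t) \<subseteq> set (concat (map edge_frame (tedges t)))"
  by (auto simp: edge_dir_def edge_frame_def)

lemma integrable_prod_exp:
  assumes "c > 0" "finite E"
  shows "integrable (\<Pi>\<^sub>M e\<in>E. edge_measure) (\<lambda>y. exp (- c * (\<Sum>e\<in>E. \<bar>fst (y e)\<bar>)))"
proof -
  have "integrable (\<Pi>\<^sub>M e\<in>E. edge_measure) (\<lambda>y. \<Prod>e\<in>E. exp (- c * \<bar>fst (y e)\<bar>))"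
    by (intro edges.product_integrable_prod assms integrable_exp_edge)
  then show ?thesis by (simp only: sum_distrib_left exp_sum[OF assms(2)])
qed

text \<open>For a fixed root position only the lengths are unbounded, and every length direction
  occurs in the frame, so \<open>eval_wedge_bound\<close> applies. The result lets wedge products be
  exchanged with integrals in \<open>tstate_eq_ket\<close>.\<close>

lemma integrable_tform: "integrable (\<Pi>\<^sub>M e\<in>set (tedges t). edge_measure) (\<lambda>y. tform \<gamma> y t x vs)"
proof -
  let ?E = "set (tedges t)"
  let ?vs = "concat (map edge_frame (tedges t)) @ map sink_vec vs :: ('e, 'n) cpt list"
  have "\<exists>C c. c > 0 \<and> C \<ge> 0 \<and> (\<forall>z. \<bar>W ((x, 0) + (\<Sum>e\<in>?E. z e *\<^sub>R edge_dir e)) ?vs\<bar>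
      \<le> C * exp (- c * (\<Sum>e\<in>?E. \<bar>z e\<bar>)))"
    unfolding W_def
  proof (rule eval_wedge_bound[OF fan trop])
    show "edge_dir ` ?E \<subseteq> set ?vs" using edge_dir_in_frame by (simp add: le_supI1)
  qed (simp_all add: linear_tpos snd_tpos_dir inj_edge_dir)
  then obtain C c where c: "c > 0"
    and b: "\<forall>z. \<bar>W ((x, 0) + (\<Sum>e\<in>?E. z e *\<^sub>R edge_dir e)) ?vs\<bar> \<le> C * exp (- c * (\<Sum>e\<in>?E. \<bar>z e\<bar>))"
    by (elim exE conjE)
  \<comment> \<open>The twists may be set to 0 by torus invariance, which leaves a combination of
    the length directions.\<close>
  have eq: "W (x, y) ?vs = W ((x, 0) + (\<Sum>e\<in>?E. fst (y e) *\<^sub>R edge_dir e)) ?vs" for y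
    unfolding sum_edge_dir[OF finite_set] by simp (rule W_cong; simp)
  show ?thesis
  proof (rule Bochner_Integration.integrable_bound)
    show "integrable (\<Pi>\<^sub>M e\<in>?E. edge_measure) (\<lambda>y. C * exp (- c * (\<Sum>e\<in>?E. \<bar>fst (y e)\<bar>)))"
      by (intro integrable_mult_right integrable_prod_exp c) simp
    show "(\<lambda>y. tform \<gamma> y t x vs) \<in> borel_measurable (\<Pi>\<^sub>M e\<in>?E. edge_measure)"
      unfolding tform_eq_W by (intro measurable_W measurable_edge_component) simp_all
    have bound: "\<bar>tform \<gamma> y t x vs\<bar> \<le> C * exp (- c * (\<Sum>e\<in>?E. \<bar>fst (y e)\<bar>))" for y
      unfolding tform_eq_W eq using b by (rule spec)
    show "AE y in (\<Pi>\<^sub>M e\<in>?E. edge_measure). norm (tform \<gamma> y t x vs)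
        \<le> norm (C * exp (- c * (\<Sum>e\<in>?E. \<bar>fst (y e)\<bar>)))"
      unfolding real_norm_def by (intro AE_I2 order_trans[OF bound abs_ge_self])
  qed
qed

lemma set_enum_of_UNIV: "set (enum_of (UNIV :: 'n set)) = UNIV"
  unfolding enum_of_def using someI_ex[OF finite_distinct_list[OF finite[of "UNIV :: 'n set"]]]
  by (metis (mono_tags, lifting) conj_commute someI_ex)

text \<open>When the sink moves as well, the unbounded directions are the radial ones, contained in
  \<open>torus_frame\<close>, and all lengths. The joint decay justifies Fubini on the whole moduli
  space.\<close>

lemma integrable_tform_total:
  "integrable (torus_measure \<Otimes>\<^sub>M (\<Pi>\<^sub>M e\<in>set (tedges t). edge_measure))
    (\<lambda>p. tform \<gamma> (snd p) t (fst p) torus_frame)"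
proof -
  let ?E = "set (tedges t)"
  let ?J = "(UNIV :: 'n set) <+> ?E"
  let ?vs = "concat (map edge_frame (tedges t)) @ map sink_vec torus_frame :: ('e, 'n) cpt list"
  define d where "d = case_sum radial_dir edge_dir"
  have "\<exists>C c. c > 0 \<and> C \<ge> 0 \<and> (\<forall>z. \<bar>W (0 + (\<Sum>j\<in>?J. z j *\<^sub>R d j)) ?vs\<bar>
      \<le> C * exp (- c * (\<Sum>j\<in>?J. \<bar>z j\<bar>)))"
    unfolding W_def
  proof (rule eval_wedge_bound[OF fan trop])
    have "radial_dir j \<in> set (map sink_vec torus_frame)" for j
      by (auto simp: torus_frame_def radial_dir_def sink_vec_def set_enum_of_UNIV)
    then show "d ` ?J \<subseteq> set ?vs" using edge_dir_in_frame by (auto simp: d_def)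
    have "radial_dir j \<noteq> edge_dir e" for j e
      by (auto simp: radial_dir_def edge_dir_def zero_prod_def axis_eq_0_iff)
    moreover have "radial_dir j = radial_dir j' \<Longrightarrow> j = j'" for j j'
      by (auto simp: radial_dir_def axis_eq_axis)
    moreover have "edge_dir e = edge_dir e' \<Longrightarrow> e = e'" for e e'
      using inj_edge_dir[of UNIV] by (simp add: inj_def)
    ultimately show "inj_on d ?J"
      by (auto simp: inj_on_def d_def) metis+
    show "snd (tpos t \<alpha> (d j)) = 0" for j \<alpha>
      by (cases j) (simp_all add: d_def snd_tpos_dir)
  qed (simp_all add: linear_tpos)
  then obtain C c where c: "c > 0" and C: "C \<ge> 0"
    and b: "\<forall>z. \<bar>W (0 + (\<Sum>j\<in>?J. z j *\<^sub>R d j)) ?vs\<bar> \<le> C * exp (- c * (\<Sum>j\<in>?J. \<bar>z j\<bar>))"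
    by (elim exE conjE)
  let ?z = "\<lambda>x y. case_sum (\<lambda>j. fst x $ j) (\<lambda>e. fst (y e))"
  have eq: "W (x, y) ?vs = W (0 + (\<Sum>j\<in>?J. ?z x y j *\<^sub>R d j)) ?vs" for x y
  proof -
    have "(\<Sum>j\<in>?J. ?z x y j *\<^sub>R d j)
        = (\<Sum>j\<in>UNIV. fst x $ j *\<^sub>R radial_dir j) + (\<Sum>e\<in>?E. fst (y e) *\<^sub>R edge_dir e)"
      by (subst sum.Plus) (simp_all add: d_def)
    also have "\<dots> = ((fst x, 0), \<lambda>e. if e \<in> ?E then (fst (y e), 0) else (0, 0))"
      unfolding sum_radial_dir sum_edge_dir[OF finite_set] by (auto simp: fun_eq_iff zero_prod_def)
    finally show ?thesis by simp (rule W_cong; simp)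
  qed
  have abs: "(\<Sum>j\<in>?J. \<bar>?z x y j\<bar>) = (\<Sum>j\<in>UNIV. \<bar>fst x $ j\<bar>) + (\<Sum>e\<in>?E. \<bar>fst (y e)\<bar>)" for x y
    by (subst sum.Plus) simp_all
  show ?thesis
  proof (rule Bochner_Integration.integrable_bound)
    show "integrable (torus_measure \<Otimes>\<^sub>M (\<Pi>\<^sub>M e\<in>?E. edge_measure))
        (\<lambda>p. C * (exp (- c * (\<Sum>j\<in>UNIV. \<bar>fst (fst p) $ j\<bar>)) * exp (- c * (\<Sum>e\<in>?E. \<bar>fst (snd p e)\<bar>))))"
      by (intro integrable_mult_right integrable_pair_mult integrable_exp_torus[OF c]
          integrable_prod_exp[OF c] sigma_finite_torus_measure sigma_finite_PiM_edges) simp_all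
    have "(\<lambda>p. snd p e) \<in> borel_measurable (torus_measure \<Otimes>\<^sub>M (\<Pi>\<^sub>M e\<in>?E. edge_measure))" if "e \<in> ?E" for e
      by (rule measurable_compose[OF measurable_snd measurable_edge_component[OF that]])
    moreover have "fst \<in> borel_measurable (torus_measure \<Otimes>\<^sub>M (\<Pi>\<^sub>M e\<in>?E. edge_measure))"
      by (rule measurable_compose[OF measurable_fst measurable_torus_measure_ident])
    ultimately show "(\<lambda>p. tform \<gamma> (snd p) t (fst p) torus_frame)
        \<in> borel_measurable (torus_measure \<Otimes>\<^sub>M (\<Pi>\<^sub>M e\<in>?E. edge_measure))"
      unfolding tform_eq_W by (intro measurable_W)
    have bound: "\<bar>tform \<gamma> y t x torus_frame\<bar>
        \<le> C * (exp (- c * (\<Sum>j\<in>UNIV. \<bar>fst x $ j\<bar>)) * exp (- c * (\<Sum>e\<in>?E. \<bar>fst (y e)\<bar>)))" for x y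
      using b[rule_format, of "?z x y"]
      unfolding tform_eq_W eq[symmetric] abs by (simp add: algebra_simps flip: exp_add)
    show "AE p in torus_measure \<Otimes>\<^sub>M (\<Pi>\<^sub>M e\<in>?E. edge_measure). norm (tform \<gamma> (snd p) t (fst p) torus_frame)
        \<le> norm (C * (exp (- c * (\<Sum>j\<in>UNIV. \<bar>fst (fst p) $ j\<bar>)) * exp (- c * (\<Sum>e\<in>?E. \<bar>fst (snd p e)\<bar>))))"
      unfolding real_norm_def by (intro AE_I2 order_trans[OF bound abs_ge_self])
  qed
qed

end

section \<open>Partial integrals of the integrand as A-model states\<close>

section \<open>Amplitudes as integrals\<close>

lemma tform_agree:
  "(\<And>e. e \<in> set (tedges t) \<Longrightarrow> y e = y' e) \<Longrightarrow> tform \<gamma> y t = tform \<gamma> y' t"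
proof (induction t)
  case (Edge e t)
  then have "tform \<gamma> y t = tform \<gamma> y' t" "y e = y' e" by auto
  then show ?case by (simp add: shift_def)
next
  case (Join t1 t2)
  then have "tform \<gamma> y t1 = tform \<gamma> y' t1" "tform \<gamma> y t2 = tform \<gamma> y' t2" by auto
  then show ?case by simp
qed auto

text \<open>Fubini with the new edge as the outer variable: the subtree is integrated first, as the
  propagator acts on the state of the subtree.\<close>

lemma integral_PiM_insert_edge:
  fixes f :: "('e \<Rightarrow> real \<times> real) \<Rightarrow> real"
  assumes E: "finite E" "e \<notin> E" and f: "integrable (\<Pi>\<^sub>M e\<in>insert e E. edge_measure) f"
  shows "(LINT y|(\<Pi>\<^sub>M e\<in>insert e E. edge_measure). f y)
    = (LINT p|edge_measure. LINT y|(\<Pi>\<^sub>M e\<in>E. edge_measure). f (y(e := p)))"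
proof -
  let ?M = "\<lambda>I. \<Pi>\<^sub>M e\<in>I. edge_measure"
  interpret PE: sigma_finite_measure "?M E" by (rule sigma_finite_PiM_edges[OF E(1)])
  have "(\<lambda>(y, p). y(e := p)) \<in> measurable (?M E \<Otimes>\<^sub>M edge_measure) (?M (insert e E))"
    by (rule measurable_add_dim)
  then have "(\<lambda>q. (\<lambda>(y, p). y(e := p)) ((\<lambda>(x, y). (y, x)) q))
      \<in> measurable (edge_measure \<Otimes>\<^sub>M ?M E) (?M (insert e E))"
    by (rule measurable_compose[OF measurable_pair_swap'])
  from measurable_compose[OF this borel_measurable_integrable[OF f]]
  have "(\<lambda>(p, y). f (y(e := p))) \<in> borel_measurable (edge_measure \<Otimes>\<^sub>M ?M E)"
    by (simp add: case_prod_unfold)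
  then have meas: "(\<lambda>p. LINT y|?M E. f (y(e := p))) \<in> borel_measurable edge_measure"
    by (rule PE.borel_measurable_lebesgue_integral)
  have "(LINT y|?M (insert e E). f y) = (LINT x|?M {e}. LINT y|?M E. f (merge {e} E (x, y)))"
    using edges.product_integral_fold[of "{e}" E f] E f by simp
  also have "\<dots> = (LINT x|?M {e}. LINT y|?M E. f (y(e := x e)))"
  proof (intro Bochner_Integration.integral_cong refl arg_cong[where f = f])
    fix x y assume "y \<in> space (?M E)"
    then show "merge {e} E (x, y) = y(e := x e)"
      using E(2) by (auto simp: merge_def fun_eq_iff space_PiM PiE_def extensional_def)
  qed
  also have "\<dots> = (LINT p|edge_measure. LINT y|?M E. f (y(e := p)))"
    using edges.product_integral_singleton[OF meas] .
  finally show ?thesis .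
qed

text \<open>Branches that meet at a vertex share no edge, so their lengths and twists are
  independent. This makes \<open>mu2\<close> of integrated states the integral of the
  product.\<close>

lemma integral_PiM_Un_mult:
  fixes f g :: "('e \<Rightarrow> real \<times> real) \<Rightarrow> real"
  assumes I: "finite I" "finite J" "I \<inter> J = {}"
    and f: "integrable (\<Pi>\<^sub>M e\<in>I. edge_measure) f" "\<And>y y'. (\<And>e. e \<in> I \<Longrightarrow> y e = y' e) \<Longrightarrow> f y = f y'"
    and g: "integrable (\<Pi>\<^sub>M e\<in>J. edge_measure) g" "\<And>y y'. (\<And>e. e \<in> J \<Longrightarrow> y e = y' e) \<Longrightarrow> g y = g y'"
  shows "integrable (\<Pi>\<^sub>M e\<in>I \<union> J. edge_measure) (\<lambda>y. f y * g y)"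
    and "(LINT y|(\<Pi>\<^sub>M e\<in>I \<union> J. edge_measure). f y * g y)
      = (LINT y|(\<Pi>\<^sub>M e\<in>I. edge_measure). f y) * (LINT y|(\<Pi>\<^sub>M e\<in>J. edge_measure). g y)"
proof -
  let ?M = "\<lambda>I. \<Pi>\<^sub>M e\<in>I. edge_measure"
  have fm: "f (merge I J (x, y)) = f x" and gm: "g (merge I J (x, y)) = g y" for x y
    using I(3) by (auto intro!: f(2) g(2))
  have "f \<in> borel_measurable (?M (I \<union> J))"
  proof -
    have "(\<lambda>y. f (restrict y I)) \<in> borel_measurable (?M (I \<union> J))"
      by (rule measurable_compose[OF measurable_restrict_subset borel_measurable_integrable[OF f(1)]]) simp
    moreover have "f (restrict y I) = f y" for y by (rule f(2)) simp
    ultimately show ?thesis by simp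
  qed
  moreover have "g \<in> borel_measurable (?M (I \<union> J))"
  proof -
    have "(\<lambda>y. g (restrict y J)) \<in> borel_measurable (?M (I \<union> J))"
      by (rule measurable_compose[OF measurable_restrict_subset borel_measurable_integrable[OF g(1)]]) simp
    moreover have "g (restrict y J) = g y" for y by (rule g(2)) simp
    ultimately show ?thesis by simp
  qed
  ultimately have "(\<lambda>y. f y * g y) \<in> borel_measurable (?M (I \<union> J))" by (rule borel_measurable_times)
  then have "integrable (distr (?M I \<Otimes>\<^sub>M ?M J) (?M (I \<union> J)) (merge I J)) (\<lambda>y. f y * g y)
      \<longleftrightarrow> integrable (?M I \<Otimes>\<^sub>M ?M J) (\<lambda>p. f (merge I J p) * g (merge I J p))"
    by (rule integrable_distr_eq[OF measurable_merge])
  moreover have "(\<lambda>p. f (merge I J p) * g (merge I J p)) = (\<lambda>p. f (fst p) * g (snd p))"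
    by (auto simp: fun_eq_iff fm gm)
  moreover have "integrable (?M I \<Otimes>\<^sub>M ?M J) (\<lambda>p. f (fst p) * g (snd p))"
    by (intro integrable_pair_mult sigma_finite_PiM_edges f g I)
  moreover have "distr (?M I \<Otimes>\<^sub>M ?M J) (?M (I \<union> J)) (merge I J) = ?M (I \<union> J)"
    by (rule edges.distr_merge[OF I(3) I(1,2)])
  ultimately show int: "integrable (?M (I \<union> J)) (\<lambda>y. f y * g y)" by simp
  show "(LINT y|?M (I \<union> J). f y * g y) = (LINT y|?M I. f y) * (LINT y|?M J. g y)"
    by (simp add: edges.product_integral_fold[OF I(3) I(1,2) int] fm gm)
qed

section \<open>A-model operations on states of a single charge\<close>

lemma mu2_ket: "mu2 (ket \<omega> m) (ket \<eta> k) = ket (\<omega> \<and>\<^sub>f \<eta>) (m + k)"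
proof (intro ext)
  fix l x vs
  show "mu2 (ket \<omega> m) (ket \<eta> k) l x vs = ket (\<omega> \<and>\<^sub>f \<eta>) (m + k) l x vs"
  \<comment> \<open>The sum in \<open>mu2\<close> runs over the support of its first argument, which
    is empty for the zero form.\<close>
  proof (cases "\<omega> = (\<lambda>_ _. 0)")
    case True
    then show ?thesis by (simp add: mu2_def ket_def wedge_zero_left)
  next
    case False
    then have "{k. ket \<omega> m k \<noteq> (\<lambda>_ _. 0)} = {m}" by (auto simp: ket_def)
    moreover have "l - m = k \<longleftrightarrow> l = m + k" by (auto simp: algebra_simps)
    ultimately show ?thesis by (simp add: mu2_def ket_def wedge_zero_right)
  qed
qed

lemma pairing_ket:
  assumes "m + k = 0"
  shows "pairing (ket \<omega> m) (ket \<eta> k) = X_integral (\<omega> \<and>\<^sub>f \<eta>)"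
proof (cases "\<omega> = (\<lambda>_ _. 0)")
  case True
  then show ?thesis by (simp add: pairing_def ket_def wedge_zero_left X_integral_def)
next
  case False
  then have "{k. ket \<omega> m k \<noteq> (\<lambda>_ _. 0)} = {m}" by (auto simp: ket_def)
  moreover have "- m = k" using assms by (rule minus_unique)
  ultimately show ?thesis by (simp add: pairing_def ket_def)
qed

lemma observable_ket: "observable \<gamma> (ket \<omega> m) = ket (\<gamma> \<and>\<^sub>f \<omega>) m"
  by (simp add: observable_def ket_def wedge_zero_right fun_eq_iff)

text \<open>G_- acts before G_+, so the angular vector comes first in the argument list, just as the
  twist precedes the length in the frame of an edge.\<close>

lemma propagator_ket:
  "propagator (ket \<omega> m) = ket (\<lambda>x vs. 2 * pi * (LINT t:{0..}|lborel.
     \<omega> (fst x - t *\<^sub>R ivec m, snd x) ((0, ivec m) # (ivec m, 0) # vs))) m"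
proof (intro ext)
  fix l x vs
  show "propagator (ket \<omega> m) l x vs = ket (\<lambda>x vs. 2 * pi * (LINT t:{0..}|lborel.
     \<omega> (fst x - t *\<^sub>R ivec m, snd x) ((0, ivec m) # (ivec m, 0) # vs))) m l x vs"
    by (cases "l = m") (simp_all add: propagator_def scale_form_def K_op_def exp_neg_H_def pullback_def
        G_plus_def G_minus_def contract_def ket_def case_prod_unfold)
qed

text \<open>The counterpart of \<open>branch_state\<close>; there the propagator is tied to the
  vertex behind the edge, here it belongs to a separate \<open>Edge\<close> node.\<close>

primrec tstate ::
    "(nat \<Rightarrow> 'n::finite state \<Rightarrow> 'n state) \<Rightarrow> ('e, int ^ 'n) ctree \<Rightarrow> 'n state" where
  "tstate obs (End b) = divisor_state b"
| "tstate obs (Mark \<alpha> t) = obs \<alpha> (tstate obs t)"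
| "tstate obs (Join t1 t2) = mu2 (tstate obs t1) (tstate obs t2)"
| "tstate obs (Edge e t) = propagator (tstate obs t)"

lemma trop_data_subtree:
  "trop_data F \<gamma> (Mark \<alpha> t) \<Longrightarrow> trop_data F \<gamma> t"
  "trop_data F \<gamma> (Join t1 t2) \<Longrightarrow> trop_data F \<gamma> t1"
  "trop_data F \<gamma> (Join t1 t2) \<Longrightarrow> trop_data F \<gamma> t2"
  "trop_data F \<gamma> (Edge e t) \<Longrightarrow> trop_data F \<gamma> t"
  by (auto simp: trop_data_def)

text \<open>The integrand is independent of the twist of \<open>e\<close>, which contributes 2 pi;
  the remaining integral over the length is the one in \<open>K_op\<close>.\<close>

lemma propagator_eq_integral:
  fixes t :: "('e, int ^ 'n::finite) ctree" and x :: "'n pt"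
  assumes "trop_data F \<gamma> (Edge e t)"
  shows "2 * pi * (LINT \<tau>:{0..}|lborel. LINT y|(\<Pi>\<^sub>M e\<in>set (tedges t). edge_measure).
      tform \<gamma> y t (fst x - \<tau> *\<^sub>R ivec (tvec t), snd x) ((0, ivec (tvec t)) # (ivec (tvec t), 0) # vs))
    = (LINT y|(\<Pi>\<^sub>M e\<in>set (tedges (Edge e t)). edge_measure). tform \<gamma> y (Edge e t) x vs)"
proof -
  interpret E: trop_data F \<gamma> "Edge e t" by fact
  interpret t: trop_data F \<gamma> t by (rule trop_data_subtree(4)[OF assms])
  let ?E = "set (tedges t)" and ?m = "ivec (tvec t) :: real ^ 'n"
  let ?M = "\<lambda>I. \<Pi>\<^sub>M e\<in>I. edge_measure"
  let ?vs = "(0, ?m) # (?m, 0) # vs"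
  define h where "h \<tau> = (LINT y|?M ?E. tform \<gamma> y t (fst x - \<tau> *\<^sub>R ?m, snd x) ?vs)" for \<tau>
  have e: "e \<notin> ?E" using E.distinct_edges by simp
  have "(LINT y|?M (set (tedges (Edge e t))). tform \<gamma> y (Edge e t) x vs)
      = (LINT p|edge_measure. LINT y|?M ?E. tform \<gamma> (y(e := p)) (Edge e t) x vs)"
    using integral_PiM_insert_edge[OF finite_set e] E.integrable_tform[of x vs] by simp
  also have "\<dots> = (LINT p|edge_measure. h (fst p))"
  proof (intro Bochner_Integration.integral_cong refl)
    fix p
    have "tform \<gamma> (y(e := p)) (Edge e t) x vs = tform \<gamma> y t (fst x - fst p *\<^sub>R ?m, snd x) ?vs" for y
    proof -
      have "tform \<gamma> (y(e := p)) t = tform \<gamma> y t" using e by (intro tform_agree) auto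
      then have "tform \<gamma> (y(e := p)) (Edge e t) x vs
          = tform \<gamma> y t (fst (shift e (tvec t) (x, y(e := p)))) ?vs" by simp
      also have "\<dots> = tform \<gamma> y t (fst x - fst p *\<^sub>R ?m, snd x) ?vs"
        by (rule t.tform_cong) (simp_all add: shift_def)
      finally show ?thesis .
    qed
    then show "(LINT y|?M ?E. tform \<gamma> (y(e := p)) (Edge e t) x vs) = h (fst p)"
      by (simp add: h_def)
  qed
  also have "\<dots> = 2 * pi * (LINT \<tau>|restrict_space lborel {0<..}. h \<tau>)"
    unfolding edge_measure_def
    by (subst integral_pair_fst[OF sigma_finite_restrict_lborel finite_measure_circle])
      (unfold measure_circle, simp_all)
  also have "(LINT \<tau>|restrict_space lborel {0<..}. h \<tau>) = (LINT \<tau>|lborel. indicator {0<..} \<tau> *\<^sub>R h \<tau>)"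
    by (rule integral_restrict_space) simp
  \<comment> \<open>Lengths are positive whereas \<open>K_op\<close> integrates from 0; the endpoint
    is a null set.\<close>
  also have "\<dots> = (LINT \<tau>|lborel. indicator {0..} \<tau> *\<^sub>R h \<tau>)"
    by (rule integral_discrete_difference[of "{0}"]) (auto simp: indicator_def)
  finally show ?thesis by (simp add: h_def set_lebesgue_integral_def)
qed

text \<open>Marks are handled by linearity of the integral, joins by independence of the edges of
  the two branches, edges by \<open>propagator_eq_integral\<close>. The charge is
  \<open>tvec t\<close> because \<open>mu2\<close> adds charges and the other operators preserve
  them.\<close>

lemma tstate_eq_ket:
  fixes t :: "('e, int ^ 'n::finite) ctree"
  assumes "trop_data F \<gamma> t"
  shows "tstate (\<lambda>\<alpha>. observable (\<gamma> \<alpha>)) t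
    = ket (\<lambda>x vs. LINT y|(\<Pi>\<^sub>M e\<in>set (tedges t). edge_measure). tform \<gamma> y t x vs) (tvec t)"
  using assms
proof (induction t)
  case (End b)
  have "(LINT y|(\<Pi>\<^sub>M e\<in>set (tedges (End b :: ('e, int ^ 'n) ctree)). edge_measure). tform \<gamma> y (End b) x vs)
      = fun_form (\<lambda>_. 1) x vs" for x vs
  proof -
    \<comment> \<open>An empty product of measures has total mass 1, so integrating over no edges
      changes nothing.\<close>
    have "measure (\<Pi>\<^sub>M e\<in>({} :: 'e set). edge_measure) (space (\<Pi>\<^sub>M e\<in>({} :: 'e set). edge_measure)) = 1"
      by (simp add: PiM_empty)
    then show ?thesis by (simp del: space_PiM_empty)
  qed
  then show ?case by (simp only: tstate.simps divisor_state_def tvec.simps)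
next
  case (Mark \<alpha> t)
  interpret t: trop_data F \<gamma> t by (rule trop_data_subtree(1)[OF Mark.prems])
  have "\<gamma> \<alpha> \<and>\<^sub>f (\<lambda>x vs. LINT y|(\<Pi>\<^sub>M e\<in>set (tedges t). edge_measure). tform \<gamma> y t x vs)
      = (\<lambda>x vs. LINT y|(\<Pi>\<^sub>M e\<in>set (tedges t). edge_measure). (\<gamma> \<alpha> \<and>\<^sub>f tform \<gamma> y t) x vs)"
    unfolding wedge_def
    by (intro ext, subst Bochner_Integration.integral_sum) (simp_all add: t.integrable_tform)
  then show ?case by (simp add: Mark.IH[OF t.trop_data_axioms] observable_ket)
next
  case (Join t1 t2)
  interpret t1: trop_data F \<gamma> t1 by (rule trop_data_subtree(2)[OF Join.prems])
  interpret t2: trop_data F \<gamma> t2 by (rule trop_data_subtree(3)[OF Join.prems])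
  interpret T: trop_data F \<gamma> "Join t1 t2" by (rule Join.prems)
  let ?M = "\<lambda>I. \<Pi>\<^sub>M e\<in>I. edge_measure"
  let ?E1 = "set (tedges t1)" and ?E2 = "set (tedges t2)"
  have disj: "?E1 \<inter> ?E2 = {}" using T.distinct_edges by simp
  have prod: "integrable (?M (?E1 \<union> ?E2)) (\<lambda>y. tform \<gamma> y t1 x vs * tform \<gamma> y t2 x ws)"
    "(LINT y|?M (?E1 \<union> ?E2). tform \<gamma> y t1 x vs * tform \<gamma> y t2 x ws)
      = (LINT y|?M ?E1. tform \<gamma> y t1 x vs) * (LINT y|?M ?E2. tform \<gamma> y t2 x ws)" for x vs ws
  proof -
    have a1: "tform \<gamma> y t1 x vs = tform \<gamma> y' t1 x vs" if "\<And>e. e \<in> ?E1 \<Longrightarrow> y e = y' e" for y y'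
      by (rule fun_cong[OF fun_cong[OF tform_agree]]) (rule that)
    have a2: "tform \<gamma> y t2 x ws = tform \<gamma> y' t2 x ws" if "\<And>e. e \<in> ?E2 \<Longrightarrow> y e = y' e" for y y'
      by (rule fun_cong[OF fun_cong[OF tform_agree]]) (rule that)
    note mult = integral_PiM_Un_mult[OF finite_set finite_set disj t1.integrable_tform[of x vs] a1
        t2.integrable_tform[of x ws] a2]
    show "integrable (?M (?E1 \<union> ?E2)) (\<lambda>y. tform \<gamma> y t1 x vs * tform \<gamma> y t2 x ws)"
      by (rule mult(1))
    show "(LINT y|?M (?E1 \<union> ?E2). tform \<gamma> y t1 x vs * tform \<gamma> y t2 x ws)
      = (LINT y|?M ?E1. tform \<gamma> y t1 x vs) * (LINT y|?M ?E2. tform \<gamma> y t2 x ws)"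
      by (rule mult(2))
  qed
  have "(\<lambda>x vs. LINT y|?M ?E1. tform \<gamma> y t1 x vs) \<and>\<^sub>f (\<lambda>x vs. LINT y|?M ?E2. tform \<gamma> y t2 x vs)
      = (\<lambda>x vs. LINT y|?M (?E1 \<union> ?E2). (tform \<gamma> y t1 \<and>\<^sub>f tform \<gamma> y t2) x vs)"
    unfolding wedge_def mult.assoc
    by (intro ext, subst Bochner_Integration.integral_sum) (simp_all add: prod)
  then show ?case by (simp add: Join.IH t1.trop_data_axioms t2.trop_data_axioms mu2_ket)
next
  case (Edge e t)
  have "tstate (\<lambda>\<alpha>. observable (\<gamma> \<alpha>)) (Edge e t)
      = propagator (ket (\<lambda>x vs. LINT y|(\<Pi>\<^sub>M e\<in>set (tedges t). edge_measure). tform \<gamma> y t x vs) (tvec t))"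
    by (simp only: tstate.simps Edge.IH[OF trop_data_subtree(4)[OF Edge.prems]])
  then show ?case
    by (simp only: propagator_ket propagator_eq_integral[OF Edge.prems] tvec.simps)
qed

text \<open>The pairing wedges the same forms as \<open>mu2\<close>, so its integrand can be read
  off from the \<open>Join\<close> case of \<open>tstate_eq_ket\<close> at the total charge.\<close>

lemma pairing_tstate:
  assumes "trop_data F \<gamma> (Join t1 t2)" "tvec t1 + tvec t2 = 0"
  shows "pairing (tstate (\<lambda>\<alpha>. observable (\<gamma> \<alpha>)) t1) (tstate (\<lambda>\<alpha>. observable (\<gamma> \<alpha>)) t2)
    = X_integral (\<lambda>x vs. LINT y|(\<Pi>\<^sub>M e\<in>set (tedges (Join t1 t2)). edge_measure). tform \<gamma> y (Join t1 t2) x vs)"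
proof -
  let ?\<omega> = "\<lambda>t x vs. LINT y|(\<Pi>\<^sub>M e\<in>set (tedges t). edge_measure). tform \<gamma> y t x vs"
  note kets = tstate_eq_ket[OF trop_data_subtree(2)[OF assms(1)]] tstate_eq_ket[OF trop_data_subtree(3)[OF assms(1)]]
  have "ket (?\<omega> t1 \<and>\<^sub>f ?\<omega> t2) (tvec t1 + tvec t2) = ket (?\<omega> (Join t1 t2)) (tvec t1 + tvec t2)"
    using tstate_eq_ket[OF assms(1)] by (simp only: tstate.simps kets mu2_ket tvec.simps)
  then have "ket (?\<omega> t1 \<and>\<^sub>f ?\<omega> t2) (tvec t1 + tvec t2) (tvec t1 + tvec t2)
      = ket (?\<omega> (Join t1 t2)) (tvec t1 + tvec t2) (tvec t1 + tvec t2)" by (rule fun_cong)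
  then have "?\<omega> t1 \<and>\<^sub>f ?\<omega> t2 = ?\<omega> (Join t1 t2)" unfolding ket_def if_True simp_thms .
  then show ?thesis by (simp only: kets pairing_ket[OF assms(2)])
qed

text \<open>Three rearrangements lead to the recursive integrand: the marks are permuted (even
  degrees), the edge frames are permuted and moved in front of the sink frame (even length), and the
  sink position becomes the outer variable (Fubini).\<close>

lemma moduli_integral_eq:
  fixes G :: "('v, 'n::finite) tropical_type"
  assumes "trop_data F \<gamma> t" and edges: "set (tedges t) = internal_edges G"
    and ev: "\<And>\<alpha>. \<alpha> \<in> set (tmarks t) \<Longrightarrow> ev G R (mark G \<alpha>) = tpos t \<alpha>"
    and marks: "mset (tmarks t) = mset ms"
    and even: "\<And>\<alpha>. \<alpha> \<in> set (tmarks t) \<Longrightarrow> grade_sign (\<gamma> \<alpha>) = \<gamma> \<alpha>"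
  shows "moduli_integral G (wedge_list (map (\<lambda>\<alpha>. ev_pullback G R (mark G \<alpha>) (\<gamma> \<alpha>)) ms))
    = X_integral (\<lambda>x vs. LINT y|(\<Pi>\<^sub>M e\<in>set (tedges t). edge_measure). tform \<gamma> y t x vs)"
proof -
  interpret trop_data F \<gamma> t by fact
  let ?P = "\<Pi>\<^sub>M e\<in>set (tedges t). edge_measure"
  let ?fr = "\<lambda>es. concat (map edge_frame es) :: ('v \<times> 'v, 'n) cpt list"
  have "wedge_list (map (\<lambda>\<alpha>. ev_pullback G R (mark G \<alpha>) (\<gamma> \<alpha>)) ms)
      = wedge_list (map (\<lambda>\<alpha>. ev_pullback G R (mark G \<alpha>) (\<gamma> \<alpha>)) (tmarks t))"
  proof (rule wedge_list_permute)
    show "mset (map (\<lambda>\<alpha>. ev_pullback G R (mark G \<alpha>) (\<gamma> \<alpha>)) ms)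
        = mset (map (\<lambda>\<alpha>. ev_pullback G R (mark G \<alpha>) (\<gamma> \<alpha>)) (tmarks t))"
      using marks by simp
    have "set ms = set (tmarks t)" using marks by (metis set_mset_mset)
    then show "grade_sign \<omega> = \<omega>" if "\<omega> \<in> set (map (\<lambda>\<alpha>. ev_pullback G R (mark G \<alpha>) (\<gamma> \<alpha>)) ms)" for \<omega>
      using that even by (auto simp: ev_pullback_def grade_sign_pullback)
  qed
  also have "\<dots> = W"
    unfolding W_def eval_wedge_def ev_pullback_def using ev by (intro arg_cong[of _ _ wedge_list] map_cong) auto
  finally have form: "wedge_list (map (\<lambda>\<alpha>. ev_pullback G R (mark G \<alpha>) (\<gamma> \<alpha>)) ms) = W" .
  have antisym: "antisym_form W"
    using alternating_eval_wedge[of "tmarks t" \<gamma> "tpos t"] trop_form_alternating[OF fan trop] linear_tpos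
    by (auto simp: W_def alternating_form_def)
  have len: "even (length (edge_frame e))" for e :: "'v \<times> 'v"
    by (simp add: edge_frame_def)
  have frame: "moduli_frame G = map sink_vec torus_frame @ ?fr (enum_of (internal_edges G))"
    unfolding moduli_frame_def sink_vec_def edge_frame_def ..
  have "\<exists>xs. distinct xs \<and> set xs = internal_edges G"
    using distinct_edges edges by blast
  then have "distinct (enum_of (internal_edges G)) \<and> set (enum_of (internal_edges G)) = internal_edges G"
    unfolding enum_of_def by (rule someI_ex)
  then have perm: "mset (enum_of (internal_edges G)) = mset (tedges t)"
    using distinct_edges edges by (metis set_eq_iff_mset_eq_distinct)
  have "W p (moduli_frame G) = tform \<gamma> (snd p) t (fst p) torus_frame" for p
  proof -
    have "W p (moduli_frame G) = W p (map sink_vec torus_frame @ ?fr (enum_of (internal_edges G)) @ [])"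
      by (simp add: frame)
    also have "\<dots> = W p (map sink_vec torus_frame @ ?fr (tedges t) @ [])"
      by (rule antisym_form_concat_pairs[OF antisym perm]) (rule len)
    also have "\<dots> = W p ([] @ ?fr (tedges t) @ map sink_vec torus_frame @ [])"
      using antisym_form_move_even[OF antisym, of "?fr (tedges t)" p "[]" "map sink_vec torus_frame" "[]"]
      by (simp add: length_concat o_def edge_frame_def sum_list_triv)
    finally show ?thesis by (simp add: tform_eq_W)
  qed
  moreover have "moduli_measure G = torus_measure \<Otimes>\<^sub>M ?P"
    by (simp add: moduli_measure_def edge_measure_def edges)
  ultimately have "moduli_integral G W
      = (LINT p|(torus_measure \<Otimes>\<^sub>M ?P). tform \<gamma> (snd p) t (fst p) torus_frame)"
    by (simp add: moduli_integral_def)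
  also have "\<dots> = (LINT x|torus_measure. LINT y|?P. tform \<gamma> y t x torus_frame)"
  proof -
    interpret pair_sigma_finite torus_measure ?P
      by (simp add: pair_sigma_finite_def sigma_finite_torus_measure sigma_finite_PiM_edges)
    show ?thesis using integral_fst'[OF integrable_tform_total] by simp
  qed
  finally show ?thesis unfolding form X_integral_def .
qed

section \<open>Paths from the sink, and the rooted tree behind a discrete type\<close>

section \<open>The tree of a tropical curve\<close>

lemma simple_path_prefix:
  assumes "simple_path G R (q @ ys) v" "q \<noteq> []"
  shows "simple_path G R q (last q)"
  unfolding simple_path_def
proof (intro conjI allI impI)
  fix i assume i: "Suc i < length q"
  then have "(q @ ys) ! Suc i \<in> neighbors G ((q @ ys) ! i)"
    using assms(1) by (simp add: simple_path_def)
  then show "q ! Suc i \<in> neighbors G (q ! i)" using i by (simp add: nth_append)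
qed (use assms in \<open>auto simp: simple_path_def\<close>)

lemma simple_path_adjacent:
  assumes "simple_path G R (xs @ a # b # ys) v"
  shows "b \<in> neighbors G a"
proof -
  have "Suc (length xs) < length (xs @ a # b # ys)" by simp
  then have "(xs @ a # b # ys) ! Suc (length xs) \<in> neighbors G ((xs @ a # b # ys) ! length xs)"
    using assms unfolding simple_path_def by blast
  then show ?thesis by (simp add: nth_append)
qed

lemma simple_path_last: "simple_path G R zs v \<Longrightarrow> last zs = v"
  by (simp add: simple_path_def)

lemma simple_path_hd: "simple_path G R zs v \<Longrightarrow> zs = R # tl zs"
  by (cases zs) (auto simp: simple_path_def)

lemma neighbors_sym: "b \<in> neighbors G a \<longleftrightarrow> a \<in> neighbors G b"
  by (auto simp: neighbors_def)

definition edge_between :: "('v, 'n::finite) tropical_type \<Rightarrow> 'v \<Rightarrow> 'v \<Rightarrow> 'v \<times> 'v" where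
  "edge_between G p v = (if (p, v) \<in> edges G then (p, v) else (v, p))"

text \<open>Unaffected by reversing an internal edge together with its vector, the identification
  made on discrete types.\<close>

definition directed_vec :: "('v, 'n::finite) tropical_type \<Rightarrow> 'v \<Rightarrow> 'v \<Rightarrow> int ^ 'n" where
  "directed_vec G v p = (if (v, p) \<in> edges G then mvec G (v, p) else - mvec G (p, v))"

definition path_edge :: "('v, 'n::finite) tropical_type \<Rightarrow> 'v list \<Rightarrow> 'v \<times> 'v" where
  "path_edge G zs = edge_between G (last (butlast zs)) (last zs)"

text \<open>An edge is recorded through the path from the sink on which it comes last; the edge
  leading into the end of \<open>q\<close> is included. The condition on the last vertex excludes
  external edges.\<close>

definition below_edges :: "('v, 'n::finite) tropical_type \<Rightarrow> 'v \<Rightarrow> 'v list \<Rightarrow> ('v \<times> 'v) set" where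
  "below_edges G R q = {path_edge G zs | zs. prefix q zs \<and> simple_path G R zs (last zs)
     \<and> last zs \<notin> leaves G \<and> 2 \<le> length zs}"

definition below_marks :: "('v, 'n::finite) tropical_type \<Rightarrow> 'v \<Rightarrow> nat \<Rightarrow> 'v list \<Rightarrow> nat set" where
  "below_marks G R n q = {\<alpha> \<in> {1..n}. \<exists>zs. prefix q zs \<and> simple_path G R zs (mark G \<alpha>)}"

definition step_sum :: "('v, 'n::finite) tropical_type \<Rightarrow> ('v \<times> 'v \<Rightarrow> real \<times> real) \<Rightarrow> 'v list \<Rightarrow> 'n pt" where
  "step_sum G y zs = (\<Sum>s\<leftarrow>zip zs (tl zs). step G y s)"

lemma step_sum_simps: "step_sum G y [v] = 0" "step_sum G y (p # v # zs) = step G y (p, v) + step_sum G y (v # zs)"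
  by (simp_all add: step_sum_def)

text \<open>\<open>k\<close> is the index of the root of \<open>d\<close> on the paths from the sink to the marks.\<close>

definition tree_describes :: "('v, 'n::finite) tropical_type \<Rightarrow> 'v \<Rightarrow> ('v \<times> 'v) set \<Rightarrow> nat set \<Rightarrow> nat
    \<Rightarrow> ('v \<times> 'v, int ^ 'n) ctree \<Rightarrow> bool" where
  "tree_describes G R E M k d \<longleftrightarrow> set (tedges d) = E \<and> set (tmarks d) = M
     \<and> distinct (tedges d) \<and> distinct (tmarks d)
     \<and> (\<forall>\<alpha>\<in>M. \<forall>zs. simple_path G R zs (mark G \<alpha>) \<longrightarrow>
          (\<forall>x y. tpos d \<alpha> (x, y) = x + step_sum G y (drop k zs)))"

lemma tree_describes_tpos:
  assumes "tree_describes G R E M k d" "\<alpha> \<in> M" "simple_path G R zs (mark G \<alpha>)"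
  shows "tpos d \<alpha> (x, y) = x + step_sum G y (drop k zs)"
  using assms unfolding tree_describes_def by blast

locale rooted_type =
  fixes F :: "(real ^ 'n::finite) set set" and n :: nat and G :: "('v, 'n) tropical_type" and R :: 'v
  assumes G: "discrete_type F n G" and R: "R \<in> verts G - leaves G"
begin

lemma tree: "is_tree G"
  using G by (simp add: discrete_type_def)

lemma finite_verts: "finite (verts G)"
  using tree by (simp add: is_tree_def)

lemma edges_verts: "(a, b) \<in> edges G \<Longrightarrow> a \<in> verts G \<and> b \<in> verts G \<and> a \<noteq> b \<and> (b, a) \<notin> edges G"
  using tree by (auto simp: is_tree_def)

lemma neighbors_verts: "b \<in> neighbors G a \<Longrightarrow> a \<in> verts G \<and> b \<in> verts G \<and> a \<noteq> b"
  using edges_verts by (auto simp: neighbors_def)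

lemma finite_neighbors: "finite (neighbors G v)"
  using neighbors_verts finite_verts by (metis finite_subset subsetI)

lemma valence_eq: "valence G v = card (neighbors G v)"
  using card_neighbors[OF tree] by simp

lemma leaf_iff: "v \<in> leaves G \<longleftrightarrow> v \<in> verts G \<and> card (neighbors G v) = 1"
  by (simp add: leaves_def valence_eq)

lemma simple_path_unique:
  assumes "simple_path G R zs v" "simple_path G R zs' v"
  shows "zs = zs'"
proof -
  have "R \<in> set zs" "v \<in> set zs" using assms(1) by (auto simp: simple_path_def)
  then have "R \<in> verts G" "v \<in> verts G" using assms(1) by (auto simp: simple_path_def)
  then have "\<exists>!xs. simple_path G R xs v" using tree by (simp add: is_tree_def)
  then show ?thesis using assms by blast
qed

lemma simple_path_exists: "v \<in> verts G \<Longrightarrow> \<exists>zs. simple_path G R zs v"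
  using tree R unfolding is_tree_def by blast

lemma simple_path_root: "simple_path G R [R] R"
  using R by (simp add: simple_path_def)

lemma mark_props:
  assumes "\<alpha> \<in> {1..n}"
  shows "mark G \<alpha> \<in> verts G" "card (neighbors G (mark G \<alpha>)) = 2"
proof -
  have "mark G \<alpha> \<in> {v \<in> verts G. valence G v = 2}"
    using G assms by (auto simp: discrete_type_def bij_betw_def)
  then show "mark G \<alpha> \<in> verts G" "card (neighbors G (mark G \<alpha>)) = 2"
    by (simp_all add: valence_eq)
qed

lemma mark_inj:
  assumes "\<alpha> \<in> {1..n}" "\<beta> \<in> {1..n}" "mark G \<alpha> = mark G \<beta>"
  shows "\<alpha> = \<beta>"
proof -
  have "inj_on (mark G) {1..n}" using G by (simp add: discrete_type_def bij_betw_def)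
  then show ?thesis using assms(3,1,2) by (rule inj_onD)
qed

lemma split_path:
  assumes "2 \<le> length zs"
  obtains xs a b where "zs = xs @ [a, b]"
proof -
  have "zs \<noteq> []" using assms by auto
  then obtain ys b where b: "zs = ys @ [b]" by (metis rev_exhaust)
  then have "ys \<noteq> []" using assms by auto
  then obtain xs a where "ys = xs @ [a]" by (metis rev_exhaust)
  then have "zs = xs @ [a, b]" using b by simp
  then show thesis by (rule that)
qed

lemma edge_between_eqD:
  assumes "edge_between G a b = edge_between G a' b'"
  shows "a = a' \<and> b = b' \<or> a = b' \<and> b = a'"
  using assms by (auto simp: edge_between_def split: if_splits)

text \<open>The edge determines its far end and hence the path: if two paths traversed it in
  opposite directions, each would be one vertex longer than the other.\<close>

lemma path_edge_inj:
  assumes "simple_path G R zs (last zs)" "simple_path G R zs' (last zs')" "2 \<le> length zs" "2 \<le> length zs'"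
    and eq: "path_edge G zs = path_edge G zs'"
  shows "zs = zs'"
proof -
  obtain xs a b where zs: "zs = xs @ [a, b]" using assms(3) by (rule split_path)
  obtain xs' a' b' where zs': "zs' = xs' @ [a', b']" using assms(4) by (rule split_path)
  have "a = a' \<and> b = b' \<or> a = b' \<and> b = a'"
    using eq by (intro edge_between_eqD) (simp add: path_edge_def zs zs' butlast_append)
  then show ?thesis
  proof
    assume "a = a' \<and> b = b'"
    then show ?thesis
      using simple_path_unique[of zs b zs'] assms(1,2) by (simp add: zs zs')
  next
    assume ab: "a = b' \<and> b = a'"
    have "simple_path G R (xs @ [a]) a"
      using simple_path_prefix[of G R "xs @ [a]" "[b]"] assms(1) by (simp add: zs)
    moreover have "simple_path G R (xs' @ [a', b']) a" using assms(2) ab by (simp add: zs')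
    ultimately have 1: "xs @ [a] = xs' @ [a', b']" by (rule simple_path_unique)
    have "simple_path G R (xs' @ [a']) b"
      using simple_path_prefix[of G R "xs' @ [a']" "[b']"] assms(2) ab by (simp add: zs')
    moreover have "simple_path G R (xs @ [a, b]) b" using assms(1) by (simp add: zs)
    ultimately have 2: "xs' @ [a'] = xs @ [a, b]" by (rule simple_path_unique)
    from arg_cong[OF 1, of length] arg_cong[OF 2, of length] show ?thesis by simp
  qed
qed

lemma prefix_cases:
  assumes "prefix q zs" "simple_path G R zs v" "q \<noteq> []"
  shows "zs = q \<or> (\<exists>w. simple_path G R (q @ [w]) w \<and> prefix (q @ [w]) zs)"
proof (cases "zs = q")
  case False
  then obtain w ys where zs: "zs = (q @ [w]) @ ys"
    using assms(1) by (metis append.assoc append_Cons append_Nil append_Nil2 list.exhaust prefix_def)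
  then have "simple_path G R (q @ [w]) w"
    using simple_path_prefix[of G R "q @ [w]" ys v] assms(2) by simp
  then show ?thesis using zs by auto
qed simp

text \<open>A path through \<open>q\<close> stops there or continues to one of the children
  \<open>C\<close>; this is the recursion that the tree of a branch follows.\<close>

lemma below_edges_split:
  assumes q: "simple_path G R q v" and C: "\<And>w. simple_path G R (q @ [w]) w \<longleftrightarrow> w \<in> C"
  shows "below_edges G R q = (if 2 \<le> length q \<and> v \<notin> leaves G then {path_edge G q} else {})
    \<union> (\<Union>w\<in>C. below_edges G R (q @ [w]))" (is "_ = ?A \<union> ?B")
proof (intro subset_antisym subsetI)
  have qv: "q \<noteq> []" "last q = v" using q by (auto simp: simple_path_def)
  {
    fix e assume "e \<in> below_edges G R q"
    then obtain zs where zs: "e = path_edge G zs" "prefix q zs" "simple_path G R zs (last zs)"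
      "last zs \<notin> leaves G" "2 \<le> length zs" by (auto simp: below_edges_def)
    from prefix_cases[OF zs(2,3) qv(1)] show "e \<in> ?A \<union> ?B"
    proof
      assume "zs = q"
      then show ?thesis using zs qv by simp
    next
      assume "\<exists>w. simple_path G R (q @ [w]) w \<and> prefix (q @ [w]) zs"
      then obtain w where w: "w \<in> C" "prefix (q @ [w]) zs" using C by blast
      then have "e \<in> below_edges G R (q @ [w])" using zs by (auto simp: below_edges_def)
      then show ?thesis using w by blast
    qed
  }
  fix e assume "e \<in> ?A \<union> ?B"
  then show "e \<in> below_edges G R q"
  proof
    assume "e \<in> ?A"
    then have "e = path_edge G q" "2 \<le> length q" "v \<notin> leaves G" by (auto split: if_splits)
    then show ?thesis using q qv by (auto simp: below_edges_def)
  next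
    assume "e \<in> ?B"
    then show ?thesis by (auto simp: below_edges_def dest: append_prefixD)
  qed
qed

lemma below_marks_split:
  assumes q: "simple_path G R q v" and C: "\<And>w. simple_path G R (q @ [w]) w \<longleftrightarrow> w \<in> C"
  shows "below_marks G R n q = {\<alpha> \<in> {1..n}. mark G \<alpha> = v} \<union> (\<Union>w\<in>C. below_marks G R n (q @ [w]))"
    (is "_ = ?A \<union> ?B")
proof (intro subset_antisym subsetI)
  have qv: "q \<noteq> []" "last q = v" using q by (auto simp: simple_path_def)
  {
    fix \<alpha> assume "\<alpha> \<in> below_marks G R n q"
    then obtain zs where \<alpha>: "\<alpha> \<in> {1..n}" and zs: "prefix q zs" "simple_path G R zs (mark G \<alpha>)"
      by (auto simp: below_marks_def)
    from prefix_cases[OF zs qv(1)] show "\<alpha> \<in> ?A \<union> ?B"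
    proof
      assume "zs = q"
      then show ?thesis using \<alpha> simple_path_last[OF zs(2)] qv by simp
    next
      assume "\<exists>w. simple_path G R (q @ [w]) w \<and> prefix (q @ [w]) zs"
      then obtain w where w: "w \<in> C" "prefix (q @ [w]) zs" using C by blast
      then have "\<alpha> \<in> below_marks G R n (q @ [w])" using zs \<alpha> by (auto simp: below_marks_def)
      then show ?thesis using w by blast
    qed
  }
  fix \<alpha> assume "\<alpha> \<in> ?A \<union> ?B"
  then show "\<alpha> \<in> below_marks G R n q"
  proof
    assume "\<alpha> \<in> ?A"
    then show ?thesis using q by (auto simp: below_marks_def)
  next
    assume "\<alpha> \<in> ?B"
    then show ?thesis by (auto simp: below_marks_def dest: append_prefixD)
  qed
qed

lemma prefix_snoc_eq: "prefix (q @ [w]) zs \<Longrightarrow> prefix (q @ [w']) zs \<Longrightarrow> w = w'"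
  by (auto simp: prefix_def)

lemma below_edges_disjoint:
  assumes "w \<noteq> w'"
  shows "below_edges G R (q @ [w]) \<inter> below_edges G R (q @ [w']) = {}"
proof -
  have False if "e \<in> below_edges G R (q @ [w])" "e \<in> below_edges G R (q @ [w'])" for e
  proof -
    from that(1) obtain zs where zs: "e = path_edge G zs" "prefix (q @ [w]) zs"
      "simple_path G R zs (last zs)" "2 \<le> length zs" by (auto simp: below_edges_def)
    from that(2) obtain zs' where zs': "e = path_edge G zs'" "prefix (q @ [w']) zs'"
      "simple_path G R zs' (last zs')" "2 \<le> length zs'" by (auto simp: below_edges_def)
    have "zs = zs'" using zs zs' by (intro path_edge_inj) simp_all
    then show False using zs(2) zs'(2) prefix_snoc_eq assms by metis
  qed
  then show ?thesis by blast
qed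

lemma path_edge_notin_below:
  assumes "simple_path G R q (last q)" "2 \<le> length q"
  shows "path_edge G q \<notin> below_edges G R (q @ [w])"
proof
  assume "path_edge G q \<in> below_edges G R (q @ [w])"
  then obtain zs where zs: "path_edge G q = path_edge G zs" "prefix (q @ [w]) zs"
    "simple_path G R zs (last zs)" "2 \<le> length zs" by (auto simp: below_edges_def)
  then have "q = zs" using assms by (intro path_edge_inj)
  then show False using zs(2) by (auto dest: prefix_length_le)
qed

lemma below_marks_disjoint:
  assumes "w \<noteq> w'"
  shows "below_marks G R n (q @ [w]) \<inter> below_marks G R n (q @ [w']) = {}"
proof -
  have False if "\<alpha> \<in> below_marks G R n (q @ [w])" "\<alpha> \<in> below_marks G R n (q @ [w'])" for \<alpha>
  proof -
    from that(1) obtain zs where zs: "prefix (q @ [w]) zs" "simple_path G R zs (mark G \<alpha>)"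
      by (auto simp: below_marks_def)
    from that(2) obtain zs' where zs': "prefix (q @ [w']) zs'" "simple_path G R zs' (mark G \<alpha>)"
      by (auto simp: below_marks_def)
    have "zs = zs'" using zs zs' simple_path_unique by blast
    then show False using zs(1) zs'(1) prefix_snoc_eq assms by metis
  qed
  then show ?thesis by blast
qed

lemma mark_notin_below:
  assumes "simple_path G R q (mark G \<alpha>)"
  shows "\<alpha> \<notin> below_marks G R n (q @ [w])"
proof
  assume "\<alpha> \<in> below_marks G R n (q @ [w])"
  then obtain zs where zs: "prefix (q @ [w]) zs" "simple_path G R zs (mark G \<alpha>)"
    by (auto simp: below_marks_def)
  then have "q = zs" using assms simple_path_unique by blast
  then show False using zs(1) by (auto dest: prefix_length_le)
qed

lemma children_root: "simple_path G R ([R] @ [w]) w \<longleftrightarrow> w \<in> neighbors G R"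
proof
  assume "simple_path G R ([R] @ [w]) w"
  then show "w \<in> neighbors G R" using simple_path_adjacent[of G R "[]" R w "[]" w] by simp
next
  assume "w \<in> neighbors G R"
  then show "simple_path G R ([R] @ [w]) w"
    using neighbors_verts[of w R] by (auto simp: simple_path_def)
qed

lemma children_node:
  assumes "simple_path G R (xs @ [p, v]) v"
  shows "simple_path G R ((xs @ [p, v]) @ [w]) w \<longleftrightarrow> w \<in> neighbors G v - {p}"
proof
  assume w: "simple_path G R ((xs @ [p, v]) @ [w]) w"
  then have "w \<in> neighbors G v"
    using simple_path_adjacent[of G R "xs @ [p]" v w "[]" w] by simp
  moreover have "w \<noteq> p" using w by (auto simp: simple_path_def)
  ultimately show "w \<in> neighbors G v - {p}" by simp
next
  assume "w \<in> neighbors G v - {p}"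
  then show "simple_path G R ((xs @ [p, v]) @ [w]) w"
    using simple_path_snoc[OF tree assms] by simp
qed

lemma directed_vec_sym: "v \<in> neighbors G p \<Longrightarrow> directed_vec G v p = - directed_vec G p v"
  using edges_verts by (auto simp: directed_vec_def neighbors_def)

text \<open>When every edge at \<open>v\<close> is turned towards \<open>v\<close>, outgoing edges
  acquire a minus sign and the balancing condition becomes a vanishing sum.\<close>

lemma balancing:
  assumes "v \<in> verts G - leaves G"
  shows "(\<Sum>w\<in>neighbors G v. directed_vec G w v) = 0"
proof -
  let ?I = "{w. (w, v) \<in> edges G}" and ?O = "{w. (v, w) \<in> edges G}"
  have N: "neighbors G v = ?I \<union> ?O" by (auto simp: neighbors_def)
  then have fin: "finite ?I" "finite ?O" using finite_neighbors[of v] by simp_all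
  have disj: "?I \<inter> ?O = {}" using edges_verts by blast
  have "(\<Sum>w\<in>neighbors G v. directed_vec G w v)
      = (\<Sum>w\<in>?I. directed_vec G w v) + (\<Sum>w\<in>?O. directed_vec G w v)"
    unfolding N by (rule sum.union_disjoint[OF fin disj])
  also have "(\<Sum>w\<in>?I. directed_vec G w v) = (\<Sum>w\<in>?I. mvec G (w, v))"
    by (intro sum.cong) (auto simp: directed_vec_def)
  also have "\<dots> = (\<Sum>e | e \<in> edges G \<and> snd e = v. mvec G e)"
    by (rule sum.reindex_bij_witness[of _ fst "\<lambda>w. (w, v)"]) auto
  also have "(\<Sum>w\<in>?O. directed_vec G w v) = (\<Sum>w\<in>?O. - mvec G (v, w))"
    using edges_verts by (intro sum.cong) (auto simp: directed_vec_def)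
  also have "\<dots> = - (\<Sum>e | e \<in> edges G \<and> fst e = v. mvec G e)"
    unfolding sum_negf by (subst sum.reindex_bij_witness[of _ snd "\<lambda>w. (v, w)"]) auto
  finally show ?thesis
    using G assms by (simp add: discrete_type_def)
qed

lemma tree_describes_Mark:
  assumes d: "tree_describes G R E M k d" and "\<alpha> \<notin> M"
    and q: "simple_path G R q (mark G \<alpha>)" "length q = Suc k"
  shows "tree_describes G R E (insert \<alpha> M) k (Mark \<alpha> d)"
  unfolding tree_describes_def
proof (intro conjI ballI allI impI)
  fix \<beta> zs x y assume \<beta>: "\<beta> \<in> insert \<alpha> M" and zs: "simple_path G R zs (mark G \<beta>)"
  show "tpos (Mark \<alpha> d) \<beta> (x, y) = x + step_sum G y (drop k zs)"
  proof (cases "\<beta> = \<alpha>")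
    case True
    then have "zs = q" using zs q(1) simple_path_unique by blast
    \<comment> \<open>The path to the mark has its last vertex at index \<open>k\<close>, so no step
      remains to be added.\<close>
    then obtain v where "drop k zs = [v]"
      using q(2) by (metis One_nat_def Suc_eq_plus1 add_diff_cancel_left' length_0_conv length_Suc_conv length_drop)
    then show ?thesis using True by (simp add: step_sum_simps)
  next
    case False
    then show ?thesis using tree_describes_tpos[OF d, of \<beta> zs x y] \<beta> zs by simp
  qed
qed (use d assms(2) in \<open>auto simp: tree_describes_def\<close>)

lemma tree_describes_Join:
  assumes d1: "tree_describes G R E1 M1 k d1" and d2: "tree_describes G R E2 M2 k d2"
    and "E1 \<inter> E2 = {}" "M1 \<inter> M2 = {}"
  shows "tree_describes G R (E1 \<union> E2) (M1 \<union> M2) k (Join d1 d2)"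
  using assms unfolding tree_describes_def by auto

text \<open>\<open>shift\<close> subtracts the vector directed towards the sink, \<open>step\<close>
  adds the one directed away from it; the two agree for either stored orientation of the
  edge.\<close>

lemma shift_step:
  assumes "v \<in> neighbors G p"
  shows "fst (shift (edge_between G p v) (directed_vec G v p) (x, y)) = x + step G y (p, v)"
proof -
  have ivec: "ivec (- m) = - ivec m" for m :: "int ^ 'n" by (simp add: ivec_def vec_eq_iff)
  from assms consider "(p, v) \<in> edges G" "(v, p) \<notin> edges G" | "(v, p) \<in> edges G" "(p, v) \<notin> edges G"
    using edges_verts by (auto simp: neighbors_def)
  then show ?thesis
    by cases (simp_all add: shift_def edge_between_def directed_vec_def step_def ivec)
qed

text \<open>Attaching the edge moves the root from \<open>v\<close> to \<open>p\<close>, one vertex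
  closer to the sink. The index drops from \<open>Suc k\<close> to \<open>k\<close>, and the step
  from \<open>p\<close> to \<open>v\<close> joins the sum.\<close>

lemma tree_describes_Edge:
  assumes d: "tree_describes G R E M (Suc k) d"
    and q: "simple_path G R (xs @ [p, v]) v" "length xs = k"
    and e: "path_edge G (xs @ [p, v]) \<notin> E" and M: "M \<subseteq> below_marks G R n (xs @ [p, v])"
    and vec: "tvec d = directed_vec G v p"
  shows "tree_describes G R (insert (path_edge G (xs @ [p, v])) E) M k (Edge (path_edge G (xs @ [p, v])) d)"
  unfolding tree_describes_def
proof (intro conjI ballI allI impI)
  let ?e = "path_edge G (xs @ [p, v])"
  have e_eq: "?e = edge_between G p v" by (simp add: path_edge_def butlast_append)
  have v: "v \<in> neighbors G p" using simple_path_adjacent[of G R xs p v "[]" v] q(1) by simp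
  fix \<alpha> zs x y assume \<alpha>: "\<alpha> \<in> M" and zs: "simple_path G R zs (mark G \<alpha>)"
  obtain zs' where "prefix (xs @ [p, v]) zs'" "simple_path G R zs' (mark G \<alpha>)"
    using M \<alpha> by (auto simp: below_marks_def)
  then have "prefix (xs @ [p, v]) zs" using zs simple_path_unique by blast
  then obtain ys where ys: "zs = xs @ p # v # ys" by (auto simp: prefix_def)
  have "tpos (Edge ?e d) \<alpha> (x, y) = tpos d \<alpha> (fst (shift ?e (tvec d) (x, y)), y)"
    by (simp add: shift_def)
  also have "\<dots> = fst (shift ?e (tvec d) (x, y)) + step_sum G y (drop (Suc k) zs)"
    by (rule tree_describes_tpos[OF d \<alpha> zs])
  also have "\<dots> = x + step_sum G y (drop k zs)"
    unfolding e_eq vec shift_step[OF v] using q(2) by (simp add: ys step_sum_simps)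
  finally show "tpos (Edge ?e d) \<alpha> (x, y) = x + step_sum G y (drop k zs)" .
qed (use d e in \<open>auto simp: tree_describes_def\<close>)

lemma tree_describes_End: "tree_describes G R {} {} k (End b)"
  by (simp add: tree_describes_def)

lemma leaf_edge:
  assumes "v \<in> leaves G" "neighbors G v = {p}"
  shows "(v, p) \<in> edges G" "(THE e. e \<in> edges G \<and> fst e = v) = (v, p)"
proof -
  have ext: "\<And>e. e \<in> external_edges G \<Longrightarrow> snd e \<notin> leaves G"
    using G by (simp add: discrete_type_def)
  have "(p, v) \<notin> edges G" using ext[of "(p, v)"] assms(1) by (auto simp: external_edges_def)
  then show vp: "(v, p) \<in> edges G" using assms(2) by (auto simp: neighbors_def)
  show "(THE e. e \<in> edges G \<and> fst e = v) = (v, p)"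
  proof (rule the_equality)
    show "(v, p) \<in> edges G \<and> fst (v, p) = v" using vp by simp
    fix e assume e: "e \<in> edges G \<and> fst e = v"
    then have "snd e \<in> neighbors G v" by (auto simp: neighbors_def)
    then show "e = (v, p)" using e assms(2) by (simp add: prod_eq_iff)
  qed
qed

text \<open>The tree copies the recursion of \<open>branch_at\<close>. Balancing at each vertex
  turns the sum of the vectors behind it into the vector of its outgoing edge, and uniqueness of
  paths keeps the edges and marks of different branches apart.\<close>

lemma branch_tree:
  assumes "branch_at G n p v t" "simple_path G R (xs @ [p, v]) v"
  shows "\<exists>d. tree_describes G R (below_edges G R (xs @ [p, v])) (below_marks G R n (xs @ [p, v])) (length xs) d
    \<and> tvec d = directed_vec G v p \<and> branch_state obs (leaf_state G) t = tstate obs d"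
  using assms
proof (induction arbitrary: xs rule: branch_at.induct)
  case (1 v p)
  let ?q = "xs @ [p, v]"
  have leaf: "v \<in> leaves G" using 1 by (simp add: leaf_iff)
  have C: "simple_path G R (?q @ [w]) w \<longleftrightarrow> w \<in> {}" for w
    using children_node[OF 1(3)] 1(1) by simp
  have "below_edges G R ?q = {}" unfolding below_edges_split[OF 1(3) C] using leaf by simp
  moreover have "mark G \<alpha> \<noteq> v" if "\<alpha> \<in> {1..n}" for \<alpha>
    using mark_props(2)[OF that] leaf by (auto simp: leaf_iff)
  then have "below_marks G R n ?q = {}" unfolding below_marks_split[OF 1(3) C] by auto
  moreover have "leaf_state G v = divisor_state (directed_vec G v p)"
    using leaf_edge[OF leaf 1(1)] by (simp add: leaf_state_def directed_vec_def)
  ultimately show ?case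
    by (intro exI[of _ "End (directed_vec G v p)"]) (simp add: tree_describes_End)
next
  case (2 \<alpha> v p w t)
  let ?q = "xs @ [p, v]"
  note path = \<open>simple_path G R ?q v\<close>
  have C: "simple_path G R (?q @ [u]) u \<longleftrightarrow> u \<in> {w}" for u
    using children_node[OF path] 2(3,4) by auto
  have "simple_path G R ((xs @ [p]) @ [v, w]) w" using C[of w] by simp
  from "2.IH"[OF this] obtain d where
    d: "tree_describes G R (below_edges G R (?q @ [w])) (below_marks G R n (?q @ [w])) (Suc (length xs)) d"
    and vec: "tvec d = directed_vec G w v" and state: "branch_state obs (leaf_state G) t = tstate obs d"
    by auto
  have v: "v \<in> verts G - leaves G"
    using mark_props[OF 2(1)] 2(2) by (simp add: leaf_iff)
  have "{\<beta> \<in> {1..n}. mark G \<beta> = v} = {\<alpha>}" using 2(1,2) mark_inj by blast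
  then have M: "below_marks G R n ?q = insert \<alpha> (below_marks G R n (?q @ [w]))"
    unfolding below_marks_split[OF path C] by simp
  have E: "below_edges G R ?q = insert (path_edge G ?q) (below_edges G R (?q @ [w]))"
    unfolding below_edges_split[OF path C] using v by simp
  \<comment> \<open>At a two-valent vertex balancing lets the vector pass through unchanged.\<close>
  have "directed_vec G w v = - directed_vec G p v"
    unfolding eq_neg_iff_add_eq_0 using balancing[OF v] 2(3,4) by (simp add: add.commute)
  also have "\<dots> = directed_vec G v p"
    using 2(3) by (intro directed_vec_sym[symmetric]) (simp add: neighbors_sym[of v])
  finally have vec': "tvec (Mark \<alpha> d) = directed_vec G v p" by (simp add: vec)
  have "tree_describes G R (below_edges G R (?q @ [w])) (below_marks G R n ?q) (Suc (length xs)) (Mark \<alpha> d)"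
    unfolding M using path 2(2)
    by (intro tree_describes_Mark[OF d, where q = ?q] mark_notin_below) simp_all
  then have "tree_describes G R (below_edges G R ?q) (below_marks G R n ?q) (length xs)
      (Edge (path_edge G ?q) (Mark \<alpha> d))"
    unfolding E using path by (intro tree_describes_Edge vec' path_edge_notin_below) simp_all
  then show ?case using vec' state
    by (intro exI[of _ "Edge (path_edge G ?q) (Mark \<alpha> d)"]) simp
next
  case (3 v p w1 w2 t1 t2)
  let ?q = "xs @ [p, v]"
  note path = \<open>simple_path G R ?q v\<close>
  have C: "simple_path G R (?q @ [u]) u \<longleftrightarrow> u \<in> {w1, w2}" for u
    using children_node[OF path] 3(1,2) by auto
  have "simple_path G R ((xs @ [p]) @ [v, w1]) w1" using C[of w1] by simp
  from "3.IH"(1)[OF this] obtain d1 where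
    d1: "tree_describes G R (below_edges G R (?q @ [w1])) (below_marks G R n (?q @ [w1])) (Suc (length xs)) d1"
    and vec1: "tvec d1 = directed_vec G w1 v" and state1: "branch_state obs (leaf_state G) t1 = tstate obs d1"
    by auto
  have "simple_path G R ((xs @ [p]) @ [v, w2]) w2" using C[of w2] by simp
  from "3.IH"(2)[OF this] obtain d2 where
    d2: "tree_describes G R (below_edges G R (?q @ [w2])) (below_marks G R n (?q @ [w2])) (Suc (length xs)) d2"
    and vec2: "tvec d2 = directed_vec G w2 v" and state2: "branch_state obs (leaf_state G) t2 = tstate obs d2"
    by auto
  have card: "card (neighbors G v) = 3" using 3(1,2) by simp
  have "v \<in> verts G" using path by (auto simp: simple_path_def)
  then have v: "v \<in> verts G - leaves G" using card by (simp add: leaf_iff)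
  have "mark G \<beta> \<noteq> v" if \<beta>: "\<beta> \<in> {1..n}" for \<beta>
    using mark_props(2)[OF \<beta>] card by auto
  then have M: "below_marks G R n ?q = below_marks G R n (?q @ [w1]) \<union> below_marks G R n (?q @ [w2])"
    unfolding below_marks_split[OF path C] by auto
  have E: "below_edges G R ?q
      = insert (path_edge G ?q) (below_edges G R (?q @ [w1]) \<union> below_edges G R (?q @ [w2]))"
    unfolding below_edges_split[OF path C] using v by simp
  have "directed_vec G w1 v + directed_vec G w2 v = - directed_vec G p v"
    unfolding eq_neg_iff_add_eq_0 using balancing[OF v] 3(1,2) by (simp add: add_ac)
  also have "\<dots> = directed_vec G v p"
    using 3(1) by (intro directed_vec_sym[symmetric]) (simp add: neighbors_sym[of v])
  finally have vec': "tvec (Join d1 d2) = directed_vec G v p" by (simp add: vec1 vec2)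
  have w: "w1 \<noteq> w2" using 3(2) by simp
  have "tree_describes G R (below_edges G R (?q @ [w1]) \<union> below_edges G R (?q @ [w2])) (below_marks G R n ?q)
      (Suc (length xs)) (Join d1 d2)"
    unfolding M
    by (rule tree_describes_Join[OF d1 d2 below_edges_disjoint[OF w] below_marks_disjoint[OF w]])
  then have "tree_describes G R (below_edges G R ?q) (below_marks G R n ?q) (length xs)
      (Edge (path_edge G ?q) (Join d1 d2))"
    unfolding E using path path_edge_notin_below[of ?q]
    by (intro tree_describes_Edge vec') simp_all
  then show ?case using vec' state1 state2
    by (intro exI[of _ "Edge (path_edge G ?q) (Join d1 d2)"]) simp
qed

text \<open>The near end of the last edge on a path is no leaf, being either the sink or a vertex
  with two neighbors on the path. Conversely, an internal edge comes last on the path to whichever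
  of its ends is farther from the sink.\<close>

lemma below_edges_root: "below_edges G R [R] = internal_edges G"
proof (intro subset_antisym subsetI)
  fix e assume "e \<in> below_edges G R [R]"
  then obtain zs where e: "e = path_edge G zs" and zs: "simple_path G R zs (last zs)"
    "last zs \<notin> leaves G" "2 \<le> length zs" by (auto simp: below_edges_def)
  obtain xs a b where ab: "zs = xs @ [a, b]" using zs(3) by (rule split_path)
  have b: "b \<in> neighbors G a" using simple_path_adjacent[of G R xs a b "[]"] zs(1) ab by simp
  have "a \<notin> leaves G"
  proof (cases xs rule: rev_cases)
    case Nil
    then have "a = R" using zs(1) ab by (simp add: simple_path_def)
    then show ?thesis using R by simp
  next
    case (snoc ws c)
    have "a \<in> neighbors G c" using simple_path_adjacent[of G R ws c a "[b]"] zs(1) ab snoc by simp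
    then have "{b, c} \<subseteq> neighbors G a" using b by (simp add: neighbors_sym[of a])
    moreover have "b \<noteq> c" using zs(1) ab snoc by (auto simp: simple_path_def)
    ultimately have "2 \<le> card (neighbors G a)"
      using card_mono[OF finite_neighbors, of "{b, c}" a] by simp
    then show ?thesis by (auto simp: leaf_iff)
  qed
  moreover have "b \<notin> leaves G" using zs(2) ab by simp
  moreover have "e = edge_between G a b" by (simp add: e ab path_edge_def butlast_append)
  ultimately show "e \<in> internal_edges G"
    using b by (auto simp: internal_edges_def external_edges_def edge_between_def neighbors_def)
next
  fix e assume e: "e \<in> internal_edges G"
  obtain a b where ab: "e = (a, b)" by (cases e)
  have in_G: "(a, b) \<in> edges G" "a \<notin> leaves G" "b \<notin> leaves G"
    using e ab by (auto simp: internal_edges_def external_edges_def)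
  have nb: "b \<in> neighbors G a" "a \<in> neighbors G b" using in_G by (auto simp: neighbors_def)
  have ext: "simple_path G R (zs @ [c']) c'"
    if zs: "simple_path G R zs c" "c' \<notin> set zs" and c: "c' \<in> neighbors G c" for zs c c'
  proof (cases "zs = [R]")
    case True
    then have "c = R" using simple_path_last[OF zs(1)] by simp
    then show ?thesis using children_root c True by simp
  next
    case False
    then have "2 \<le> length zs" using simple_path_hd[OF zs(1)] by (cases "tl zs") (metis, metis One_nat_def Suc_le_mono le0 length_Cons numeral_2_eq_2)
    then obtain xs p v where xs: "zs = xs @ [p, v]" by (rule split_path)
    then have "v = c" using simple_path_last[OF zs(1)] by simp
    then have "simple_path G R (xs @ [p, c]) c" using zs(1) xs by simp
    moreover have "c' \<in> neighbors G c - {p}" using c zs(2) xs by auto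
    ultimately show ?thesis using children_node xs \<open>v = c\<close> by blast
  qed
  have concl: "edge_between G c c' \<in> below_edges G R [R]"
    if zs: "simple_path G R zs c" "c' \<notin> set zs" and c: "c' \<in> neighbors G c" "c' \<notin> leaves G" for zs c c'
  proof -
    have path: "simple_path G R (zs @ [c']) c'" by (rule ext[OF zs c(1)])
    have "prefix [R] (zs @ [c'])" using simple_path_hd[OF zs(1)] by (metis append_Cons prefix_code(1) Cons_prefix_Cons)
    moreover have "last zs = c" "zs \<noteq> []" using zs(1) by (auto simp: simple_path_def)
    moreover have "2 \<le> length (zs @ [c'])" using \<open>zs \<noteq> []\<close> by (cases zs) auto
    ultimately show ?thesis
      using path c(2) unfolding below_edges_def
      by (intro CollectI exI[of _ "zs @ [c']"]) (simp add: path_edge_def butlast_append)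
  qed
  obtain zs where zs: "simple_path G R zs b" using simple_path_exists neighbors_verts[OF nb(1)] by blast
  show "e \<in> below_edges G R [R]"
  \<comment> \<open>If \<open>a\<close> lies on the path to \<open>b\<close>, then \<open>b\<close>
    is the far end; otherwise the path extends to \<open>a\<close>, which is the far end.\<close>
  proof (cases "a \<in> set zs")
    case False
    then show ?thesis
      using concl[OF zs False nb(2) in_G(2)] in_G(1) edges_verts[OF in_G(1)] by (simp add: edge_between_def ab)
  next
    case True
    then obtain xs ys where xs: "zs = (xs @ [a]) @ ys" by (auto simp: in_set_conv_decomp)
    have "simple_path G R (xs @ [a]) a" using simple_path_prefix[of G R "xs @ [a]" ys b] zs xs by simp
    moreover have "b \<notin> set (xs @ [a])"
    proof -
      have "a \<noteq> b" using edges_verts[OF in_G(1)] by simp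
      then have "ys \<noteq> []" using simple_path_last[OF zs] xs by auto
      then have "b \<in> set ys" using simple_path_last[OF zs] xs by auto
      moreover have "distinct zs" using zs by (simp add: simple_path_def)
      ultimately show ?thesis unfolding xs distinct_append by blast
    qed
    ultimately show ?thesis
      using concl[OF _ _ nb(1) in_G(3)] in_G(1) by (simp add: edge_between_def ab)
  qed
qed

lemma below_marks_root: "below_marks G R n [R] = {1..n}"
proof -
  have "\<exists>zs. prefix [R] zs \<and> simple_path G R zs (mark G \<alpha>)" if \<alpha>: "\<alpha> \<in> {1..n}" for \<alpha>
  proof -
    obtain zs where "simple_path G R zs (mark G \<alpha>)" using simple_path_exists mark_props(1)[OF \<alpha>] by blast
    then show ?thesis using simple_path_hd by (metis Cons_prefix_Cons prefix_code(1))
  qed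
  then show ?thesis by (auto simp: below_marks_def)
qed

text \<open>The branches at the sink are joined without a further edge. A mark at the sink is
  attached to the second branch, where the amplitude applies its observable; at a trivalent sink the
  last two branches are joined, as in \<open>mu3_0\<close>. Balancing at the sink makes the total
  charge vanish.\<close>

lemma special_tree:
  assumes "special_tree_of G n R T"
  shows "\<exists>d1 d2. tree_describes G R (internal_edges G) {1..n} 0 (Join d1 d2) \<and> tvec d1 + tvec d2 = 0
    \<and> amplitude obs (leaf_state G) T = pairing (tstate obs d1) (tstate obs d2)"
proof -
  have C: "simple_path G R ([R] @ [w]) w \<longleftrightarrow> w \<in> neighbors G R" for w by (rule children_root)
  have E: "internal_edges G = (\<Union>w\<in>neighbors G R. below_edges G R ([R] @ [w]))"
    using below_edges_split[OF simple_path_root C] below_edges_root by simp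
  have M: "{1..n} = {\<alpha> \<in> {1..n}. mark G \<alpha> = R} \<union> (\<Union>w\<in>neighbors G R. below_marks G R n ([R] @ [w]))"
    using below_marks_split[OF simple_path_root C] unfolding below_marks_root .
  have branch: "\<exists>d. tree_describes G R (below_edges G R ([R] @ [w])) (below_marks G R n ([R] @ [w])) 0 d
    \<and> tvec d = directed_vec G w R \<and> branch_state obs (leaf_state G) t = tstate obs d"
    if "w \<in> neighbors G R" "branch_at G n R w t" for w t
    using branch_tree[OF that(2), of "[]"] C[of w] that(1) by simp
  from assms show ?thesis
  proof cases
    case (1 \<alpha> w1 w2 t1 t2)
    from branch[of w1 t1] obtain d1 where
      d1: "tree_describes G R (below_edges G R ([R] @ [w1])) (below_marks G R n ([R] @ [w1])) 0 d1"
        "tvec d1 = directed_vec G w1 R" "branch_state obs (leaf_state G) t1 = tstate obs d1"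
      using 1 by auto
    from branch[of w2 t2] obtain d2 where
      d2: "tree_describes G R (below_edges G R ([R] @ [w2])) (below_marks G R n ([R] @ [w2])) 0 d2"
        "tvec d2 = directed_vec G w2 R" "branch_state obs (leaf_state G) t2 = tstate obs d2"
      using 1 by auto
    have "{\<beta> \<in> {1..n}. mark G \<beta> = R} = {\<alpha>}" using 1(2,3) mark_inj by blast
    then have M': "{1..n} = below_marks G R n ([R] @ [w1]) \<union> insert \<alpha> (below_marks G R n ([R] @ [w2]))"
      using M 1(4) by auto
    have E': "internal_edges G = below_edges G R ([R] @ [w1]) \<union> below_edges G R ([R] @ [w2])"
      using E 1(4) by simp
    have R\<alpha>: "simple_path G R [R] (mark G \<alpha>)" using simple_path_root 1(3) by simp
    have "tree_describes G R (internal_edges G) {1..n} 0 (Join d1 (Mark \<alpha> d2))"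
      unfolding M' E'
    proof (rule tree_describes_Join[OF d1(1)])
      show "tree_describes G R (below_edges G R ([R] @ [w2])) (insert \<alpha> (below_marks G R n ([R] @ [w2]))) 0 (Mark \<alpha> d2)"
        by (rule tree_describes_Mark[OF d2(1) mark_notin_below[OF R\<alpha>] R\<alpha>]) simp
      show "below_edges G R ([R] @ [w1]) \<inter> below_edges G R ([R] @ [w2]) = {}"
        by (rule below_edges_disjoint[OF 1(5)])
      show "below_marks G R n ([R] @ [w1]) \<inter> insert \<alpha> (below_marks G R n ([R] @ [w2])) = {}"
        using below_marks_disjoint[OF 1(5), of "[R]"] mark_notin_below[OF R\<alpha>, of w1] by blast
    qed
    moreover have "tvec d1 + tvec (Mark \<alpha> d2) = 0"
      using balancing[OF R] 1(4,5) by (simp add: d1 d2)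
    moreover have "amplitude obs (leaf_state G) T = pairing (tstate obs d1) (tstate obs (Mark \<alpha> d2))"
      by (simp add: 1 d1 d2)
    ultimately show ?thesis by blast
  next
    case (2 w1 w2 w3 t1 t2 t3)
    from branch[of w1 t1] obtain d1 where
      d1: "tree_describes G R (below_edges G R ([R] @ [w1])) (below_marks G R n ([R] @ [w1])) 0 d1"
        "tvec d1 = directed_vec G w1 R" "branch_state obs (leaf_state G) t1 = tstate obs d1"
      using 2 by auto
    from branch[of w2 t2] obtain d2 where
      d2: "tree_describes G R (below_edges G R ([R] @ [w2])) (below_marks G R n ([R] @ [w2])) 0 d2"
        "tvec d2 = directed_vec G w2 R" "branch_state obs (leaf_state G) t2 = tstate obs d2"
      using 2 by auto
    from branch[of w3 t3] obtain d3 where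
      d3: "tree_describes G R (below_edges G R ([R] @ [w3])) (below_marks G R n ([R] @ [w3])) 0 d3"
        "tvec d3 = directed_vec G w3 R" "branch_state obs (leaf_state G) t3 = tstate obs d3"
      using 2 by auto
    have w: "w1 \<noteq> w2" "w1 \<noteq> w3" "w2 \<noteq> w3" using 2(3) by auto
    have card: "card (neighbors G R) = 3" using 2(2,3) by simp
    have "mark G \<beta> \<noteq> R" if \<beta>: "\<beta> \<in> {1..n}" for \<beta>
      using mark_props(2)[OF \<beta>] card by auto
    then have "{\<beta> \<in> {1..n}. mark G \<beta> = R} = {}" by blast
    then have M': "{1..n} = below_marks G R n ([R] @ [w1])
        \<union> (below_marks G R n ([R] @ [w2]) \<union> below_marks G R n ([R] @ [w3]))"
      using M 2(2) by auto
    have E': "internal_edges G = below_edges G R ([R] @ [w1])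
        \<union> (below_edges G R ([R] @ [w2]) \<union> below_edges G R ([R] @ [w3]))"
      using E 2(2) by auto
    have "tree_describes G R (internal_edges G) {1..n} 0 (Join d1 (Join d2 d3))"
      unfolding M' E'
    proof (rule tree_describes_Join[OF d1(1) tree_describes_Join[OF d2(1) d3(1)]])
      show "below_edges G R ([R] @ [w2]) \<inter> below_edges G R ([R] @ [w3]) = {}"
        "below_marks G R n ([R] @ [w2]) \<inter> below_marks G R n ([R] @ [w3]) = {}"
        by (rule below_edges_disjoint[OF w(3)] below_marks_disjoint[OF w(3)])+
      show "below_edges G R ([R] @ [w1]) \<inter> (below_edges G R ([R] @ [w2]) \<union> below_edges G R ([R] @ [w3])) = {}"
        using below_edges_disjoint[OF w(1), of "[R]"] below_edges_disjoint[OF w(2), of "[R]"] by blast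
      show "below_marks G R n ([R] @ [w1]) \<inter> (below_marks G R n ([R] @ [w2]) \<union> below_marks G R n ([R] @ [w3])) = {}"
        using below_marks_disjoint[OF w(1), of "[R]"] below_marks_disjoint[OF w(2), of "[R]"] by blast
    qed
    moreover have "tvec d1 + tvec (Join d2 d3) = 0"
      using balancing[OF R] 2(2) w by (simp add: d1 d2 d3)
    moreover have "amplitude obs (leaf_state G) T = pairing (tstate obs d1) (tstate obs (Join d2 d3))"
      by (simp add: 2 d1 d2 d3 mu3_0_def)
    ultimately show ?thesis by blast
  qed
qed

lemma ev_eq_tpos:
  assumes "tree_describes G R E M 0 d" "\<alpha> \<in> M" "\<alpha> \<in> {1..n}"
  shows "ev G R (mark G \<alpha>) = tpos d \<alpha>"
proof
  fix p :: "('v, 'n) mpt"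
  obtain zs where zs: "simple_path G R zs (mark G \<alpha>)" using simple_path_exists mark_props(1)[OF assms(3)] by blast
  then have the: "(THE xs. simple_path G R xs (mark G \<alpha>)) = zs"
    using simple_path_unique by blast
  obtain x y where p: "p = (x, y)" by (cases p)
  have "tpos d \<alpha> (x, y) = x + step_sum G y (drop 0 zs)"
    by (rule tree_describes_tpos[OF assms(1,2) zs])
  then show "ev G R (mark G \<alpha>) p = tpos d \<alpha> p"
    by (simp add: p ev_def the step_sum_def)
qed

lemma divisor_state_inj: "divisor_state b = divisor_state b' \<longleftrightarrow> b = b'" for b b' :: "int ^ 'n"
proof
  assume "divisor_state b = divisor_state b'"
  \<comment> \<open>The form 1 has a nonzero component in degree 0, so its value at charge
    \<open>b\<close> detects the charge.\<close>
  then have "divisor_state b b 0 [] = divisor_state b' b 0 []" by simp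
  then show "b = b'" by (simp add: divisor_state_def ket_def fun_form_def split: if_splits)
qed simp

text \<open>Every external edge starts at a leaf and every leaf has a single edge, so the states on
  leaves are counted by the vectors of external edges, that is, by the degree.\<close>

lemma card_leaves:
  "card {v \<in> leaves G. leaf_state G v = divisor_state b} = card {e \<in> external_edges G. mvec G e = b}"
proof (rule bij_betw_same_card[of fst, symmetric])
  have ext: "fst e \<in> leaves G" if "e \<in> external_edges G" for e
  proof -
    have "snd e \<notin> leaves G" using G that by (simp add: discrete_type_def)
    then show ?thesis using that by (simp add: external_edges_def)
  qed
  have leaf: "\<exists>p. neighbors G v = {p}" if "v \<in> leaves G" for v
    using that by (auto simp: leaf_iff card_1_singleton_iff)
  have the: "(THE e'. e' \<in> edges G \<and> fst e' = fst e) = e" if e: "e \<in> external_edges G" for e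
  proof -
    obtain p where p: "neighbors G (fst e) = {p}" using leaf[OF ext[OF e]] ..
    have "snd e \<in> neighbors G (fst e)" using e by (simp add: external_edges_def neighbors_def)
    then have "snd e = p" using p by simp
    then show ?thesis using leaf_edge(2)[OF ext[OF e] p] by (simp add: prod_eq_iff)
  qed
  show "bij_betw fst {e \<in> external_edges G. mvec G e = b} {v \<in> leaves G. leaf_state G v = divisor_state b}"
    unfolding bij_betw_def
  proof (intro conjI subset_antisym subsetI)
    show "inj_on fst {e \<in> external_edges G. mvec G e = b}"
    proof (rule inj_onI)
      fix e e' assume e: "e \<in> {e \<in> external_edges G. mvec G e = b}" "e' \<in> {e \<in> external_edges G. mvec G e = b}"
        and eq: "fst e = fst e'"
      have "e = (THE e'. e' \<in> edges G \<and> fst e' = fst e)" using e by (intro the[symmetric]) simp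
      also have "\<dots> = e'" unfolding eq using e by (intro the) simp
      finally show "e = e'" .
    qed
    fix v
    {
      assume "v \<in> fst ` {e \<in> external_edges G. mvec G e = b}"
      then obtain e where e: "e \<in> external_edges G" "mvec G e = b" "v = fst e" by blast
      then show "v \<in> {v \<in> leaves G. leaf_state G v = divisor_state b}"
        using ext[OF e(1)] by (simp only: leaf_state_def the[OF e(1)] mem_Collect_eq simp_thms)
    }
    assume "v \<in> {v \<in> leaves G. leaf_state G v = divisor_state b}"
    then have v: "v \<in> leaves G" "leaf_state G v = divisor_state b" by auto
    obtain p where p: "neighbors G v = {p}" using leaf[OF v(1)] ..
    have "mvec G (v, p) = b"
      using v(2) leaf_edge(2)[OF v(1) p] by (simp add: leaf_state_def divisor_state_inj)
    moreover have "(v, p) \<in> external_edges G"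
      using leaf_edge(1)[OF v(1) p] v(1) by (simp add: external_edges_def)
    ultimately show "v \<in> fst ` {e \<in> external_edges G. mvec G e = b}" by force
  qed
qed

end

section \<open>Comparison of the moduli integral with the amplitude\<close>

theorem theorem4p26:
  fixes F :: "(real ^ 'n) set set"
    and n :: nat
    and \<beta> :: "int ^ 'n \<Rightarrow> int"
    and c :: "nat \<Rightarrow> nat"
    and C :: "nat \<Rightarrow> 'n tform \<Rightarrow> real"
    and \<gamma> :: "nat \<Rightarrow> 'n tform"
    and G :: "('v, 'n) tropical_type"
    and R :: 'v
    and T :: "'v special_tree"
  assumes "complete_fan F"
    and "n \<ge> 3"
    and "\<beta> \<in> H2 F" and "\<beta> \<noteq> (\<lambda>_. 0)"
    and "\<And>\<alpha>. \<alpha> \<in> {1..n} \<Longrightarrow> c \<alpha> \<le> CARD('n)"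
    and "\<And>\<alpha>. \<alpha> \<in> {1..n} \<Longrightarrow> trop_cycle F (2 * c \<alpha>) (C \<alpha>)"
    and "\<And>\<alpha>. \<alpha> \<in> {1..n} \<Longrightarrow> represents_PD F (2 * c \<alpha>) (C \<alpha>) (\<gamma> \<alpha>)"
    and "discrete_type F n G"
    and "has_degree F G \<beta>"
    and "R \<in> verts G - leaves G"
    and "special_tree_of G n R T"
  shows "moduli_integral G
           (wedge_list (map (\<lambda>\<alpha>. ev_pullback G R (mark G \<alpha>) (\<gamma> \<alpha>)) [1..<Suc n]))
         = amplitude (\<lambda>\<alpha>. observable (\<gamma> \<alpha>)) (leaf_state G) T
       \<and> (\<forall>b\<in>normals F. int (card {v \<in> leaves G. leaf_state G v = divisor_state b}) = \<beta> b)"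
proof (intro conjI ballI)
  interpret rooted_type F n G R using assms(8,10) by (simp add: rooted_type_def)
  show "int (card {v \<in> leaves G. leaf_state G v = divisor_state b}) = \<beta> b" if "b \<in> normals F" for b
    using assms(9) that by (simp add: card_leaves has_degree_def)
  obtain d1 d2 where d: "tree_describes G R (internal_edges G) {1..n} 0 (Join d1 d2)"
    and vec: "tvec d1 + tvec d2 = 0"
    and amp: "amplitude (\<lambda>\<alpha>. observable (\<gamma> \<alpha>)) (leaf_state G) T
      = pairing (tstate (\<lambda>\<alpha>. observable (\<gamma> \<alpha>)) d1) (tstate (\<lambda>\<alpha>. observable (\<gamma> \<alpha>)) d2)"
    using special_tree[OF assms(11)] by blast
  have marks: "set (tmarks (Join d1 d2)) = {1..n}" "distinct (tmarks (Join d1 d2))"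
    and edges: "set (tedges (Join d1 d2)) = internal_edges G" "distinct (tedges (Join d1 d2))"
    using d unfolding tree_describes_def by blast+
  \<comment> \<open>A cycle of real dimension 2c has a dual of degree 2N - 2c, which is
    even.\<close>
  have \<gamma>: "\<gamma> \<alpha> \<in> trop_forms F" "grade_sign (\<gamma> \<alpha>) = \<gamma> \<alpha>" if "\<alpha> \<in> {1..n}" for \<alpha>
    using assms(7)[OF that] grade_sign_even[of "2 * CARD('n) - 2 * c \<alpha>" "\<gamma> \<alpha>"]
    by (simp_all add: represents_PD_def)
  have data: "trop_data F \<gamma> (Join d1 d2)"
    unfolding trop_data_def using assms(1) \<gamma>(1) marks edges by blast
  have "mset (tmarks (Join d1 d2)) = mset [1..<Suc n]"
    using marks by (metis atLeastLessThanSuc_atLeastAtMost distinct_upt set_eq_iff_mset_eq_distinct set_upt)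
  then show "moduli_integral G
           (wedge_list (map (\<lambda>\<alpha>. ev_pullback G R (mark G \<alpha>) (\<gamma> \<alpha>)) [1..<Suc n]))
         = amplitude (\<lambda>\<alpha>. observable (\<gamma> \<alpha>)) (leaf_state G) T"
    unfolding amp pairing_tstate[OF data vec]
    using ev_eq_tpos[OF d] \<gamma>(2) marks(1) edges(1)
    by (intro moduli_integral_eq[OF data]) simp_all
qed

end
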